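(* Let $(\Omega,\mu)$ be a $\sigma$-finite measure space, and let $X$ be an intermediate space for the interpolation couple $(L^1(\Omega),L^\infty(\Omega))$. Then the following are equivalent: (i) The space $X$ is an exact partially monotone space. (ii) The space $X$ is an exact partially $K$-monotone space. (iii) The space $X$ is an exact interpolation space for positive Gagliardo-Peetre operators. (iv) The space $X$ is an exact interpolation space for (admissible) order preserving, Lipschitz continuous operators with solid lattice domain. (v) The space $X$ is an exact interpolation space for (admissible) positive, linear operators.
   Context: All function spaces are real. Put $X_0=L^1(\Omega)$, $X_1=L^\infty(\Omega)$ and $\vec X=(X_0,X_1)$. The norms are $\|f\|_{X_0\cap X_1}=\|f\|_{X_0}+\|f\|_{X_1}$ and $\|f\|_{X_0+X_1}=\inf\{\|f_0\|_{X_0}+\|f_1\|_{X_1}: f_i\in X_i,\ f=f_0+f_1\}$. An intermediate space is a Banach space $X$ with $X_0\cap X_1\subseteq X\subseteq X_0+X_1$ with continuous embeddings. Write $f^+=f\vee 0$, $f^-=(-f)\vee 0$. Partially monotone spaces: for measurable $f$ let $f^*$ be its decreasing rearrangement and $f^{**}(t)=\frac1t\int_0^t f^*(s)\,ds$ ($t>0$). Write $g\preceq f$ if $g^{**}\le f^{**}$ pointwise everywhere, and $g\ll f$ if $g^+\preceq f^+$ and $g^-\preceq f^-$. $X$ is exactly partially monotone if for every $f\in X$ and $g\in L^1+L^\infty$: $g\ll f$ implies $g\in X$ and $\|g\|_X\le\|f\|_X$. Partially $K$-monotone spaces: $K(f,t)=\inf\{\|f_0\|_{X_0}+t\|f_1\|_{X_1}: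 f=f_0+f_1,\ f_i\in X_i\}$ for $f\in X_0+X_1$, $t\in(0,\infty)$. Write $g\ll_K f$ if $K(g^+,t)\le K(f^+,t)$ and $K(g^-,t)\le K(f^-,t)$ for all $t\in(0,\infty)$. $X$ is exactly partially $K$-monotone if for every $f\in X$ and $g\in X_0+X_1$: $g\ll_K f$ implies $g\in X$ and $\|g\|_X\le\|f\|_X$. Positive Gagliardo-Peetre operators: a (possibly nonlinear) operator $S:X_0+X_1\supseteq D_S\to X_0+X_1$ with nonempty domain $D_S$ is a positive Gagliardo-Peetre operator if there is $C\ge0$ such that for all $f\in D_S$, all $f_i\in X_i$ with $f=f_0+f_1$ and all $\varepsilon>0$ there exist $g_i\in X_i$ with $Sf=g_0+g_1$ and $\|g_i^+\|_{X_i}\le C\|f_i^+\|_{X_i}+\varepsilon$, $\|g_i^-\|_{X_i}\le C\|f_i^-\|_{X_i}+\varepsilon$ ($i=0,1$). The least such $C$ is $\|S\|_{GP^+}$. $X$ is an exact interpolation space for positive Gagliardo-Peetre operators if for every such $S$ and every $f\in X\cap D_S$ one has $Sf\in X$ and $\|Sf\|_X\le\|S\|_{GP^+}\|f\|_X$. Lipschitz operators: an operator $S:X_0+X_1\supseteq D_S\to X_0+X_1$ (with $D_S\neq\emptyset$) is an admissible Lipschitz operator if there is $C\ge0$ with $\|Sf-S\hat f\|_{X_i}\le C\|f-\hat f\|_{X_i}$ for all $f,\hat f\in D_S$, $i\in\{0,1\}$; the right-hand side is interpreted as $\infty$ if $f-\hat f\notin X_i$, and finiteness of the left-hand side means $Sf-S\hat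 f\in X_i$. The least such $C$ is $\|S\|_{Lip}$. $S$ is order preserving if $Sg\le Sf$ whenever $g\le f$. A subset $A$ of an ordered Banach space $Z$ is solid if $g\le h\le f$ with $f,g\in A$, $h\in Z$ implies $h\in A$; the domain $D_S$ is a (not necessarily linear) lattice if it is closed under $\vee$ and $\wedge$; it is a solid lattice if it is a lattice and solid in $X_0+X_1$. $X$ is an exact interpolation space for order preserving, Lipschitz continuous operators with solid lattice domain if for every admissible, order preserving Lipschitz operator $S$ whose domain is a solid lattice, and all $f,\hat f\in D_S$, $\|Sf-S\hat f\|_X\le\|S\|_{Lip}\|f-\hat f\|_X$ (same convention: the right-hand side is $\infty$ if $f-\hat f\notin X$, and finiteness of the left-hand side means $Sf-S\hat f\in X$). Positive linear operators: an admissible, positive, linear operator is a positive, linear $S:X_0+X_1\to X_0+X_1$ with $SX_i\subseteq X_i$ and $S|_{X_i}$ bounded on $X_i$ ($i=0,1$); put $\|S\|_{\mathcal L(\vec X)}=\max_{i}\|S\|_{\mathcal L(X_i)}$. $X$ is an exact interpolation space for positive, linear operators if for every such $S$ one has $SX\subseteq X$ and $\|S\|_{\mathcal L(X)}\le\|S\|_{\mathcal L(\vec X)}$. *)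

theory Defs
  imports "HOL-Analysis.Analysis" "HOL-Probability.Essential_Supremum"
begin

text \<open>
  Elements of the function spaces are classes of real measurable functions modulo equality
  almost everywhere.  They are represented here by their members: a space of classes is a set of
  measurable functions closed under a.e. equality, a map on classes is a map on functions that
  respects a.e. equality, and equalities and inequalities between elements are a.e. statements.
\<close>

definition ae_saturated :: "'a measure \<Rightarrow> ('a \<Rightarrow> real) set \<Rightarrow> bool" where
  "ae_saturated M Y \<longleftrightarrow> Y \<subseteq> borel_measurable M \<and>
     (\<forall>f\<in>Y. \<forall>g\<in>borel_measurable M. (AE x in M. f x = g x) \<longrightarrow> g \<in> Y)"

definition pos_part :: "('a \<Rightarrow> real) \<Rightarrow> 'a \<Rightarrow> real" where
  "pos_part f = (\<lambda>x. max (f x) 0)"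

definition neg_part :: "('a \<Rightarrow> real) \<Rightarrow> 'a \<Rightarrow> real" where
  "neg_part f = (\<lambda>x. max (- f x) 0)"


section \<open>The couple of integrable and essentially bounded functions\<close>

definition L1 :: "'a measure \<Rightarrow> ('a \<Rightarrow> real) set" where
  "L1 M = {f. integrable M f}"

definition L1_norm :: "'a measure \<Rightarrow> ('a \<Rightarrow> real) \<Rightarrow> real" where
  "L1_norm M f = (\<integral>x. \<bar>f x\<bar> \<partial>M)"

definition Linf :: "'a measure \<Rightarrow> ('a \<Rightarrow> real) set" where
  "Linf M = {f \<in> borel_measurable M. \<exists>C. AE x in M. \<bar>f x\<bar> \<le> C}"

text \<open>If the whole space is a null set, the essential supremum below is \<open>-\<infinity>\<close> and
  the norm is 0, as it should be.\<close>

definition Linf_norm :: "'a measure \<Rightarrow> ('a \<Rightarrow> real) \<Rightarrow> real" where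
  "Linf_norm M f = real_of_ereal (esssup M (\<lambda>x. ereal \<bar>f x\<bar>))"

definition Sum_space :: "'a measure \<Rightarrow> ('a \<Rightarrow> real) set" where
  "Sum_space M = {f \<in> borel_measurable M.
     \<exists>f0\<in>L1 M. \<exists>f1\<in>Linf M. AE x in M. f x = f0 x + f1 x}"

definition Sum_norm :: "'a measure \<Rightarrow> ('a \<Rightarrow> real) \<Rightarrow> real" where
  "Sum_norm M f = Inf {L1_norm M f0 + Linf_norm M f1 | f0 f1.
     f0 \<in> L1 M \<and> f1 \<in> Linf M \<and> (AE x in M. f x = f0 x + f1 x)}"

definition Int_norm :: "'a measure \<Rightarrow> ('a \<Rightarrow> real) \<Rightarrow> real" where
  "Int_norm M f = L1_norm M f + Linf_norm M f"

definition K_functional :: "'a measure \<Rightarrow> ('a \<Rightarrow> real) \<Rightarrow> real \<Rightarrow> real" where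
  "K_functional M f t = Inf {L1_norm M f0 + t * Linf_norm M f1 | f0 f1.
     f0 \<in> L1 M \<and> f1 \<in> Linf M \<and> (AE x in M. f x = f0 x + f1 x)}"


section \<open>Intermediate spaces\<close>

text \<open>A Banach space of classes of functions is given by a carrier \<open>Y\<close> and a norm \<open>nY\<close>;
  the values of \<open>nY\<close> outside \<open>Y\<close> are irrelevant.\<close>

definition banach_function_space ::
  "'a measure \<Rightarrow> ('a \<Rightarrow> real) set \<Rightarrow> (('a \<Rightarrow> real) \<Rightarrow> real) \<Rightarrow> bool" where
  "banach_function_space M Y nY \<longleftrightarrow>
     ae_saturated M Y \<and>
     (\<lambda>x. 0) \<in> Y \<and>
     (\<forall>f\<in>Y. \<forall>g\<in>Y. (\<lambda>x. f x + g x) \<in> Y) \<and>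
     (\<forall>c. \<forall>f\<in>Y. (\<lambda>x. c * f x) \<in> Y) \<and>
     (\<forall>f\<in>Y. \<forall>g\<in>Y. (AE x in M. f x = g x) \<longrightarrow> nY f = nY g) \<and>
     (\<forall>f\<in>Y. 0 \<le> nY f) \<and>
     (\<forall>f\<in>Y. nY f = 0 \<longleftrightarrow> (AE x in M. f x = 0)) \<and>
     (\<forall>c. \<forall>f\<in>Y. nY (\<lambda>x. c * f x) = \<bar>c\<bar> * nY f) \<and>
     (\<forall>f\<in>Y. \<forall>g\<in>Y. nY (\<lambda>x. f x + g x) \<le> nY f + nY g) \<and>
     (\<forall>F. (\<forall>n::nat. F n \<in> Y) \<and>
          (\<forall>\<epsilon>>0. \<exists>k. \<forall>m\<ge>k. \<forall>n\<ge>k. nY (\<lambda>x. F m x - F n x) < \<epsilon>) \<longrightarrow>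
          (\<exists>f\<in>Y. (\<lambda>n. nY (\<lambda>x. F n x - f x)) \<longlonglongrightarrow> 0))"

definition intermediate_space ::
  "'a measure \<Rightarrow> ('a \<Rightarrow> real) set \<Rightarrow> (('a \<Rightarrow> real) \<Rightarrow> real) \<Rightarrow> bool" where
  "intermediate_space M X nX \<longleftrightarrow>
     banach_function_space M X nX \<and>
     L1 M \<inter> Linf M \<subseteq> X \<and> X \<subseteq> Sum_space M \<and>
     (\<exists>c. \<forall>f \<in> L1 M \<inter> Linf M. nX f \<le> c * Int_norm M f) \<and>
     (\<exists>c. \<forall>f\<in>X. Sum_norm M f \<le> c * nX f)"


section \<open>Partially monotone and partially K-monotone spaces\<close>

definition decr_rearr :: "'a measure \<Rightarrow> ('a \<Rightarrow> real) \<Rightarrow> real \<Rightarrow> ennreal" where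
  "decr_rearr M f s =
     Inf {l. emeasure M {x \<in> space M. l < ennreal \<bar>f x\<bar>} \<le> ennreal s}"

definition max_rearr :: "'a measure \<Rightarrow> ('a \<Rightarrow> real) \<Rightarrow> real \<Rightarrow> ennreal" where
  "max_rearr M f t = (\<integral>\<^sup>+s\<in>{0..t}. decr_rearr M f s \<partial>lborel) / ennreal t"

definition submajorized :: "'a measure \<Rightarrow> ('a \<Rightarrow> real) \<Rightarrow> ('a \<Rightarrow> real) \<Rightarrow> bool" where
  "submajorized M g f \<longleftrightarrow> (\<forall>t>0. max_rearr M g t \<le> max_rearr M f t)"

definition partially_submajorized :: "'a measure \<Rightarrow> ('a \<Rightarrow> real) \<Rightarrow> ('a \<Rightarrow> real) \<Rightarrow> bool" where
  "partially_submajorized M g f \<longleftrightarrow>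
     submajorized M (pos_part g) (pos_part f) \<and> submajorized M (neg_part g) (neg_part f)"

definition exact_partially_monotone ::
  "'a measure \<Rightarrow> ('a \<Rightarrow> real) set \<Rightarrow> (('a \<Rightarrow> real) \<Rightarrow> real) \<Rightarrow> bool" where
  "exact_partially_monotone M X nX \<longleftrightarrow>
     (\<forall>f\<in>X. \<forall>g\<in>Sum_space M. partially_submajorized M g f \<longrightarrow> g \<in> X \<and> nX g \<le> nX f)"

definition partially_K_below :: "'a measure \<Rightarrow> ('a \<Rightarrow> real) \<Rightarrow> ('a \<Rightarrow> real) \<Rightarrow> bool" where
  "partially_K_below M g f \<longleftrightarrow>
     (\<forall>t>0. K_functional M (pos_part g) t \<le> K_functional M (pos_part f) t \<and>
            K_functional M (neg_part g) t \<le> K_functional M (neg_part f) t)"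

definition exact_partially_K_monotone ::
  "'a measure \<Rightarrow> ('a \<Rightarrow> real) set \<Rightarrow> (('a \<Rightarrow> real) \<Rightarrow> real) \<Rightarrow> bool" where
  "exact_partially_K_monotone M X nX \<longleftrightarrow>
     (\<forall>f\<in>X. \<forall>g\<in>Sum_space M. partially_K_below M g f \<longrightarrow> g \<in> X \<and> nX g \<le> nX f)"


section \<open>Operators\<close>

definition operator_on ::
  "'a measure \<Rightarrow> ('a \<Rightarrow> real) set \<Rightarrow> (('a \<Rightarrow> real) \<Rightarrow> 'a \<Rightarrow> real) \<Rightarrow> bool" where
  "operator_on M D S \<longleftrightarrow>
     D \<noteq> {} \<and> D \<subseteq> Sum_space M \<and> ae_saturated M D \<and> S ` D \<subseteq> Sum_space M \<and>
     (\<forall>f\<in>D. \<forall>g\<in>D. (AE x in M. f x = g x) \<longrightarrow> (AE x in M. S f x = S g x))"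


subsection \<open>Positive Gagliardo-Peetre operators\<close>

definition GP_bound ::
  "'a measure \<Rightarrow> ('a \<Rightarrow> real) set \<Rightarrow> (('a \<Rightarrow> real) \<Rightarrow> 'a \<Rightarrow> real) \<Rightarrow> real \<Rightarrow> bool" where
  "GP_bound M D S C \<longleftrightarrow> 0 \<le> C \<and>
     (\<forall>f\<in>D. \<forall>f0\<in>L1 M. \<forall>f1\<in>Linf M. \<forall>\<epsilon>>0. (AE x in M. f x = f0 x + f1 x) \<longrightarrow>
        (\<exists>g0\<in>L1 M. \<exists>g1\<in>Linf M. (AE x in M. S f x = g0 x + g1 x) \<and>
           L1_norm M (pos_part g0) \<le> C * L1_norm M (pos_part f0) + \<epsilon> \<and>
           L1_norm M (neg_part g0) \<le> C * L1_norm M (neg_part f0) + \<epsilon> \<and>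
           Linf_norm M (pos_part g1) \<le> C * Linf_norm M (pos_part f1) + \<epsilon> \<and>
           Linf_norm M (neg_part g1) \<le> C * Linf_norm M (neg_part f1) + \<epsilon>))"

definition positive_GP_operator ::
  "'a measure \<Rightarrow> ('a \<Rightarrow> real) set \<Rightarrow> (('a \<Rightarrow> real) \<Rightarrow> 'a \<Rightarrow> real) \<Rightarrow> bool" where
  "positive_GP_operator M D S \<longleftrightarrow> operator_on M D S \<and> (\<exists>C. GP_bound M D S C)"

text \<open>The bounds of an operator form a nonempty closed subset of \<open>[0, \<infinity>)\<close>
  (here and for Lipschitz operators below), so that the infimum is the least bound.\<close>

definition GP_norm ::
  "'a measure \<Rightarrow> ('a \<Rightarrow> real) set \<Rightarrow> (('a \<Rightarrow> real) \<Rightarrow> 'a \<Rightarrow> real) \<Rightarrow> real" where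
  "GP_norm M D S = Inf {C. GP_bound M D S C}"

definition exact_interpolation_GP ::
  "'a measure \<Rightarrow> ('a \<Rightarrow> real) set \<Rightarrow> (('a \<Rightarrow> real) \<Rightarrow> real) \<Rightarrow> bool" where
  "exact_interpolation_GP M X nX \<longleftrightarrow>
     (\<forall>D S. positive_GP_operator M D S \<longrightarrow>
        (\<forall>f \<in> X \<inter> D. S f \<in> X \<and> nX (S f) \<le> GP_norm M D S * nX f))"


subsection \<open>Order preserving Lipschitz operators\<close>

text \<open>The Lipschitz estimate in \<open>Y\<close> is void for pairs with difference outside \<open>Y\<close>
  (right-hand side \<open>\<infinity>\<close>), also when \<open>C = 0\<close>.\<close>

definition lipschitz_wrt ::
  "('a \<Rightarrow> real) set \<Rightarrow> (('a \<Rightarrow> real) \<Rightarrow> real) \<Rightarrow> ('a \<Rightarrow> real) set \<Rightarrow>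
   (('a \<Rightarrow> real) \<Rightarrow> 'a \<Rightarrow> real) \<Rightarrow> real \<Rightarrow> bool" where
  "lipschitz_wrt Y nY D S C \<longleftrightarrow>
     (\<forall>f\<in>D. \<forall>f'\<in>D. (\<lambda>x. f x - f' x) \<in> Y \<longrightarrow>
        (\<lambda>x. S f x - S f' x) \<in> Y \<and>
        nY (\<lambda>x. S f x - S f' x) \<le> C * nY (\<lambda>x. f x - f' x))"

definition Lip_bound ::
  "'a measure \<Rightarrow> ('a \<Rightarrow> real) set \<Rightarrow> (('a \<Rightarrow> real) \<Rightarrow> 'a \<Rightarrow> real) \<Rightarrow> real \<Rightarrow> bool" where
  "Lip_bound M D S C \<longleftrightarrow> 0 \<le> C \<and>
     lipschitz_wrt (L1 M) (L1_norm M) D S C \<and> lipschitz_wrt (Linf M) (Linf_norm M) D S C"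

definition admissible_Lipschitz ::
  "'a measure \<Rightarrow> ('a \<Rightarrow> real) set \<Rightarrow> (('a \<Rightarrow> real) \<Rightarrow> 'a \<Rightarrow> real) \<Rightarrow> bool" where
  "admissible_Lipschitz M D S \<longleftrightarrow> operator_on M D S \<and> (\<exists>C. Lip_bound M D S C)"

definition Lip_norm ::
  "'a measure \<Rightarrow> ('a \<Rightarrow> real) set \<Rightarrow> (('a \<Rightarrow> real) \<Rightarrow> 'a \<Rightarrow> real) \<Rightarrow> real" where
  "Lip_norm M D S = Inf {C. Lip_bound M D S C}"

definition order_preserving ::
  "'a measure \<Rightarrow> ('a \<Rightarrow> real) set \<Rightarrow> (('a \<Rightarrow> real) \<Rightarrow> 'a \<Rightarrow> real) \<Rightarrow> bool" where
  "order_preserving M D S \<longleftrightarrow>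
     (\<forall>f\<in>D. \<forall>g\<in>D. (AE x in M. g x \<le> f x) \<longrightarrow> (AE x in M. S g x \<le> S f x))"

definition solid_lattice :: "'a measure \<Rightarrow> ('a \<Rightarrow> real) set \<Rightarrow> bool" where
  "solid_lattice M D \<longleftrightarrow>
     (\<forall>f\<in>D. \<forall>g\<in>D. (\<lambda>x. max (f x) (g x)) \<in> D \<and> (\<lambda>x. min (f x) (g x)) \<in> D) \<and>
     (\<forall>f\<in>D. \<forall>g\<in>D. \<forall>h\<in>Sum_space M.
        (AE x in M. g x \<le> h x) \<and> (AE x in M. h x \<le> f x) \<longrightarrow> h \<in> D)"

definition exact_interpolation_Lipschitz ::
  "'a measure \<Rightarrow> ('a \<Rightarrow> real) set \<Rightarrow> (('a \<Rightarrow> real) \<Rightarrow> real) \<Rightarrow> bool" where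
  "exact_interpolation_Lipschitz M X nX \<longleftrightarrow>
     (\<forall>D S. admissible_Lipschitz M D S \<and> order_preserving M D S \<and> solid_lattice M D \<longrightarrow>
        lipschitz_wrt X nX D S (Lip_norm M D S))"


subsection \<open>Positive linear operators\<close>

definition positive_linear ::
  "'a measure \<Rightarrow> (('a \<Rightarrow> real) \<Rightarrow> 'a \<Rightarrow> real) \<Rightarrow> bool" where
  "positive_linear M S \<longleftrightarrow> operator_on M (Sum_space M) S \<and>
     (\<forall>f\<in>Sum_space M. \<forall>g\<in>Sum_space M.
        AE x in M. S (\<lambda>y. f y + g y) x = S f x + S g x) \<and>
     (\<forall>c. \<forall>f\<in>Sum_space M. AE x in M. S (\<lambda>y. c * f y) x = c * S f x) \<and>
     (\<forall>f\<in>Sum_space M. (AE x in M. 0 \<le> f x) \<longrightarrow> (AE x in M. 0 \<le> S f x))"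

definition bounded_on ::
  "('a \<Rightarrow> real) set \<Rightarrow> (('a \<Rightarrow> real) \<Rightarrow> real) \<Rightarrow> (('a \<Rightarrow> real) \<Rightarrow> 'a \<Rightarrow> real) \<Rightarrow> bool" where
  "bounded_on Y nY S \<longleftrightarrow> S ` Y \<subseteq> Y \<and> (\<exists>C. \<forall>f\<in>Y. nY (S f) \<le> C * nY f)"

text \<open>As for \<^const>\<open>onorm\<close>, the quotient is 0 if \<open>nY f = 0\<close>; the value is
  meaningful under \<^const>\<open>bounded_on\<close> only.\<close>

definition op_norm ::
  "('a \<Rightarrow> real) set \<Rightarrow> (('a \<Rightarrow> real) \<Rightarrow> real) \<Rightarrow> (('a \<Rightarrow> real) \<Rightarrow> 'a \<Rightarrow> real) \<Rightarrow> real" where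
  "op_norm Y nY S = (SUP f\<in>Y. nY (S f) / nY f)"

definition admissible_positive_linear ::
  "'a measure \<Rightarrow> (('a \<Rightarrow> real) \<Rightarrow> 'a \<Rightarrow> real) \<Rightarrow> bool" where
  "admissible_positive_linear M S \<longleftrightarrow> positive_linear M S \<and>
     bounded_on (L1 M) (L1_norm M) S \<and> bounded_on (Linf M) (Linf_norm M) S"

definition couple_op_norm :: "'a measure \<Rightarrow> (('a \<Rightarrow> real) \<Rightarrow> 'a \<Rightarrow> real) \<Rightarrow> real" where
  "couple_op_norm M S = max (op_norm (L1 M) (L1_norm M) S) (op_norm (Linf M) (Linf_norm M) S)"

definition exact_interpolation_positive_linear ::
  "'a measure \<Rightarrow> ('a \<Rightarrow> real) set \<Rightarrow> (('a \<Rightarrow> real) \<Rightarrow> real) \<Rightarrow> bool" where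
  "exact_interpolation_positive_linear M X nX \<longleftrightarrow>
     (\<forall>S. admissible_positive_linear M S \<longrightarrow>
        bounded_on X nX S \<and> op_norm X nX S \<le> couple_op_norm M S)"

end

theory Submission
  imports Defs
begin

text \<open>
  The five properties are connected by the equivalence of the two monotonicity notions and by a
  cycle leading from K-monotonicity through the three classes of operators back to K-monotonicity.

  For a function \<open>h \<ge> 0\<close> everything is governed by the excess \<open>E(c) = \<integral> (h - c)\<^sup>+\<close>: the K-functional
  is the infimum of \<open>E(c) + t c\<close> over \<open>c \<ge> 0\<close>, and so is the integral of the decreasing rearrangement
  over \<open>[0, t]\<close>, because \<open>h\<close> and its rearrangement have the same excesses.  Hence
  \<open>K(h, t) = t h\<^sup>*\<^sup>*(t)\<close> and the two monotonicity notions coincide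
  (\<open>K_functional_eq_rearr\<close>, \<open>exact_partially_monotone_iff\<close>).

  Three steps of the cycle are soft.  A positive Gagliardo-Peetre operator with bound \<open>C > 0\<close> maps
  \<open>f\<close> to a function K-below \<open>C f\<close>, since \<open>f\<close> can be decomposed without cancellation between its
  positive and negative parts (\<open>GP_bound_K_below\<close>).  A difference \<open>S f - S f'\<close> of values of an order
  preserving Lipschitz operator can be split along any splitting of \<open>f - f'\<close>, by moving from \<open>f'\<close>
  and from \<open>f\<close> to \<open>max f f'\<close> in two steps each (\<open>Lip_bound_split\<close>).  Positive linear operators are
  order preserving and Lipschitz.

  The last step is a theorem of Calderon type: if \<open>g\<close> is K-below \<open>f\<close> and \<open>r > 1\<close>, some positive
  linear operator of norm at most \<open>r\<^sup>4\<close> maps \<open>f\<close> to \<open>g\<close>.  The operator may be built separately for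
  positive and negative parts, so let \<open>f, g \<ge> 0\<close>.  Comparison of the K-functionals amounts to
  comparison of the excesses (\<open>excess_le_of_K_le\<close>).  Rounding \<open>g\<close> to powers of \<open>r\<close> leaves countably
  many cells of mass \<open>\<beta> i\<close> on which \<open>g\<close> is nearly a constant \<open>b i\<close>.  For each cell in turn one extracts
  from the domain of \<open>f\<close>, that is, from the mass still available there, an amount of mass at most
  \<open>\<beta> i\<close> whose \<open>f\<close>-integral is \<open>\<beta> i * b i\<close>.  The extracted mass is taken from an interval
  \<open>[p, q]\<close> of values of \<open>f\<close> around \<open>b i\<close>, leaving no mass with values strictly between \<open>p\<close> and \<open>q\<close>;
  such an interval exists by the intermediate value theorem (\<open>interval_weight_exists\<close>).  Among the
  extractions of the same mass and integral this one leaves the largest excess: outside \<open>[p, q]\<close> the excess of \<open>f\<close> drops by at most what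
  is taken away from the excess of \<open>g\<close>, while inside it becomes affine and therefore still dominates
  the convex excess of the cells that remain (\<open>residual_dominates\<close>).  So the extraction can be repeated
  for all cells (\<open>greedy_extraction\<close>).

  The argument requires \<open>E(c) < \<infinity>\<close> for all \<open>c > 0\<close>.  If \<open>f\<close> does not become small, only the
  part of \<open>f\<close> above a suitable height is treated in this way, and the remaining mass is supplied from
  a set of infinite measure on which \<open>f\<close> is nearly constant (\<open>match_levels\<close>).  Averaging over the
  extracted masses, with a multiplier at most \<open>r\<^sup>4\<close>, is the operator sought
  (\<open>K_below_imp_kernel_operator\<close>), and \<open>r \<rightarrow> 1\<close> gives the exact estimate.
\<close>

section \<open>Excess integrals and the K-functional\<close>

text \<open>Since \<open>ennreal\<close> sends negative numbers to 0, only the positive part of the function counts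
  here and in \<open>excess\<close> below.\<close>

abbreviation mass :: "'a measure \<Rightarrow> ('a \<Rightarrow> real) \<Rightarrow> ennreal" where
  "mass M u \<equiv> (\<integral>\<^sup>+x. ennreal (u x) \<partial>M)"

definition excess :: "'a measure \<Rightarrow> ('a \<Rightarrow> real) \<Rightarrow> real \<Rightarrow> ennreal" where
  "excess M f c = mass M (\<lambda>x. f x - c)"

lemma pos_part_measurable [measurable]: "f \<in> borel_measurable M \<Longrightarrow> pos_part f \<in> borel_measurable M"
  unfolding pos_part_def by measurable

lemma neg_part_measurable [measurable]: "f \<in> borel_measurable M \<Longrightarrow> neg_part f \<in> borel_measurable M"
  unfolding neg_part_def by measurable

lemma pos_part_nonneg [simp]: "0 \<le> pos_part f x" and neg_part_nonneg [simp]: "0 \<le> neg_part f x"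
  by (auto simp: pos_part_def neg_part_def)

lemma pos_part_minus_neg_part: "f x = pos_part f x - neg_part f x"
  by (auto simp: pos_part_def neg_part_def)

lemma L1_norm_nonneg [simp]: "0 \<le> L1_norm M f"
  unfolding L1_norm_def by simp

lemma ennreal_L1_norm: "f \<in> L1 M \<Longrightarrow> ennreal (L1_norm M f) = (\<integral>\<^sup>+x. ennreal \<bar>f x\<bar> \<partial>M)"
  unfolding L1_norm_def L1_def
  by (subst nn_integral_eq_integral) auto

lemma L1_iff_nn_integral:
  "f \<in> L1 M \<longleftrightarrow> f \<in> borel_measurable M \<and> (\<integral>\<^sup>+x. ennreal \<bar>f x\<bar> \<partial>M) < \<infinity>"
  unfolding L1_def integrable_iff_bounded by simp

lemma L1_norm_le_iff:
  assumes "f \<in> L1 M" "0 \<le> A"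
  shows "L1_norm M f \<le> A \<longleftrightarrow> (\<integral>\<^sup>+x. ennreal \<bar>f x\<bar> \<partial>M) \<le> ennreal A"
  using ennreal_L1_norm[OF assms(1)] assms(2) by (metis L1_norm_nonneg ennreal_le_iff)

lemma Linf_norm_le:
  assumes "f \<in> borel_measurable M" "0 \<le> C" "AE x in M. \<bar>f x\<bar> \<le> C"
  shows "Linf_norm M f \<le> C"
proof -
  have "esssup M (\<lambda>x. ereal \<bar>f x\<bar>) \<le> ereal C"
    using assms by (intro esssup_I) auto
  then show ?thesis
    unfolding Linf_norm_def using assms(2) by (cases "esssup M (\<lambda>x. ereal \<bar>f x\<bar>)") auto
qed

lemma Linf_norm_AE_nonneg:
  assumes "f \<in> Linf M"
  shows Linf_norm_AE: "AE x in M. \<bar>f x\<bar> \<le> Linf_norm M f"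
    and Linf_norm_nonneg: "0 \<le> Linf_norm M f"
proof -
  let ?e = "esssup M (\<lambda>x. ereal \<bar>f x\<bar>)"
  obtain C where C: "AE x in M. \<bar>f x\<bar> \<le> C" and [measurable]: "f \<in> borel_measurable M"
    using assms by (auto simp: Linf_def)
  have le: "?e \<le> ereal C" using C by (intro esssup_I) auto
  have ae: "AE x in M. ereal \<bar>f x\<bar> \<le> ?e" by (rule esssup_AE)
  show 1: "AE x in M. \<bar>f x\<bar> \<le> Linf_norm M f"
    using ae
  proof eventually_elim
    case (elim x)
    then show ?case unfolding Linf_norm_def using le by (cases ?e) auto
  qed
  show "0 \<le> Linf_norm M f"
  proof (rule ccontr)
    assume neg: "\<not> 0 \<le> Linf_norm M f"
    have "AE x in M. ereal \<bar>f x\<bar> \<le> - \<infinity>"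
      using 1 by eventually_elim (use neg in auto)
    then have "?e \<le> - \<infinity>" by (intro esssup_I) auto
    then show False using neg unfolding Linf_norm_def by auto
  qed
qed

lemma excess_antimono: "c \<le> c' \<Longrightarrow> excess M f c' \<le> excess M f c"
  unfolding excess_def by (intro nn_integral_mono ennreal_leI) auto

lemma excess_mono_AE: "(AE x in M. f x \<le> g x) \<Longrightarrow> excess M f c \<le> excess M g c"
  unfolding excess_def by (intro nn_integral_mono_AE) (auto intro: ennreal_leI elim!: eventually_mono)

lemma L1_measurable: "f \<in> L1 M \<Longrightarrow> f \<in> borel_measurable M"
  by (simp add: L1_def)

lemma Linf_measurable: "f \<in> Linf M \<Longrightarrow> f \<in> borel_measurable M"
  by (simp add: Linf_def)

lemma Sum_space_measurable: "f \<in> Sum_space M \<Longrightarrow> f \<in> borel_measurable M"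
  by (simp add: Sum_space_def)

lemma Sum_spaceI:
  "f \<in> borel_measurable M \<Longrightarrow> f0 \<in> L1 M \<Longrightarrow> f1 \<in> Linf M \<Longrightarrow> AE x in M. f x = f0 x + f1 x \<Longrightarrow>
   f \<in> Sum_space M"
  unfolding Sum_space_def by blast

text \<open>Subtracting the bounded summand costs at most its norm, so any decomposition controls an
  excess; conversely truncation at height \<open>c\<close> is itself a decomposition.\<close>

lemma excess_le_L1_norm:
  assumes "f0 \<in> L1 M" "f1 \<in> Linf M" "AE x in M. h x \<le> f0 x + f1 x"
  shows "excess M h (Linf_norm M f1) \<le> ennreal (L1_norm M f0)"
  unfolding ennreal_L1_norm[OF assms(1)] excess_def
proof (intro nn_integral_mono_AE)
  show "AE x in M. ennreal (h x - Linf_norm M f1) \<le> ennreal \<bar>f0 x\<bar>"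
    using assms(3) Linf_norm_AE[OF assms(2)]
    by eventually_elim (auto intro!: ennreal_leI)
qed

lemma truncation_decomposition:
  assumes [measurable]: "f \<in> borel_measurable M" and c: "0 \<le> c"
    and fin: "excess M (\<lambda>x. \<bar>f x\<bar>) c < \<infinity>"
  shows truncation_Linf: "(\<lambda>x. max (- c) (min c (f x))) \<in> Linf M"
    and truncation_L1: "(\<lambda>x. f x - max (- c) (min c (f x))) \<in> L1 M"
proof -
  show "(\<lambda>x. max (- c) (min c (f x))) \<in> Linf M"
    unfolding Linf_def using c by (auto intro!: exI[of _ c])
  have "(\<integral>\<^sup>+x. ennreal \<bar>f x - max (- c) (min c (f x))\<bar> \<partial>M) \<le> excess M (\<lambda>x. \<bar>f x\<bar>) c"
    unfolding excess_def
  proof (intro nn_integral_mono)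
    fix x show "ennreal \<bar>f x - max (- c) (min c (f x))\<bar> \<le> ennreal (\<bar>f x\<bar> - c)"
      by (cases "\<bar>f x\<bar> \<le> c") (auto simp: max_def min_def abs_if intro!: ennreal_leI)
  qed
  then show "(\<lambda>x. f x - max (- c) (min c (f x))) \<in> L1 M"
    using fin by (simp add: L1_iff_nn_integral)
qed

text \<open>Membership in the sum space is thus a condition on \<open>\<bar>f\<bar>\<close> alone, which makes the sum space
  stable under domination.\<close>

lemma Sum_space_iff:
  "f \<in> Sum_space M \<longleftrightarrow> f \<in> borel_measurable M \<and> (\<exists>c\<ge>0. excess M (\<lambda>x. \<bar>f x\<bar>) c < \<infinity>)"
proof safe
  assume f: "f \<in> Sum_space M"
  then show "f \<in> borel_measurable M" by (rule Sum_space_measurable)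
  obtain f0 f1 where d: "f0 \<in> L1 M" "f1 \<in> Linf M" "AE x in M. f x = f0 x + f1 x"
    using f by (auto simp: Sum_space_def)
  have a0: "(\<lambda>x. \<bar>f0 x\<bar>) \<in> L1 M" using d(1) by (simp add: L1_def)
  have a1: "(\<lambda>x. \<bar>f1 x\<bar>) \<in> Linf M" using d(2) by (auto simp: Linf_def)
  have "excess M (\<lambda>x. \<bar>f x\<bar>) (Linf_norm M (\<lambda>x. \<bar>f1 x\<bar>)) \<le> ennreal (L1_norm M (\<lambda>x. \<bar>f0 x\<bar>))"
    by (rule excess_le_L1_norm[OF a0 a1]) (use d(3) in \<open>auto elim!: eventually_mono\<close>)
  also have "\<dots> < \<infinity>" by simp
  finally show "\<exists>c\<ge>0. excess M (\<lambda>x. \<bar>f x\<bar>) c < \<infinity>"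
    using Linf_norm_nonneg[OF a1] by blast
next
  fix c :: real assume m: "f \<in> borel_measurable M" "0 \<le> c" "excess M (\<lambda>x. \<bar>f x\<bar>) c < \<infinity>"
  show "f \<in> Sum_space M"
    by (rule Sum_spaceI[OF m(1) truncation_L1[OF m] truncation_Linf[OF m]]) simp
qed

lemma Sum_space_dominated:
  assumes "f \<in> Sum_space M" "h \<in> borel_measurable M" "AE x in M. \<bar>h x\<bar> \<le> \<bar>f x\<bar>"
  shows "h \<in> Sum_space M"
proof -
  obtain c where c: "0 \<le> c" "excess M (\<lambda>x. \<bar>f x\<bar>) c < \<infinity>"
    using assms(1) by (auto simp: Sum_space_iff)
  have "excess M (\<lambda>x. \<bar>h x\<bar>) c \<le> excess M (\<lambda>x. \<bar>f x\<bar>) c"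
    using assms(3) by (rule excess_mono_AE)
  then show ?thesis using c assms(2) by (auto simp: Sum_space_iff intro: le_less_trans)
qed

lemma L1_add: "f \<in> L1 M \<Longrightarrow> g \<in> L1 M \<Longrightarrow> (\<lambda>x. f x + g x) \<in> L1 M"
  by (simp add: L1_def)

lemma L1_diff: "f \<in> L1 M \<Longrightarrow> g \<in> L1 M \<Longrightarrow> (\<lambda>x. f x - g x) \<in> L1 M"
  by (simp add: L1_def)

lemma L1_cmult: "f \<in> L1 M \<Longrightarrow> (\<lambda>x. c * f x) \<in> L1 M" for c :: real
  by (simp add: L1_def)

lemma L1_AE_cong: "f \<in> L1 M \<Longrightarrow> g \<in> borel_measurable M \<Longrightarrow> (AE x in M. f x = g x) \<Longrightarrow> g \<in> L1 M"
  unfolding L1_def using integrable_cong_AE[of f M g] by auto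

lemma L1_norm_AE_cong:
  "f \<in> borel_measurable M \<Longrightarrow> g \<in> borel_measurable M \<Longrightarrow> (AE x in M. f x = g x) \<Longrightarrow>
   L1_norm M f = L1_norm M g"
  unfolding L1_norm_def by (intro integral_cong_AE) (auto elim!: eventually_mono)

lemma L1_dominated:
  assumes "f \<in> L1 M" "h \<in> borel_measurable M" "AE x in M. \<bar>h x\<bar> \<le> \<bar>f x\<bar>"
  shows "h \<in> L1 M" "L1_norm M h \<le> L1_norm M f"
proof -
  show 1: "h \<in> L1 M" using assms unfolding L1_def
    by (auto intro: Bochner_Integration.integrable_bound)
  show "L1_norm M h \<le> L1_norm M f" using 1 assms unfolding L1_def L1_norm_def
    by (intro integral_mono_AE) auto
qed

lemma Linf_dominated:
  assumes "f \<in> Linf M" "h \<in> borel_measurable M" "AE x in M. \<bar>h x\<bar> \<le> \<bar>f x\<bar>"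
  shows "h \<in> Linf M" "Linf_norm M h \<le> Linf_norm M f"
proof -
  have ae: "AE x in M. \<bar>h x\<bar> \<le> Linf_norm M f"
    using assms(3) Linf_norm_AE[OF assms(1)] by eventually_elim auto
  then show "h \<in> Linf M" using assms(2) by (auto simp: Linf_def)
  show "Linf_norm M h \<le> Linf_norm M f"
    by (rule Linf_norm_le[OF assms(2) Linf_norm_nonneg[OF assms(1)] ae])
qed

lemma Linf_add: 
  assumes "f \<in> Linf M" "g \<in> Linf M" shows "(\<lambda>x. f x + g x) \<in> Linf M"
proof -
  obtain C D where "AE x in M. \<bar>f x\<bar> \<le> C" "AE x in M. \<bar>g x\<bar> \<le> D"
    using assms by (auto simp: Linf_def)
  then have "AE x in M. \<bar>f x + g x\<bar> \<le> C + D" by eventually_elim auto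
  then show ?thesis using assms by (auto simp: Linf_def)
qed

lemma Linf_cmult:
  assumes "f \<in> Linf M" shows "(\<lambda>x. c * f x) \<in> Linf M"
proof -
  obtain C where "AE x in M. \<bar>f x\<bar> \<le> C" using assms by (auto simp: Linf_def)
  then have "AE x in M. \<bar>c * f x\<bar> \<le> \<bar>c\<bar> * C" by eventually_elim (auto simp: abs_mult mult_left_mono)
  then show ?thesis using assms by (auto simp: Linf_def)
qed

lemma Linf_AE_cong: "f \<in> Linf M \<Longrightarrow> g \<in> borel_measurable M \<Longrightarrow> (AE x in M. f x = g x) \<Longrightarrow> g \<in> Linf M"
  by (rule Linf_dominated[of f]) (auto elim!: eventually_mono)

lemma Linf_norm_AE_cong:
  "f \<in> borel_measurable M \<Longrightarrow> g \<in> borel_measurable M \<Longrightarrow> (AE x in M. f x = g x) \<Longrightarrow>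
   Linf_norm M f = Linf_norm M g"
  unfolding Linf_norm_def by (intro arg_cong[where f=real_of_ereal] esssup_AE_cong) (auto elim!: eventually_mono)

lemma Sum_space_add:
  assumes "f \<in> Sum_space M" "g \<in> Sum_space M" shows "(\<lambda>x. f x + g x) \<in> Sum_space M"
proof -
  obtain f0 f1 where f: "f0 \<in> L1 M" "f1 \<in> Linf M" "AE x in M. f x = f0 x + f1 x"
    using assms(1) by (auto simp: Sum_space_def)
  obtain g0 g1 where g: "g0 \<in> L1 M" "g1 \<in> Linf M" "AE x in M. g x = g0 x + g1 x"
    using assms(2) by (auto simp: Sum_space_def)
  have "AE x in M. f x + g x = (f0 x + g0 x) + (f1 x + g1 x)"
    using f(3) g(3) by eventually_elim auto
  then show ?thesis
    using assms[THEN Sum_space_measurable]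
    by (intro Sum_spaceI[OF _ L1_add[OF f(1) g(1)] Linf_add[OF f(2) g(2)]]) auto
qed

lemma Sum_space_cmult:
  assumes "f \<in> Sum_space M" shows "(\<lambda>x. c * f x) \<in> Sum_space M"
proof -
  obtain f0 f1 where f: "f0 \<in> L1 M" "f1 \<in> Linf M" "AE x in M. f x = f0 x + f1 x"
    using assms(1) by (auto simp: Sum_space_def)
  have "AE x in M. c * f x = c * f0 x + c * f1 x"
    using f(3) by eventually_elim (auto simp: algebra_simps)
  then show ?thesis
    using assms[THEN Sum_space_measurable]
    by (intro Sum_spaceI[OF _ L1_cmult[OF f(1)] Linf_cmult[OF f(2)]]) auto
qed

lemma Sum_space_diff: "f \<in> Sum_space M \<Longrightarrow> g \<in> Sum_space M \<Longrightarrow> (\<lambda>x. f x - g x) \<in> Sum_space M"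
  using Sum_space_add[of f M "\<lambda>x. - 1 * g x"] Sum_space_cmult[of g M "- 1"] by simp

lemma Sum_space_zero: "(\<lambda>x. 0) \<in> Sum_space M"
  by (auto simp: Sum_space_iff excess_def intro!: exI[of _ 0])

lemma L1_zero: "(\<lambda>x. 0) \<in> L1 M" and Linf_zero: "(\<lambda>x. 0) \<in> Linf M"
  by (auto simp: L1_def Linf_def)

lemma L1_subset_Sum: "f \<in> L1 M \<Longrightarrow> f \<in> Sum_space M"
  by (rule Sum_spaceI[OF L1_measurable _ Linf_zero, of f _ f]) auto

lemma Linf_subset_Sum: "f \<in> Linf M \<Longrightarrow> f \<in> Sum_space M"
  by (rule Sum_spaceI[OF Linf_measurable L1_zero, of f _ f]) auto

lemma ae_saturated_Sum_space: "ae_saturated M (Sum_space M)"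
  unfolding ae_saturated_def
proof (intro conjI ballI impI subsetI)
  fix f g assume "f \<in> Sum_space M" "g \<in> borel_measurable M" "AE x in M. f x = g x"
  then show "g \<in> Sum_space M"
    by - (rule Sum_space_dominated[of f M g], assumption+, erule eventually_mono, simp)
qed (rule Sum_space_measurable)

lemma pos_part_Sum: "f \<in> Sum_space M \<Longrightarrow> pos_part f \<in> Sum_space M"
  by (rule Sum_space_dominated[OF _ pos_part_measurable[OF Sum_space_measurable]]) (auto simp: pos_part_def)

lemma neg_part_Sum: "f \<in> Sum_space M \<Longrightarrow> neg_part f \<in> Sum_space M"
  by (rule Sum_space_dominated[OF _ neg_part_measurable[OF Sum_space_measurable]]) (auto simp: neg_part_def)

lemma excess_finite_nonneg:
  assumes "h \<in> Sum_space M" "\<And>x. 0 \<le> h x"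
  obtains c where "0 \<le> c" "excess M h c < \<infinity>"
proof -
  obtain c where c: "0 \<le> c" "excess M (\<lambda>x. \<bar>h x\<bar>) c < \<infinity>"
    using assms(1) unfolding Sum_space_iff by blast
  have "(\<lambda>x. \<bar>h x\<bar>) = h" by (intro ext abs_of_nonneg assms(2))
  from that[OF c(1)] c(2)[unfolded this] show ?thesis by blast
qed

text \<open>For a nonnegative function the K-functional is the infimum of \<open>excess M h c + t * c\<close> over
  \<open>c \<ge> 0\<close>.  Truncation at height \<open>c\<close> gives the upper bound.  For the lower bound, a decomposition
  \<open>h = f0 + f1\<close> is compared with the height \<open>c = \<parallel>f1\<parallel>\<close>.\<close>

lemma K_functional_le:
  assumes h [measurable]: "h \<in> borel_measurable M" and nn: "\<And>x. 0 \<le> h x" and "0 \<le> c" "0 \<le> A" "0 \<le> t"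
    and ex: "excess M h c \<le> ennreal A"
  shows "K_functional M h t \<le> A + t * c"
proof -
  let ?h1 = "\<lambda>x. max (- c) (min c (h x))" and ?h0 = "\<lambda>x. h x - max (- c) (min c (h x))"
  have abs: "(\<lambda>x. \<bar>h x\<bar>) = h" by (intro ext abs_of_nonneg nn)
  have fin: "excess M (\<lambda>x. \<bar>h x\<bar>) c < \<infinity>" unfolding abs using ex by (rule le_less_trans) simp
  have h1: "?h1 \<in> Linf M" and h0: "?h0 \<in> L1 M"
    by (rule truncation_Linf truncation_L1; fact)+
  have "(\<integral>\<^sup>+x. ennreal \<bar>?h0 x\<bar> \<partial>M) = excess M h c"
    unfolding excess_def
  proof (intro nn_integral_cong)
    fix x show "ennreal \<bar>?h0 x\<bar> = ennreal (h x - c)"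
      using nn[of x] \<open>0 \<le> c\<close> by (auto simp: max_def min_def ennreal_neg)
  qed
  then have n0: "L1_norm M ?h0 \<le> A" using ex L1_norm_le_iff[OF h0 \<open>0 \<le> A\<close>] by simp
  have n1: "Linf_norm M ?h1 \<le> c" using assms(3) by (intro Linf_norm_le) auto
  have "K_functional M h t \<le> L1_norm M ?h0 + t * Linf_norm M ?h1"
    unfolding K_functional_def
  proof (rule cInf_lower)
    show "bdd_below {L1_norm M f0 + t * Linf_norm M f1 | f0 f1.
     f0 \<in> L1 M \<and> f1 \<in> Linf M \<and> (AE x in M. h x = f0 x + f1 x)}"
      using \<open>0 \<le> t\<close>
      by (auto intro!: bdd_belowI[of _ 0] add_nonneg_nonneg mult_nonneg_nonneg Linf_norm_nonneg)
    show "L1_norm M ?h0 + t * Linf_norm M ?h1 \<in> {L1_norm M f0 + t * Linf_norm M f1 | f0 f1.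
        f0 \<in> L1 M \<and> f1 \<in> Linf M \<and> (AE x in M. h x = f0 x + f1 x)}"
      by (rule CollectI, rule exI[of _ ?h0], rule exI[of _ ?h1]) (use h0 h1 in simp)
  qed
  also have "\<dots> \<le> A + t * c" using n0 n1 \<open>0 \<le> t\<close> by (intro add_mono mult_left_mono)
  finally show ?thesis .
qed

lemma K_functional_ge:
  assumes h: "h \<in> Sum_space M"
    and lower: "\<And>c A. 0 \<le> c \<Longrightarrow> 0 \<le> A \<Longrightarrow> excess M h c \<le> ennreal A \<Longrightarrow> B \<le> A + t * c"
  shows "B \<le> K_functional M h t"
  unfolding K_functional_def
proof (rule cInf_greatest)
  show "{L1_norm M f0 + t * Linf_norm M f1 | f0 f1.
     f0 \<in> L1 M \<and> f1 \<in> Linf M \<and> (AE x in M. h x = f0 x + f1 x)} \<noteq> {}"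
    using h by (auto simp: Sum_space_def)
next
  fix y assume "y \<in> {L1_norm M f0 + t * Linf_norm M f1 | f0 f1.
     f0 \<in> L1 M \<and> f1 \<in> Linf M \<and> (AE x in M. h x = f0 x + f1 x)}"
  then obtain f0 f1 where d: "f0 \<in> L1 M" "f1 \<in> Linf M" "AE x in M. h x = f0 x + f1 x"
    and y: "y = L1_norm M f0 + t * Linf_norm M f1" by blast
  have "excess M h (Linf_norm M f1) \<le> ennreal (L1_norm M f0)"
    by (rule excess_le_L1_norm[OF d(1,2)]) (use d(3) in \<open>auto elim: eventually_mono\<close>)
  from lower[OF Linf_norm_nonneg[OF d(2)] L1_norm_nonneg this] show "B \<le> y" unfolding y .
qed

section \<open>The maximal rearrangement as a K-functional\<close>

text \<open>As a function of \<open>l\<close> this is the distribution function of \<open>h\<close>.\<close>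

abbreviation superlevel :: "'a measure \<Rightarrow> ('a \<Rightarrow> real) \<Rightarrow> real \<Rightarrow> ennreal" where
  "superlevel M h l \<equiv> emeasure M {x\<in>space M. l < h x}"

text \<open>Right continuity of the distribution function, in the form in which it is used.\<close>

lemma superlevel_approx:
  assumes [measurable]: "h \<in> borel_measurable M"
    and s: "s < superlevel M h l"
  obtains e :: real where "0 < e" "s < superlevel M h (l + e)"
proof -
  let ?A = "\<lambda>n. {x\<in>space M. l + 1 / Suc n < h x}"
  have "(\<Union>n. ?A n) = {x\<in>space M. l < h x}"
  proof safe
    fix x assume "l < h x"
    then obtain n where "1 / Suc n < h x - l" using nat_approx_posE[of "h x - l"] by auto
    moreover assume "x \<in> space M"
    ultimately show "x \<in> (\<Union>n. ?A n)" by (auto intro!: exI[of _ n])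
  next
    fix x n assume "l + 1 / real (Suc n) < h x"
    moreover have "0 < 1 / real (Suc n)" by simp
    ultimately show "l < h x" by linarith
  qed
  moreover have "(SUP n. emeasure M (?A n)) = emeasure M (\<Union>n. ?A n)"
  proof (rule SUP_emeasure_incseq)
    show "incseq ?A"
    proof (intro incseq_SucI subsetI)
      fix n x assume "x \<in> ?A n"
      moreover have "1 / real (Suc (Suc n)) \<le> 1 / real (Suc n)" by (simp add: field_simps)
      ultimately show "x \<in> ?A (Suc n)" by auto
    qed
  qed auto
  ultimately have "s < (SUP n. emeasure M (?A n))" using s by (simp only:)
  then obtain n where "s < emeasure M (?A n)" unfolding less_SUP_iff by blast
  then show ?thesis by (intro that[of "1 / Suc n"]) auto
qed

lemma superlevel_markov:
  assumes [measurable]: "h \<in> borel_measurable M" and "c \<le> l"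
  shows "ennreal (l - c) * superlevel M h l \<le> excess M h c"
proof -
  have "ennreal (l - c) * superlevel M h l =
      (\<integral>\<^sup>+x. ennreal (l - c) * indicator {x\<in>space M. l < h x} x \<partial>M)"
    by (subst nn_integral_cmult_indicator) auto
  also have "\<dots> \<le> excess M h c"
    unfolding excess_def using assms(2)
    by (intro nn_integral_mono) (auto simp: indicator_def intro!: ennreal_leI)
  finally show ?thesis .
qed

lemma superlevel_finite:
  assumes "h \<in> borel_measurable M" "c < l" "excess M h c < \<infinity>"
  shows "superlevel M h l < \<infinity>"
proof (rule ccontr)
  assume "\<not> ?thesis"
  then have "superlevel M h l = \<infinity>" by (simp add: less_top[symmetric])
  then have "ennreal (l - c) * \<infinity> \<le> excess M h c"
    using superlevel_markov[OF assms(1), of c l] assms(2) by simp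
  then show False using assms(2,3) by (simp add: ennreal_mult_top)
qed

lemma superlevel_small:
  assumes h: "h \<in> borel_measurable M" and fin: "excess M h c < \<infinity>" and t: "0 < t"
  obtains l where "c \<le> l" "0 \<le> l" "superlevel M h l \<le> ennreal t"
proof -
  obtain E where E: "0 \<le> E" "excess M h c = ennreal E"
    using fin by (cases "excess M h c") auto
  define l where "l = max 0 c + (E + 1) / t"
  have cl: "(E + 1) / t \<le> l - c" "0 < (E + 1) / t" using t E by (auto simp: l_def)
  have fin': "superlevel M h l < \<infinity>"
    by (rule superlevel_finite[OF h _ fin]) (use cl in linarith)
  then obtain m where m: "0 \<le> m" "superlevel M h l = ennreal m"
    by (cases "superlevel M h l") auto
  have "ennreal ((l - c) * m) \<le> ennreal E"
    using superlevel_markov[OF h, of c l] m cl E by (simp add: ennreal_mult)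
  then have "(l - c) * m \<le> E" using E by (simp add: ennreal_le_iff)
  moreover have "(E + 1) / t * m \<le> (l - c) * m" using cl m by (intro mult_right_mono) auto
  ultimately have "(E + 1) / t * m \<le> E" by linarith
  then have "(E + 1) * m \<le> E * t" using t by (simp add: field_simps)
  then have "(E + 1) * m \<le> (E + 1) * t" using t by (simp add: algebra_simps)
  then have "m \<le> t" using E by simp
  moreover have "0 \<le> (E + 1) / t" "0 \<le> l" using t E by (auto simp: l_def)
  ultimately show ?thesis using that[of l] m cl by (auto intro: ennreal_leI)
qed

lemma decr_rearr_antimono: "s \<le> s' \<Longrightarrow> decr_rearr M h s' \<le> decr_rearr M h s"
  unfolding decr_rearr_def
  by (intro Inf_superset_mono) (auto intro: order_trans ennreal_leI)

text \<open>The rearrangement is the generalized inverse of the distribution function; the strict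
  inequalities on both sides rest on the right continuity of the latter.\<close>

lemma decr_rearr_less_iff:
  assumes h [measurable]: "h \<in> borel_measurable M" and nn: "\<And>x. 0 \<le> h x" and l: "0 \<le> l"
  shows "ennreal l < decr_rearr M h s \<longleftrightarrow> ennreal s < superlevel M h l"
proof
  assume less: "ennreal l < decr_rearr M h s"
  have "\<not> emeasure M {x\<in>space M. ennreal l < ennreal \<bar>h x\<bar>} \<le> ennreal s"
  proof
    assume "emeasure M {x\<in>space M. ennreal l < ennreal \<bar>h x\<bar>} \<le> ennreal s"
    then have "decr_rearr M h s \<le> ennreal l"
      unfolding decr_rearr_def by (intro Inf_lower) simp
    then show False using less by simp
  qed
  also have "{x\<in>space M. ennreal l < ennreal \<bar>h x\<bar>} = {x\<in>space M. l < h x}"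
    using nn l by (auto simp: ennreal_less_iff)
  finally show "ennreal s < superlevel M h l" by simp
next
  assume "ennreal s < superlevel M h l"
  then obtain e where e: "0 < e" "ennreal s < superlevel M h (l + e)"
    by (rule superlevel_approx[OF h])
  have "ennreal (l + e) \<le> decr_rearr M h s"
    unfolding decr_rearr_def
  proof (rule Inf_greatest)
    fix y assume "y \<in> {l. emeasure M {x\<in>space M. l < ennreal \<bar>h x\<bar>} \<le> ennreal s}"
    then have y: "emeasure M {x\<in>space M. y < ennreal \<bar>h x\<bar>} \<le> ennreal s" by simp
    show "ennreal (l + e) \<le> y"
    proof (rule ccontr)
      assume "\<not> ?thesis"
      then have "{x\<in>space M. l + e < h x} \<subseteq> {x\<in>space M. y < ennreal \<bar>h x\<bar>}"
      proof safe
        fix x assume "l + e < h x"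
        then have "ennreal (l + e) < ennreal \<bar>h x\<bar>" using e l by (intro ennreal_lessI) auto
        with \<open>\<not> ennreal (l + e) \<le> y\<close> show "y < ennreal \<bar>h x\<bar>" by (auto simp: not_le)
      qed
      then have "superlevel M h (l + e) \<le> emeasure M {x\<in>space M. y < ennreal \<bar>h x\<bar>}"
        by (intro emeasure_mono) auto
      then show False using e(2) y by simp
    qed
  qed
  moreover have "ennreal l < ennreal (l + e)" using e l by (simp add: ennreal_less_iff)
  ultimately show "ennreal l < decr_rearr M h s" by simp
qed

lemma borel_measurable_antimono_ennreal:
  fixes F :: "real \<Rightarrow> ennreal"
  assumes "\<And>x y. x \<le> y \<Longrightarrow> F y \<le> F x"
  shows "F \<in> borel_measurable borel"
proof (rule borel_measurableI_greater)
  fix y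
  have "is_interval {x \<in> space borel. y < F x}"
    using assms by (auto simp: is_interval_1 intro: less_le_trans)
  then show "{x \<in> space borel. y < F x} \<in> sets borel" by (rule real_interval_borel_measurable)
qed

lemma emeasure_lborel_atLeast: "emeasure lborel {c::real..} = \<infinity>"
proof (rule ccontr)
  assume "\<not> ?thesis"
  then obtain n :: nat where n: "emeasure lborel {c..} < of_nat n"
    using ennreal_Ex_less_of_nat[of "emeasure lborel {c..}"] by (auto simp: less_top)
  have "of_nat n = emeasure lborel {c..<c + real n}" by (simp add: ennreal_of_nat_eq_real_of_nat)
  also have "\<dots> \<le> emeasure lborel {c..}" by (intro emeasure_mono) auto
  finally show False using n by simp
qed

lemma ennreal_le_diff_add: "y \<le> (y - c) + (c :: ennreal)"
  by (cases "c \<le> y") (auto simp: diff_add_cancel_ennreal not_le intro: order_trans[OF less_imp_le])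

lemma ennreal_diff_layers:
  assumes "0 \<le> c"
  shows "y - ennreal c = (\<integral>\<^sup>+l. indicator {l. c \<le> l \<and> ennreal l < y} l \<partial>lborel)"
proof (cases y)
  case (real r)
  have "{l. c \<le> l \<and> ennreal l < y} = {c..<r}"
    using real assms by (auto simp: ennreal_less_iff)
  then show ?thesis using real assms
    by (cases "c \<le> r") (simp_all add: ennreal_minus ennreal_neg)
next
  case top
  have "{l. c \<le> l \<and> ennreal l < y} = {c..}" using top by auto
  then show ?thesis using top emeasure_lborel_atLeast[of c] by simp
qed

context sigma_finite_measure
begin

text \<open>Integration over \<open>{(x, l). c \<le> l < h x}\<close> in both orders.\<close>

lemma excess_layer_cake:
  assumes h [measurable]: "h \<in> borel_measurable M" and nn: "\<And>x. 0 \<le> h x" and c: "0 \<le> c"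
  shows "excess M h c = (\<integral>\<^sup>+l. superlevel M h l * indicator {c..} l \<partial>lborel)"
proof -
  interpret pair_sigma_finite M lborel ..
  have "excess M h c = (\<integral>\<^sup>+x. (\<integral>\<^sup>+l. indicator {c..} l * indicator {(x, l). l < h x} (x, l) \<partial>lborel) \<partial>M)"
    unfolding excess_def
  proof (intro nn_integral_cong)
    fix x
    have "ennreal (h x - c) = ennreal (h x) - ennreal c" using c by (simp add: ennreal_minus)
    also have "\<dots> = (\<integral>\<^sup>+l. indicator {c..} l * indicator {(x, l). l < h x} (x, l) \<partial>lborel)"
      unfolding ennreal_diff_layers[OF c]
      using c nn[of x] by (intro nn_integral_cong) (auto simp: indicator_def ennreal_less_iff)
    finally show "ennreal (h x - c) = \<dots>" .
  qed
  also have "\<dots> = (\<integral>\<^sup>+l. (\<integral>\<^sup>+x. indicator {c..} l * indicator {(x, l). l < h x} (x, l) \<partial>M) \<partial>lborel)"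
    by (rule Fubini'[symmetric]) measurable
  also have "\<dots> = (\<integral>\<^sup>+l. superlevel M h l * indicator {c..} l \<partial>lborel)"
  proof (intro nn_integral_cong)
    fix l :: real
    have "(\<integral>\<^sup>+x. indicator {c..} l * indicator {(x, l). l < h x} (x, l) \<partial>M) =
        (\<integral>\<^sup>+x. indicator {c..} l * indicator {x\<in>space M. l < h x} x \<partial>M)"
      by (intro nn_integral_cong) (auto simp: indicator_def)
    also have "\<dots> = superlevel M h l * indicator {c..} l"
      by (subst nn_integral_cmult_indicator) (auto simp: mult.commute)
    finally show "(\<integral>\<^sup>+x. indicator {c..} l * indicator {(x, l). l < h x} (x, l) \<partial>M) = \<dots>" .
  qed
  finally show ?thesis .
qed

lemma decr_rearr_measurable [measurable]: "decr_rearr M h \<in> borel_measurable borel"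
  by (rule borel_measurable_antimono_ennreal) (rule decr_rearr_antimono)

lemma superlevel_measurable [measurable]:
  fixes h :: "'a \<Rightarrow> real"
  assumes [measurable]: "h \<in> borel_measurable M"
  shows "(\<lambda>l. superlevel M h l) \<in> borel_measurable borel"
proof (rule borel_measurable_antimono_ennreal)
  fix x y :: real assume "x \<le> y"
  then show "superlevel M h y \<le> superlevel M h x"
    by (intro emeasure_mono) auto
qed

text \<open>A function and its decreasing rearrangement have the same superlevel masses, hence, by
  integration over the levels, the same excesses.\<close>

lemma excess_decr_rearr:
  assumes h [measurable]: "h \<in> borel_measurable M" and nn: "\<And>x. 0 \<le> h x" and c: "0 \<le> c"
  shows "(\<integral>\<^sup>+s. (decr_rearr M h s - ennreal c) * indicator {0..} s \<partial>lborel) = excess M h c"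
proof -
  let ?I = "\<lambda>s l. indicator {0..} s * indicator {c..} l *
      indicator {(s, l). ennreal s < superlevel M h l} (s, l) :: ennreal"
  have "(\<integral>\<^sup>+s. (decr_rearr M h s - ennreal c) * indicator {0..} s \<partial>lborel) =
      (\<integral>\<^sup>+s. (\<integral>\<^sup>+l. ?I s l \<partial>lborel) \<partial>lborel)"
  proof (intro nn_integral_cong)
    fix s :: real
    have "(decr_rearr M h s - ennreal c) * indicator {0..} s =
      (\<integral>\<^sup>+l. indicator {l. c \<le> l \<and> ennreal l < decr_rearr M h s} l \<partial>lborel) * indicator {0..} s"
      by (subst ennreal_diff_layers[OF c]) simp
    also have "\<dots> = (\<integral>\<^sup>+l. ?I s l \<partial>lborel)"
    proof (cases "0 \<le> s")
      case True
      then have ind: "indicator {0..} s = (1::ennreal)" by simp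
      show ?thesis unfolding ind mult_1_right mult_1_left
        using c True by (intro nn_integral_cong)
          (auto simp: indicator_def decr_rearr_less_iff[OF h nn])
    qed simp
    finally show "(decr_rearr M h s - ennreal c) * indicator {0..} s = \<dots>" .
  qed
  also have "\<dots> = (\<integral>\<^sup>+l. (\<integral>\<^sup>+s. ?I s l \<partial>lborel) \<partial>lborel)"
    by (rule lborel_pair.Fubini'[symmetric]) measurable
  also have "\<dots> = (\<integral>\<^sup>+l. superlevel M h l * indicator {c..} l \<partial>lborel)"
  proof (intro nn_integral_cong)
    fix l :: real
    let ?m = "superlevel M h l"
    have "(\<integral>\<^sup>+s. ?I s l \<partial>lborel) = (\<integral>\<^sup>+s. indicator {c..} l * indicator {s. 0 \<le> s \<and> ennreal s < ?m} s \<partial>lborel)"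
      by (intro nn_integral_cong) (auto simp: indicator_def)
    also have "\<dots> = indicator {c..} l * (\<integral>\<^sup>+s. indicator {s. 0 \<le> s \<and> ennreal s < ?m} s \<partial>lborel)"
      by (rule nn_integral_cmult) measurable
    also have "\<dots> = ?m * indicator {c..} l"
      using ennreal_diff_layers[of 0 ?m] by (simp add: mult.commute)
    finally show "(\<integral>\<^sup>+s. ?I s l \<partial>lborel) = \<dots>" .
  qed
  also have "\<dots> = excess M h c" by (rule excess_layer_cake[OF h nn c, symmetric])
  finally show ?thesis .
qed

text \<open>The integral of the rearrangement over \<open>[0, t]\<close> is the minimum over \<open>c\<close> of
  \<open>excess M h c + t * c\<close>, attained at \<open>c = decr_rearr M h t\<close>.\<close>

lemma K_functional_eq_rearr:
  assumes h: "h \<in> Sum_space M" and nn: "\<And>x. 0 \<le> h x" and t: "0 < t"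
  shows "ennreal (K_functional M h t) = (\<integral>\<^sup>+s\<in>{0..t}. decr_rearr M h s \<partial>lborel)"
proof -
  note [measurable] = Sum_space_measurable[OF h]
  note hm = Sum_space_measurable[OF h]
  let ?J = "\<integral>\<^sup>+s\<in>{0..t}. decr_rearr M h s \<partial>lborel"
  have J_le: "?J \<le> excess M h c + ennreal (t * c)" if c: "0 \<le> c" for c
  proof -
    have "?J \<le> (\<integral>\<^sup>+s. (decr_rearr M h s - ennreal c) * indicator {0..} s + ennreal c * indicator {0..t} s \<partial>lborel)"
    proof (intro nn_integral_mono)
      fix s :: real
      have "decr_rearr M h s \<le> (decr_rearr M h s - ennreal c) + ennreal c"
        by (rule ennreal_le_diff_add)
      then show "decr_rearr M h s * indicator {0..t} s \<le>
        (decr_rearr M h s - ennreal c) * indicator {0..} s + ennreal c * indicator {0..t} s"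
        by (auto simp: indicator_def)
    qed
    also have "\<dots> = excess M h c + ennreal c * emeasure lborel {0..t}"
      by (subst nn_integral_add) (auto simp: excess_decr_rearr[OF hm nn c] nn_integral_cmult_indicator)
    also have "\<dots> = excess M h c + ennreal (t * c)"
      using t c by (simp add: ennreal_mult[symmetric] mult.commute)
    finally show ?thesis .
  qed
  obtain c0 where c0: "0 \<le> c0" "excess M h c0 < \<infinity>"
    using excess_finite_nonneg[OF h nn] by blast
  obtain l where l: "0 \<le> l" "superlevel M h l \<le> ennreal t"
    using superlevel_small[OF hm c0(2) t] by blast
  then have "decr_rearr M h t \<le> ennreal l"
    using decr_rearr_less_iff[OF hm nn l(1), of t] by (simp add: not_less[symmetric])
  then obtain c where c: "0 \<le> c" "decr_rearr M h t = ennreal c"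
    by (cases "decr_rearr M h t") (auto simp: top_unique)
  have J_fin: "?J < \<infinity>"
    by (rule le_less_trans[OF J_le[OF c0(1)]]) (use c0(2) in simp)
  have J_eq: "?J = excess M h c + ennreal (t * c)"
  proof -
    have "excess M h c = (\<integral>\<^sup>+s. (decr_rearr M h s - ennreal c) * indicator {0..t} s \<partial>lborel)"
      unfolding excess_decr_rearr[OF hm nn c(1), symmetric]
    proof (intro nn_integral_cong)
      fix s :: real
      show "(decr_rearr M h s - ennreal c) * indicator {0..} s =
        (decr_rearr M h s - ennreal c) * indicator {0..t} s"
        using decr_rearr_antimono[of t s M h] c
        by (cases "s \<le> t")
          (auto simp: indicator_def intro!: diff_eq_0_ennreal le_less_trans[of "decr_rearr M h s" "ennreal c" top])
    qed
    moreover have "ennreal (t * c) = (\<integral>\<^sup>+s. ennreal c * indicator {0..t} s \<partial>lborel)"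
      using t c by (subst nn_integral_cmult_indicator) (auto simp: ennreal_mult[symmetric] mult.commute)
    moreover have "?J = (\<integral>\<^sup>+s. (decr_rearr M h s - ennreal c) * indicator {0..t} s + ennreal c * indicator {0..t} s \<partial>lborel)"
    proof (intro nn_integral_cong)
      fix s :: real
      have "ennreal c \<le> decr_rearr M h s" if "s \<le> t"
        using decr_rearr_antimono[OF that, of M h] c by simp
      then show "decr_rearr M h s * indicator {0..t} s =
        (decr_rearr M h s - ennreal c) * indicator {0..t} s + ennreal c * indicator {0..t} s"
        by (auto simp: indicator_def diff_add_cancel_ennreal)
    qed
    ultimately show ?thesis by (simp only:) (rule nn_integral_add; measurable)
  qed
  obtain A where A: "0 \<le> A" "excess M h c = ennreal A"
    using J_fin unfolding J_eq by (cases "excess M h c") auto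
  have "?J = ennreal (A + t * c)" using A c t unfolding J_eq by (simp add: ennreal_plus)
  moreover have "K_functional M h t = A + t * c"
  proof (rule antisym)
    show "K_functional M h t \<le> A + t * c"
      using K_functional_le[OF hm nn c(1) A(1)] t A(2) by simp
    show "A + t * c \<le> K_functional M h t"
    proof (rule K_functional_ge[OF h])
      fix c' B assume cB: "0 \<le> c'" "0 \<le> B" "excess M h c' \<le> ennreal B"
      have "ennreal (A + t * c) \<le> excess M h c' + ennreal (t * c')"
        using J_le[OF cB(1)] \<open>?J = ennreal (A + t * c)\<close> by simp
      also have "\<dots> \<le> ennreal (B + t * c')"
        using cB t by (simp add: ennreal_plus add_right_mono)
      finally show "A + t * c \<le> B + t * c'" using cB t by (subst (asm) ennreal_le_iff) auto
    qed
  qed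
  ultimately show ?thesis by simp
qed

lemma submajorized_iff_K:
  assumes "g \<in> Sum_space M" "\<And>x. 0 \<le> g x" "f \<in> Sum_space M" "\<And>x. 0 \<le> f x"
  shows "submajorized M g f \<longleftrightarrow> (\<forall>t>0. K_functional M g t \<le> K_functional M f t)"
proof -
  have "max_rearr M g t \<le> max_rearr M f t \<longleftrightarrow> K_functional M g t \<le> K_functional M f t"
    if t: "0 < t" for t
  proof -
    have "0 \<le> K_functional M f t"
      using t by (intro K_functional_ge[OF assms(3)]) auto
    then show ?thesis
      unfolding max_rearr_def K_functional_eq_rearr[OF assms(1,2) t, symmetric]
        K_functional_eq_rearr[OF assms(3,4) t, symmetric]
      using t by (simp add: divide_ennreal_def ennreal_mult_le_mult_iff mult.commute[of _ "inverse _"] ennreal_le_iff ennreal_zero_less_divide)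
  qed
  then show ?thesis unfolding submajorized_def by auto
qed

lemma exact_partially_monotone_iff:
  assumes "X \<subseteq> Sum_space M"
  shows "exact_partially_monotone M X nX \<longleftrightarrow> exact_partially_K_monotone M X nX"
proof -
  have "partially_submajorized M g f \<longleftrightarrow> partially_K_below M g f"
    if "f \<in> X" "g \<in> Sum_space M" for f g
  proof -
    have f: "f \<in> Sum_space M" using that assms by auto
    show ?thesis
      unfolding partially_submajorized_def partially_K_below_def
      using that(2) f
      by (subst (1 2) submajorized_iff_K) (auto intro: pos_part_Sum neg_part_Sum)
  qed
  then show ?thesis
    unfolding exact_partially_monotone_def exact_partially_K_monotone_def by blast
qed

end

section \<open>Passing along the chain of operator classes\<close>

lemma le_mult_epsilon:
  fixes x a b :: real
  assumes le: "\<And>d. 0 < d \<Longrightarrow> x \<le> (a + d) * b" and b: "0 \<le> b"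
  shows "x \<le> a * b"
proof (rule field_le_epsilon)
  fix e :: real assume e: "0 < e"
  have "x \<le> (a + e / (b + 1)) * b" using e b by (intro le) auto
  also have "\<dots> = a * b + e * (b / (b + 1))" by (simp add: algebra_simps)
  also have "e * (b / (b + 1)) \<le> e * 1" using e b by (intro mult_left_mono) auto
  finally show "x \<le> a * b + e" by simp
qed

lemma intermediate_spaceD:
  assumes "intermediate_space M X nX"
  shows "X \<subseteq> Sum_space M" "ae_saturated M X" "(\<lambda>x. 0) \<in> X"
    "f \<in> X \<Longrightarrow> g \<in> X \<Longrightarrow> (AE x in M. f x = g x) \<Longrightarrow> nX f = nX g"
    "f \<in> X \<Longrightarrow> (\<lambda>x. c * f x) \<in> X" "f \<in> X \<Longrightarrow> nX (\<lambda>x. c * f x) = \<bar>c\<bar> * nX f"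
    "f \<in> X \<Longrightarrow> 0 \<le> nX f"
  using assms unfolding intermediate_space_def banach_function_space_def by blast+

lemma ae_saturatedD:
  "ae_saturated M Y \<Longrightarrow> f \<in> Y \<Longrightarrow> g \<in> borel_measurable M \<Longrightarrow> (AE x in M. f x = g x) \<Longrightarrow> g \<in> Y"
  unfolding ae_saturated_def by blast

lemma excess_cmult:
  assumes [measurable]: "h \<in> borel_measurable M" and "0 \<le> C"
  shows "excess M (\<lambda>x. C * h x) (C * c) = ennreal C * excess M h c"
  unfolding excess_def using assms(2)
  by (subst nn_integral_cmult[symmetric])
    (auto intro!: nn_integral_cong simp: ennreal_mult'[symmetric] right_diff_distrib)

lemma pos_part_L1: "f \<in> L1 M \<Longrightarrow> pos_part f \<in> L1 M"
  by (rule L1_dominated(1)[OF _ pos_part_measurable[OF L1_measurable]]) (auto simp: pos_part_def)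

lemma neg_part_L1: "f \<in> L1 M \<Longrightarrow> neg_part f \<in> L1 M"
  by (rule L1_dominated(1)[OF _ neg_part_measurable[OF L1_measurable]]) (auto simp: neg_part_def)

lemma pos_part_Linf: "f \<in> Linf M \<Longrightarrow> pos_part f \<in> Linf M"
  by (rule Linf_dominated(1)[OF _ pos_part_measurable[OF Linf_measurable]]) (auto simp: pos_part_def)

lemma neg_part_Linf: "f \<in> Linf M \<Longrightarrow> neg_part f \<in> Linf M"
  by (rule Linf_dominated(1)[OF _ neg_part_measurable[OF Linf_measurable]]) (auto simp: neg_part_def)

subsection \<open>From K-monotonicity to Gagliardo-Peetre operators\<close>

text \<open>The splitting of a value of an operator which a positive Gagliardo-Peetre bound asks for, with
  separate bounds for the four parts.\<close>

definition signed_splitting ::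
  "'a measure \<Rightarrow> ('a \<Rightarrow> real) \<Rightarrow> real \<Rightarrow> real \<Rightarrow> real \<Rightarrow> real \<Rightarrow> bool" where
  "signed_splitting M w A A' c c' \<longleftrightarrow>
     (\<exists>g0\<in>L1 M. \<exists>g1\<in>Linf M. (AE x in M. w x = g0 x + g1 x) \<and>
        L1_norm M (pos_part g0) \<le> A \<and> L1_norm M (neg_part g0) \<le> A' \<and>
        Linf_norm M (pos_part g1) \<le> c \<and> Linf_norm M (neg_part g1) \<le> c')"

lemma signed_splitting_mono:
  "signed_splitting M w A A' c c' \<Longrightarrow> A \<le> B \<Longrightarrow> A' \<le> B' \<Longrightarrow> c \<le> d \<Longrightarrow> c' \<le> d' \<Longrightarrow>
   signed_splitting M w B B' d d'"
  unfolding signed_splitting_def by (meson order_trans)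

lemma GP_bound_iff:
  "GP_bound M D S C \<longleftrightarrow> 0 \<le> C \<and>
     (\<forall>f\<in>D. \<forall>f0\<in>L1 M. \<forall>f1\<in>Linf M. \<forall>\<epsilon>>0. (AE x in M. f x = f0 x + f1 x) \<longrightarrow>
        signed_splitting M (S f)
          (C * L1_norm M (pos_part f0) + \<epsilon>) (C * L1_norm M (neg_part f0) + \<epsilon>)
          (C * Linf_norm M (pos_part f1) + \<epsilon>) (C * Linf_norm M (neg_part f1) + \<epsilon>))"
  unfolding GP_bound_def signed_splitting_def ..

lemma GP_bound_mono:
  assumes "GP_bound M D S C" "C \<le> C'"
  shows "GP_bound M D S C'"
  unfolding GP_bound_iff
proof (intro conjI ballI allI impI)
  show "0 \<le> C'" using assms by (auto simp: GP_bound_def)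
  fix f f0 f1 and \<epsilon> :: real
  assume a: "f \<in> D" "f0 \<in> L1 M" "f1 \<in> Linf M" "0 < \<epsilon>" "AE x in M. f x = f0 x + f1 x"
  have le: "C * n + \<epsilon> \<le> C' * n + \<epsilon>" if "0 \<le> n" for n
    using mult_right_mono[OF assms(2) that] by simp
  have "signed_splitting M (S f)
      (C * L1_norm M (pos_part f0) + \<epsilon>) (C * L1_norm M (neg_part f0) + \<epsilon>)
      (C * Linf_norm M (pos_part f1) + \<epsilon>) (C * Linf_norm M (neg_part f1) + \<epsilon>)"
    using assms(1) a unfolding GP_bound_iff by blast
  then show "signed_splitting M (S f)
      (C' * L1_norm M (pos_part f0) + \<epsilon>) (C' * L1_norm M (neg_part f0) + \<epsilon>)
      (C' * Linf_norm M (pos_part f1) + \<epsilon>) (C' * Linf_norm M (neg_part f1) + \<epsilon>)"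
    by (rule signed_splitting_mono)
      (intro le L1_norm_nonneg Linf_norm_nonneg pos_part_Linf neg_part_Linf a)+
qed

text \<open>Truncating \<open>f\<^sup>+\<close> and \<open>f\<^sup>-\<close> independently at heights \<open>c\<close> and \<open>c'\<close> decomposes \<open>f\<close> without
  cancellation: the parts of the two summands are the summands of the parts.\<close>

lemma signed_truncation:
  assumes [measurable]: "f \<in> borel_measurable M" and c: "0 \<le> c" "0 \<le> c'" and A: "0 \<le> A" "0 \<le> A'"
    and ex: "excess M (pos_part f) c \<le> ennreal A" "excess M (neg_part f) c' \<le> ennreal A'"
  obtains f0 f1 where "f0 \<in> L1 M" "f1 \<in> Linf M" "\<And>x. f x = f0 x + f1 x"
    "L1_norm M (pos_part f0) \<le> A" "L1_norm M (neg_part f0) \<le> A'"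
    "Linf_norm M (pos_part f1) \<le> c" "Linf_norm M (neg_part f1) \<le> c'"
proof -
  define f1 where "f1 x = max (- c') (min c (f x))" for x
  define f0 where "f0 x = f x - f1 x" for x
  have [measurable]: "f1 \<in> borel_measurable M" "f0 \<in> borel_measurable M"
    unfolding f0_def[abs_def] f1_def[abs_def] by measurable
  have p0: "(\<integral>\<^sup>+x. ennreal \<bar>pos_part f0 x\<bar> \<partial>M) = excess M (pos_part f) c"
    unfolding excess_def
  proof (intro nn_integral_cong)
    fix x show "ennreal \<bar>pos_part f0 x\<bar> = ennreal (pos_part f x - c)"
      using c by (auto simp: f0_def f1_def pos_part_def max_def min_def ennreal_neg)
  qed
  have n0: "(\<integral>\<^sup>+x. ennreal \<bar>neg_part f0 x\<bar> \<partial>M) = excess M (neg_part f) c'"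
    unfolding excess_def
  proof (intro nn_integral_cong)
    fix x show "ennreal \<bar>neg_part f0 x\<bar> = ennreal (neg_part f x - c')"
      using c by (auto simp: f0_def f1_def neg_part_def max_def min_def ennreal_neg)
  qed
  have L: "pos_part f0 \<in> L1 M" "neg_part f0 \<in> L1 M"
    using p0 n0 ex by (auto simp: L1_iff_nn_integral intro: le_less_trans)
  have "f0 = (\<lambda>x. pos_part f0 x - neg_part f0 x)" by (rule ext) (rule pos_part_minus_neg_part)
  then have "f0 \<in> L1 M" using L1_diff[OF L] by simp
  moreover have "f1 \<in> Linf M"
    unfolding Linf_def using c by (auto simp: f1_def intro!: exI[of _ "max c c'"])
  moreover have "L1_norm M (pos_part f0) \<le> A" "L1_norm M (neg_part f0) \<le> A'"
    using L1_norm_le_iff[OF L(1) A(1)] L1_norm_le_iff[OF L(2) A(2)] p0 n0 ex by auto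
  moreover have "Linf_norm M (pos_part f1) \<le> c" "Linf_norm M (neg_part f1) \<le> c'"
    using c by (auto intro!: Linf_norm_le simp: pos_part_def neg_part_def f1_def)
  ultimately show ?thesis by (intro that[of f0 f1]) (auto simp: f0_def)
qed

text \<open>The decomposition of \<open>f\<close> without cancellation makes the estimates of the operator separate:
  the positive part of \<open>S f\<close> is dominated by the sum of the positive parts of the two summands of
  \<open>S f\<close>, and these are controlled by the truncation of \<open>f\<^sup>+\<close> alone.  So the height at which
  \<open>f\<^sup>-\<close> is truncated may be any height of finite excess when \<open>f\<^sup>+\<close> is considered, and vice
  versa.\<close>

lemma GP_bound_K_below:
  assumes S: "GP_bound M D S C" and C: "0 < C" and f: "f \<in> D" "f \<in> Sum_space M" "S f \<in> Sum_space M"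
  shows "partially_K_below M (S f) (\<lambda>x. C * f x)"
proof -
  note [measurable] = Sum_space_measurable[OF f(2)] Sum_space_measurable[OF f(3)]
  have key: "signed_splitting M (S f) (C * A + \<epsilon>) (C * A' + \<epsilon>) (C * c + \<epsilon>) (C * c' + \<epsilon>)"
    if h: "0 \<le> c" "0 \<le> c'" "0 \<le> A" "0 \<le> A'" "excess M (pos_part f) c \<le> ennreal A"
      "excess M (neg_part f) c' \<le> ennreal A'" "0 < \<epsilon>" for c c' A A' \<epsilon> :: real
  proof -
    obtain f0 f1 where d: "f0 \<in> L1 M" "f1 \<in> Linf M" "\<And>x. f x = f0 x + f1 x"
      "L1_norm M (pos_part f0) \<le> A" "L1_norm M (neg_part f0) \<le> A'"
      "Linf_norm M (pos_part f1) \<le> c" "Linf_norm M (neg_part f1) \<le> c'"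
      by (rule signed_truncation[OF _ h(1-6)]) auto
    have "signed_splitting M (S f)
        (C * L1_norm M (pos_part f0) + \<epsilon>) (C * L1_norm M (neg_part f0) + \<epsilon>)
        (C * Linf_norm M (pos_part f1) + \<epsilon>) (C * Linf_norm M (neg_part f1) + \<epsilon>)"
      using S f(1) d(1,2) h(7) AE_I2[of M "\<lambda>x. f x = f0 x + f1 x", OF d(3)]
      unfolding GP_bound_iff by blast
    then show ?thesis by (rule signed_splitting_mono) (use C d(4-7) in auto)
  qed
  obtain c1 where c1: "0 \<le> c1" "excess M (pos_part f) c1 < \<infinity>"
    by (rule excess_finite_nonneg[OF pos_part_Sum[OF f(2)]]) auto
  then obtain A1 where A1: "0 \<le> A1" "excess M (pos_part f) c1 \<le> ennreal A1"
    by (cases "excess M (pos_part f) c1") auto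
  obtain c2 where c2: "0 \<le> c2" "excess M (neg_part f) c2 < \<infinity>"
    by (rule excess_finite_nonneg[OF neg_part_Sum[OF f(2)]]) auto
  then obtain A2 where A2: "0 \<le> A2" "excess M (neg_part f) c2 \<le> ennreal A2"
    by (cases "excess M (neg_part f) c2") auto
  have K_le: "K_functional M h t \<le> K_functional M (\<lambda>x. C * p x) t"
    if t: "0 < t" and [measurable]: "h \<in> borel_measurable M" "p \<in> borel_measurable M"
      and h: "\<And>x. 0 \<le> h x" and p: "\<And>x. 0 \<le> p x" "(\<lambda>x. C * p x) \<in> Sum_space M"
      and step: "\<And>c A \<epsilon>. 0 \<le> c \<Longrightarrow> 0 \<le> A \<Longrightarrow> excess M p c \<le> ennreal A \<Longrightarrow> 0 < \<epsilon> \<Longrightarrow>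
        \<exists>g0\<in>L1 M. \<exists>g1\<in>Linf M. (AE x in M. h x \<le> g0 x + g1 x) \<and>
           L1_norm M g0 \<le> C * A + \<epsilon> \<and> Linf_norm M g1 \<le> C * c + \<epsilon>"
    for h p t
  proof (rule K_functional_ge[OF p(2)])
    fix c A :: real assume cA: "0 \<le> c" "0 \<le> A" "excess M (\<lambda>x. C * p x) c \<le> ennreal A"
    have "ennreal C * excess M p (c / C) \<le> ennreal C * ennreal (A / C)"
      using excess_cmult[of p M C "c / C"] cA C by (simp add: ennreal_mult[symmetric])
    then have ex: "excess M p (c / C) \<le> ennreal (A / C)"
      using C by (subst (asm) ennreal_mult_le_mult_iff) auto
    show "K_functional M h t \<le> A + t * c"
    proof (rule field_le_epsilon)
      fix e :: real assume e: "0 < e"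
      \<comment> \<open>An error \<open>\<epsilon>\<close> in each of the two norms costs \<open>(1 + t) * \<epsilon>\<close> in the K-functional.\<close>
      define \<epsilon> where "\<epsilon> = e / (1 + t)"
      have "(1 + t) * \<epsilon> = e" using t by (simp add: \<epsilon>_def)
      then have \<epsilon>: "0 < \<epsilon>" "\<epsilon> + t * \<epsilon> = e"
        using e t by (simp add: \<epsilon>_def, simp only: distrib_right mult_1_left)
      obtain g0 g1 where g: "g0 \<in> L1 M" "g1 \<in> Linf M" "AE x in M. h x \<le> g0 x + g1 x"
          "L1_norm M g0 \<le> C * (A / C) + \<epsilon>" "Linf_norm M g1 \<le> C * (c / C) + \<epsilon>"
        using step[OF _ _ ex \<epsilon>(1)] cA C by auto
      have "K_functional M h t \<le> L1_norm M g0 + t * Linf_norm M g1"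
        using excess_le_L1_norm[OF g(1-3)] Linf_norm_nonneg[OF g(2)] t h
        by (intro K_functional_le) auto
      also have "\<dots> \<le> (A + \<epsilon>) + t * (c + \<epsilon>)"
        using g(4,5) C t by (intro add_mono mult_left_mono) auto
      also have "\<dots> = A + t * c + e" using \<epsilon>(2) by (simp add: algebra_simps)
      finally show "K_functional M h t \<le> A + t * c + e" .
    qed
  qed
  have scal: "pos_part (\<lambda>x. C * f x) = (\<lambda>x. C * pos_part f x)" "neg_part (\<lambda>x. C * f x) = (\<lambda>x. C * neg_part f x)"
    using C by (auto simp: pos_part_def neg_part_def fun_eq_iff max_def zero_le_mult_iff mult_le_0_iff)
  show ?thesis
    unfolding partially_K_below_def scal
  proof (intro allI impI conjI)
    fix t :: real assume t: "0 < t"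
    show "K_functional M (pos_part (S f)) t \<le> K_functional M (\<lambda>x. C * pos_part f x) t"
    proof (rule K_le[OF t])
      fix c A \<epsilon> :: real
      assume h: "0 \<le> c" "0 \<le> A" "excess M (pos_part f) c \<le> ennreal A" "0 < \<epsilon>"
      obtain g0 g1 where g: "g0 \<in> L1 M" "g1 \<in> Linf M" "AE x in M. S f x = g0 x + g1 x"
           "L1_norm M (pos_part g0) \<le> C * A + \<epsilon>" "Linf_norm M (pos_part g1) \<le> C * c + \<epsilon>"
        using key[OF h(1) c2(1) h(2) A2(1) h(3) A2(2) h(4)] unfolding signed_splitting_def by blast
      have "AE x in M. pos_part (S f) x \<le> pos_part g0 x + pos_part g1 x"
        using g(3) by eventually_elim (auto simp: pos_part_def)
      then show "\<exists>g0\<in>L1 M. \<exists>g1\<in>Linf M. (AE x in M. pos_part (S f) x \<le> g0 x + g1 x) \<and>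
           L1_norm M g0 \<le> C * A + \<epsilon> \<and> Linf_norm M g1 \<le> C * c + \<epsilon>"
        using pos_part_L1[OF g(1)] pos_part_Linf[OF g(2)] g(4,5) by blast
    qed (auto intro!: Sum_space_cmult pos_part_Sum f)
    show "K_functional M (neg_part (S f)) t \<le> K_functional M (\<lambda>x. C * neg_part f x) t"
    proof (rule K_le[OF t])
      fix c A \<epsilon> :: real
      assume h: "0 \<le> c" "0 \<le> A" "excess M (neg_part f) c \<le> ennreal A" "0 < \<epsilon>"
      obtain g0 g1 where g: "g0 \<in> L1 M" "g1 \<in> Linf M" "AE x in M. S f x = g0 x + g1 x"
           "L1_norm M (neg_part g0) \<le> C * A + \<epsilon>" "Linf_norm M (neg_part g1) \<le> C * c + \<epsilon>"
        using key[OF c1(1) h(1) A1(1) h(2) A1(2) h(3,4)] unfolding signed_splitting_def by blast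
      have "AE x in M. neg_part (S f) x \<le> neg_part g0 x + neg_part g1 x"
        using g(3) by eventually_elim (auto simp: neg_part_def)
      then show "\<exists>g0\<in>L1 M. \<exists>g1\<in>Linf M. (AE x in M. neg_part (S f) x \<le> g0 x + g1 x) \<and>
           L1_norm M g0 \<le> C * A + \<epsilon> \<and> Linf_norm M g1 \<le> C * c + \<epsilon>"
        using neg_part_L1[OF g(1)] neg_part_Linf[OF g(2)] g(4,5) by blast
    qed (auto intro!: Sum_space_cmult neg_part_Sum f)
  qed
qed

text \<open>The operator norm is an infimum of bounds, and only a strictly positive bound allows the
  rescaling of \<open>f\<close>; both are dealt with by replacing the norm with norm plus \<open>d\<close>.\<close>

lemma K_monotone_imp_GP:
  assumes X: "intermediate_space M X nX" and mon: "exact_partially_K_monotone M X nX"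
  shows "exact_interpolation_GP M X nX"
  unfolding exact_interpolation_GP_def
proof (intro allI impI ballI)
  fix D S f assume S: "positive_GP_operator M D S" and f: "f \<in> X \<inter> D"
  note XD = intermediate_spaceD[OF X]
  have Sf: "S f \<in> Sum_space M" using S f by (auto simp: positive_GP_operator_def operator_on_def)
  have bound: "S f \<in> X \<and> nX (S f) \<le> C * nX f" if C: "GP_bound M D S C" "0 < C" for C
  proof -
    have "partially_K_below M (S f) (\<lambda>x. C * f x)"
      using f XD(1) Sf by (intro GP_bound_K_below[OF C]) auto
    moreover have "(\<lambda>x. C * f x) \<in> X" using f XD(5) by auto
    ultimately have "S f \<in> X \<and> nX (S f) \<le> nX (\<lambda>x. C * f x)"
      using mon Sf unfolding exact_partially_K_monotone_def by blast
    then show ?thesis using XD(6)[of f C] f C by simp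
  qed
  obtain C0 where C0: "GP_bound M D S C0" using S by (auto simp: positive_GP_operator_def)
  have "nX (S f) \<le> GP_norm M D S * nX f"
  proof (rule le_mult_epsilon)
    fix d :: real assume d: "0 < d"
    have "Inf {C. GP_bound M D S C} < GP_norm M D S + d / 2" using d by (simp add: GP_norm_def)
    then obtain C where C: "GP_bound M D S C" "C < GP_norm M D S + d / 2"
      using cInf_lessD[of "{C. GP_bound M D S C}"] C0 by auto
    have "0 \<le> C" using C(1) by (simp add: GP_bound_def)
    moreover have "GP_bound M D S (C + d / 2)" using d by (intro GP_bound_mono[OF C(1)]) auto
    ultimately have "nX (S f) \<le> (C + d / 2) * nX f" using bound[of "C + d / 2"] d by auto
    also have "\<dots> \<le> (GP_norm M D S + d) * nX f"
      using C(2) XD(7)[of f] f by (intro mult_right_mono) auto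
    finally show "nX (S f) \<le> (GP_norm M D S + d) * nX f" .
  qed (use XD(7) f in auto)
  moreover have "S f \<in> X"
    using bound[OF GP_bound_mono[OF C0, of "C0 + 1"]] C0 by (auto simp: GP_bound_def)
  ultimately show "S f \<in> X \<and> nX (S f) \<le> GP_norm M D S * nX f" by blast
qed

subsection \<open>From Gagliardo-Peetre operators to order preserving Lipschitz operators\<close>

text \<open>By monotonicity \<open>S f - S f'\<close> lies below \<open>S (max f f') - S f'\<close>.  Climbing from \<open>f'\<close> to
  \<open>max f f'\<close> in two steps, the first with integrable and the second with bounded increment, splits
  this upper bound into two nonnegative differences controlled by the Lipschitz estimates; the
  intermediate point belongs to the domain because the domain is a solid lattice.\<close>

lemma Lip_bound_upper:
  assumes S: "operator_on M D S" "Lip_bound M D S C" "order_preserving M D S" "solid_lattice M D"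
    and f: "f \<in> D" "f' \<in> D"
    and u: "u0 \<in> L1 M" "u1 \<in> Linf M" "AE x in M. f x - f' x = u0 x + u1 x"
  obtains p0 p1 where "p0 \<in> L1 M" "p1 \<in> Linf M"
    "AE x in M. 0 \<le> p0 x \<and> 0 \<le> p1 x \<and> S f x - S f' x \<le> p0 x + p1 x"
    "L1_norm M p0 \<le> C * L1_norm M (pos_part u0)" "Linf_norm M p1 \<le> C * Linf_norm M (pos_part u1)"
proof -
  have sub: "D \<subseteq> Sum_space M" and SD: "S ` D \<subseteq> Sum_space M"
    using S(1) by (auto simp: operator_on_def)
  have C: "0 \<le> C" and LipL1: "lipschitz_wrt (L1 M) (L1_norm M) D S C"
    and LipLinf: "lipschitz_wrt (Linf M) (Linf_norm M) D S C"
    using S(2) by (auto simp: Lip_bound_def)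
  have Dm: "e \<in> borel_measurable M" if "e \<in> D" for e
    using that sub by (auto intro!: Sum_space_measurable)
  note [measurable] = Dm[OF f(1)] Dm[OF f(2)] L1_measurable[OF u(1)] Linf_measurable[OF u(2)]
  define a0 where "a0 x = min (max (f x - f' x) 0) (pos_part u0 x)" for x
  define a1 where "a1 x = max (f x - f' x) 0 - a0 x" for x
  have [measurable]: "a0 \<in> borel_measurable M" "a1 \<in> borel_measurable M"
    unfolding a0_def[abs_def] a1_def[abs_def] by measurable
  have a0: "a0 \<in> L1 M" "L1_norm M a0 \<le> L1_norm M (pos_part u0)"
    by (rule L1_dominated[OF pos_part_L1[OF u(1)]]; auto simp: a0_def)+
  have "AE x in M. \<bar>a1 x\<bar> \<le> \<bar>pos_part u1 x\<bar>"
    using u(3) by eventually_elim (auto simp: a1_def a0_def pos_part_def max_def min_def)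
  then have a1: "a1 \<in> Linf M" "Linf_norm M a1 \<le> Linf_norm M (pos_part u1)"
    by (rule Linf_dominated[OF pos_part_Linf[OF u(2)], rotated]; measurable)+
  define up where "up x = max (f x) (f' x)" for x
  define up0 where "up0 x = f' x + a0 x" for x
  have upD: "up \<in> D" using S(4) f unfolding solid_lattice_def up_def[abs_def] by blast
  have up0S: "up0 \<in> Sum_space M"
    unfolding up0_def[abs_def] by (rule Sum_space_add[OF _ L1_subset_Sum[OF a0(1)]]) (use f sub in auto)
  have "AE x in M. f' x \<le> up0 x" "AE x in M. up0 x \<le> up x" by (auto simp: up_def up0_def a0_def)
  with S(4) f(2) upD up0S have up0D: "up0 \<in> D" unfolding solid_lattice_def by blast
  have lip: "(\<lambda>x. S e x - S e' x) \<in> Y \<and> nY (\<lambda>x. S e x - S e' x) \<le> C * A"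
    if "lipschitz_wrt Y nY D S C" "e \<in> D" "e' \<in> D" "d \<in> Y" "(\<lambda>x. e x - e' x) = d" "nY d \<le> A"
    for Y e e' d A and nY :: "('a \<Rightarrow> real) \<Rightarrow> real"
  proof -
    have "(\<lambda>x. S e x - S e' x) \<in> Y \<and> nY (\<lambda>x. S e x - S e' x) \<le> C * nY d"
      using that(1-4) unfolding lipschitz_wrt_def that(5)[symmetric] by blast
    then show ?thesis using mult_left_mono[OF that(6) C] by auto
  qed
  define p0 where "p0 x = S up0 x - S f' x" for x
  define p1 where "p1 x = S up x - S up0 x" for x
  have p0: "p0 \<in> L1 M \<and> L1_norm M p0 \<le> C * L1_norm M (pos_part u0)"
    unfolding p0_def[abs_def] by (rule lip[OF LipL1 up0D f(2) a0(1) _ a0(2)]) (auto simp: up0_def)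
  have p1: "p1 \<in> Linf M \<and> Linf_norm M p1 \<le> C * Linf_norm M (pos_part u1)"
    unfolding p1_def[abs_def] by (rule lip[OF LipLinf upD up0D a1(1) _ a1(2)]) (auto simp: up0_def up_def a1_def)
  have mono: "AE x in M. S e x \<le> S e' x" if "e \<in> D" "e' \<in> D" "\<And>x. e x \<le> e' x" for e e'
    using S(3) that AE_I2[of M "\<lambda>x. e x \<le> e' x"] unfolding order_preserving_def by blast
  have "AE x in M. S f' x \<le> S up0 x" "AE x in M. S up0 x \<le> S up x" "AE x in M. S f x \<le> S up x"
    by (rule mono; (fact | auto simp: up0_def up_def a0_def))+
  then have "AE x in M. 0 \<le> p0 x \<and> 0 \<le> p1 x \<and> S f x - S f' x \<le> p0 x + p1 x"
    by eventually_elim (auto simp: p0_def p1_def)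
  then show ?thesis using p0 p1 by (intro that[of p0 p1]) auto
qed

text \<open>Exchanging \<open>f\<close> and \<open>f'\<close> bounds the difference from below as well.\<close>

lemma Lip_bound_split:
  assumes S: "operator_on M D S" "Lip_bound M D S C" "order_preserving M D S" "solid_lattice M D"
    and f: "f \<in> D" "f' \<in> D"
    and u: "u0 \<in> L1 M" "u1 \<in> Linf M" "AE x in M. f x - f' x = u0 x + u1 x"
  shows "signed_splitting M (\<lambda>x. S f x - S f' x)
    (C * L1_norm M (pos_part u0)) (C * L1_norm M (neg_part u0))
    (C * Linf_norm M (pos_part u1)) (C * Linf_norm M (neg_part u1))"
proof -
  obtain p0 p1 where p: "p0 \<in> L1 M" "p1 \<in> Linf M"
    "AE x in M. 0 \<le> p0 x \<and> 0 \<le> p1 x \<and> S f x - S f' x \<le> p0 x + p1 x"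
    "L1_norm M p0 \<le> C * L1_norm M (pos_part u0)" "Linf_norm M p1 \<le> C * Linf_norm M (pos_part u1)"
    by (rule Lip_bound_upper[OF S f u])
  have neg: "pos_part (\<lambda>x. - h x) = neg_part h" for h :: "'a \<Rightarrow> real"
    by (simp add: pos_part_def neg_part_def)
  have "(\<lambda>x. - u0 x) \<in> L1 M" "(\<lambda>x. - u1 x) \<in> Linf M"
    using u(1) Linf_cmult[OF u(2), of "- 1"] by (auto simp: L1_def)
  moreover have "AE x in M. f' x - f x = - u0 x + - u1 x" using u(3) by eventually_elim auto
  ultimately obtain q0 q1 where q: "q0 \<in> L1 M" "q1 \<in> Linf M"
    "AE x in M. 0 \<le> q0 x \<and> 0 \<le> q1 x \<and> S f' x - S f x \<le> q0 x + q1 x"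
    "L1_norm M q0 \<le> C * L1_norm M (neg_part u0)" "Linf_norm M q1 \<le> C * Linf_norm M (neg_part u1)"
    using Lip_bound_upper[OF S f(2,1)] unfolding neg[symmetric] by blast
  \<comment> \<open>Cutting off \<open>w\<^sup>+\<close> at \<open>p0\<close> and \<open>w\<^sup>-\<close> at \<open>q0\<close> leaves remainders below \<open>p1\<close> and \<open>q1\<close>.\<close>
  define w where "w x = S f x - S f' x" for x
  define g0 where "g0 x = min (max (w x) 0) (p0 x) - min (max (- w x) 0) (q0 x)" for x
  define g1 where "g1 x = w x - g0 x" for x
  have "S f \<in> Sum_space M" "S f' \<in> Sum_space M" using S(1) f by (auto simp: operator_on_def)
  note [measurable] = this[THEN Sum_space_measurable] p(1)[THEN L1_measurable] q(1)[THEN L1_measurable]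
    p(2)[THEN Linf_measurable] q(2)[THEN Linf_measurable]
  have [measurable]: "g0 \<in> borel_measurable M" "g1 \<in> borel_measurable M"
    unfolding g0_def[abs_def] g1_def[abs_def] w_def[abs_def] by measurable
  have aeg: "AE x in M. \<bar>g0 x\<bar> \<le> \<bar>p0 x + q0 x\<bar> \<and> \<bar>g1 x\<bar> \<le> \<bar>p1 x + q1 x\<bar> \<and>
      \<bar>pos_part g0 x\<bar> \<le> \<bar>p0 x\<bar> \<and> \<bar>neg_part g0 x\<bar> \<le> \<bar>q0 x\<bar> \<and>
      \<bar>pos_part g1 x\<bar> \<le> \<bar>p1 x\<bar> \<and> \<bar>neg_part g1 x\<bar> \<le> \<bar>q1 x\<bar>"
    using p(3) q(3)
  proof eventually_elim
    case (elim x)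
    then have "w x \<le> p0 x + p1 x" "- w x \<le> q0 x + q1 x" by (auto simp: w_def)
    with elim show ?case
      by (cases "0 \<le> w x") (auto simp: g0_def g1_def pos_part_def neg_part_def max_def min_def)
  qed
  have g0: "g0 \<in> L1 M"
    by (rule L1_dominated(1)[OF L1_add[of p0 M q0]]) (use p q aeg in auto)
  have g1: "g1 \<in> Linf M"
    by (rule Linf_dominated(1)[OF Linf_add[of p1 M q1]]) (use p q aeg in auto)
  have "L1_norm M (pos_part g0) \<le> L1_norm M p0" "L1_norm M (neg_part g0) \<le> L1_norm M q0"
    by (rule L1_dominated(2); use p q aeg in auto)+
  moreover have "Linf_norm M (pos_part g1) \<le> Linf_norm M p1" "Linf_norm M (neg_part g1) \<le> Linf_norm M q1"
    by (rule Linf_dominated(2); use p q aeg in auto)+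
  moreover have "AE x in M. S f x - S f' x = g0 x + g1 x" by (simp add: g1_def w_def)
  ultimately show ?thesis
    using g0 g1 p q unfolding signed_splitting_def
    by (intro bexI[of _ g0] bexI[of _ g1]) (auto intro: order_trans)
qed

text \<open>An operator on the single class of \<open>f - f'\<close> inherits the splitting, so the estimate for
  differences is an estimate for one value of a positive Gagliardo-Peetre operator.\<close>

lemma GP_imp_Lipschitz:
  assumes X: "intermediate_space M X nX" and GP: "exact_interpolation_GP M X nX"
  shows "exact_interpolation_Lipschitz M X nX"
  unfolding exact_interpolation_Lipschitz_def lipschitz_wrt_def
proof (intro allI impI ballI)
  fix D S f f'
  assume S: "admissible_Lipschitz M D S \<and> order_preserving M D S \<and> solid_lattice M D"
    and f: "f \<in> D" "f' \<in> D" and uX: "(\<lambda>x. f x - f' x) \<in> X"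
  note XD = intermediate_spaceD[OF X]
  have op: "operator_on M D S" using S by (auto simp: admissible_Lipschitz_def)
  let ?u = "\<lambda>x. f x - f' x" and ?w = "\<lambda>x. S f x - S f' x"
  have u: "?u \<in> Sum_space M" using uX XD(1) by auto
  have w: "?w \<in> Sum_space M" using op f by (intro Sum_space_diff) (auto simp: operator_on_def)
  define D' where "D' = {v \<in> borel_measurable M. AE x in M. v x = ?u x}"
  have uD: "?u \<in> D'" using Sum_space_measurable[OF u] by (simp add: D'_def)
  have "operator_on M D' (\<lambda>_. ?w)"
    unfolding operator_on_def
  proof (intro conjI)
    show "D' \<subseteq> Sum_space M"
    proof
      fix v assume v: "v \<in> D'"
      then have "AE x in M. f x - f' x = v x" by (auto simp: D'_def)
      with v show "v \<in> Sum_space M"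
        by (intro ae_saturatedD[OF ae_saturated_Sum_space u]) (auto simp: D'_def)
    qed
    show "ae_saturated M D'"
      unfolding ae_saturated_def
    proof (intro conjI ballI impI)
      fix v v' assume "v \<in> D'" "v' \<in> borel_measurable M" "AE x in M. v x = v' x"
      moreover from this have "AE x in M. v' x = f x - f' x" unfolding D'_def by auto
      ultimately show "v' \<in> D'" by (simp add: D'_def)
    qed (auto simp: D'_def)
  qed (use uD w in auto)
  moreover have GPC: "GP_bound M D' (\<lambda>_. ?w) C" if C: "Lip_bound M D S C" for C
    unfolding GP_bound_iff
  proof (intro conjI ballI allI impI)
    show "0 \<le> C" using C by (simp add: Lip_bound_def)
    fix v u0 u1 and \<epsilon> :: real
    assume v: "v \<in> D'" "u0 \<in> L1 M" "u1 \<in> Linf M" "0 < \<epsilon>" "AE x in M. v x = u0 x + u1 x"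
    have "AE x in M. v x = f x - f' x" using v(1) by (simp add: D'_def)
    then have "AE x in M. f x - f' x = u0 x + u1 x" using v(5) by eventually_elim auto
    then have "signed_splitting M ?w
        (C * L1_norm M (pos_part u0)) (C * L1_norm M (neg_part u0))
        (C * Linf_norm M (pos_part u1)) (C * Linf_norm M (neg_part u1))"
      using Lip_bound_split[OF op C _ _ f v(2,3)] S by blast
    then show "signed_splitting M ?w
        (C * L1_norm M (pos_part u0) + \<epsilon>) (C * L1_norm M (neg_part u0) + \<epsilon>)
        (C * Linf_norm M (pos_part u1) + \<epsilon>) (C * Linf_norm M (neg_part u1) + \<epsilon>)"
      by (rule signed_splitting_mono) (use v(4) in auto)
  qed
  obtain C0 where C0: "Lip_bound M D S C0" using S by (auto simp: admissible_Lipschitz_def)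
  have "positive_GP_operator M D' (\<lambda>_. ?w)"
    using calculation GPC[OF C0] by (auto simp: positive_GP_operator_def)
  then have res: "?w \<in> X \<and> nX ?w \<le> GP_norm M D' (\<lambda>_. ?w) * nX ?u"
    using GP uX uD unfolding exact_interpolation_GP_def by blast
  have "GP_norm M D' (\<lambda>_. ?w) \<le> Lip_norm M D S"
    unfolding Lip_norm_def
  proof (rule cInf_greatest)
    fix C assume "C \<in> {C. Lip_bound M D S C}"
    then show "GP_norm M D' (\<lambda>_. ?w) \<le> C"
      unfolding GP_norm_def using GPC
      by (intro cInf_lower) (auto simp: GP_bound_def intro!: bdd_belowI[of _ 0])
  qed (use C0 in auto)
  then have "GP_norm M D' (\<lambda>_. ?w) * nX ?u \<le> Lip_norm M D S * nX ?u"
    using XD(7)[OF uX] by (rule mult_right_mono)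
  with res show "?w \<in> X \<and> nX ?w \<le> Lip_norm M D S * nX ?u" by auto
qed

subsection \<open>From Lipschitz operators to positive linear operators\<close>

lemma bounded_on_bdd_above:
  assumes "bounded_on Y nY S" "\<And>f. f \<in> Y \<Longrightarrow> 0 \<le> nY f"
  shows "bdd_above ((\<lambda>f. nY (S f) / nY f) ` Y)"
proof -
  obtain C where C: "\<And>f. f \<in> Y \<Longrightarrow> nY (S f) \<le> C * nY f" using assms(1) by (auto simp: bounded_on_def)
  have "nY (S f) / nY f \<le> max C 0" if "f \<in> Y" for f
  proof (cases "nY f = 0")
    case False
    then have pos: "0 < nY f" using assms(2)[OF that] by simp
    have "C * nY f \<le> max C 0 * nY f" using pos by (intro mult_right_mono) auto
    then have "nY (S f) \<le> max C 0 * nY f" using C[OF that] by linarith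
    then show ?thesis using pos by (simp add: field_simps)
  qed simp
  then show ?thesis by (auto intro!: bdd_aboveI[of _ "max C 0"])
qed

lemma op_norm_bound:
  assumes "bounded_on Y nY S" "\<And>f. f \<in> Y \<Longrightarrow> 0 \<le> nY f" "f \<in> Y"
  shows "nY (S f) \<le> op_norm Y nY S * nY f"
proof (cases "nY f = 0")
  case True
  then show ?thesis using assms(1,3) by (fastforce simp: bounded_on_def)
next
  case False
  then have "0 < nY f" using assms(2)[OF assms(3)] by simp
  moreover have "nY (S f) / nY f \<le> op_norm Y nY S"
    unfolding op_norm_def by (rule cSUP_upper[OF assms(3) bounded_on_bdd_above[OF assms(1,2)]])
  ultimately show ?thesis by (simp add: field_simps)
qed

lemma op_norm_nonneg:
  assumes "bounded_on Y nY S" "\<And>f. f \<in> Y \<Longrightarrow> 0 \<le> nY f" "f \<in> Y"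
  shows "0 \<le> op_norm Y nY S"
proof -
  have "0 \<le> nY (S f) / nY f" using assms by (auto simp: bounded_on_def)
  also have "\<dots> \<le> op_norm Y nY S"
    unfolding op_norm_def by (rule cSUP_upper[OF assms(3) bounded_on_bdd_above[OF assms(1,2)]])
  finally show ?thesis .
qed

lemma op_norm_le:
  assumes "Y \<noteq> {}" "\<And>f. f \<in> Y \<Longrightarrow> 0 \<le> nY f" "0 \<le> C" "\<And>f. f \<in> Y \<Longrightarrow> nY (S f) \<le> C * nY f"
  shows "op_norm Y nY S \<le> C"
  unfolding op_norm_def
proof (rule cSUP_least[OF assms(1)])
  fix f assume f: "f \<in> Y"
  show "nY (S f) / nY f \<le> C"
    using assms(2)[OF f] assms(3) assms(4)[OF f] by (cases "nY f = 0") (auto simp: field_simps)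
qed

lemma solid_lattice_Sum_space: "solid_lattice M (Sum_space M)"
  unfolding solid_lattice_def
proof (intro conjI ballI impI)
  fix f g assume fg: "f \<in> Sum_space M" "g \<in> Sum_space M"
  note [measurable] = fg[THEN Sum_space_measurable]
  have "(\<lambda>x. pos_part f x + neg_part f x + (pos_part g x + neg_part g x)) \<in> Sum_space M"
    by (intro Sum_space_add pos_part_Sum neg_part_Sum fg)
  then show "(\<lambda>x. max (f x) (g x)) \<in> Sum_space M" "(\<lambda>x. min (f x) (g x)) \<in> Sum_space M"
    by (rule Sum_space_dominated; (measurable; fail | auto simp: pos_part_def neg_part_def max_def min_def))+
qed

text \<open>A positive linear operator preserves the order, and by linearity its norm bounds are Lipschitz
  bounds; its domain is the whole sum space, a solid lattice.\<close>

lemma Lipschitz_imp_positive_linear: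
  assumes X: "intermediate_space M X nX" and Lip: "exact_interpolation_Lipschitz M X nX"
  shows "exact_interpolation_positive_linear M X nX"
  unfolding exact_interpolation_positive_linear_def
proof (intro allI impI)
  fix S assume "admissible_positive_linear M S"
  then have S: "positive_linear M S" and b0: "bounded_on (L1 M) (L1_norm M) S"
    and b1: "bounded_on (Linf M) (Linf_norm M) S"
    by (auto simp: admissible_positive_linear_def)
  note XD = intermediate_spaceD[OF X]
  define C where "C = couple_op_norm M S"
  have C: "0 \<le> C" "op_norm (L1 M) (L1_norm M) S \<le> C" "op_norm (Linf M) (Linf_norm M) S \<le> C"
    using op_norm_nonneg[OF b0 _ L1_zero] by (auto simp: C_def couple_op_norm_def)
  have op: "operator_on M (Sum_space M) S" using S by (simp add: positive_linear_def)
  have Sm: "S f \<in> borel_measurable M" if "f \<in> Sum_space M" for f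
    using op that by (auto simp: operator_on_def intro!: Sum_space_measurable)
  have diff: "AE x in M. S (\<lambda>x. f x - g x) x = S f x - S g x"
    if "f \<in> Sum_space M" "g \<in> Sum_space M" for f g
  proof -
    have "AE x in M. S (\<lambda>y. - 1 * g y) x = - 1 * S g x"
      using S that(2) unfolding positive_linear_def by blast
    moreover have "AE x in M. S (\<lambda>y. f y + - 1 * g y) x = S f x + S (\<lambda>y. - 1 * g y) x"
    proof -
      have add: "\<forall>f\<in>Sum_space M. \<forall>g\<in>Sum_space M. AE x in M. S (\<lambda>y. f y + g y) x = S f x + S g x"
        using S by (simp add: positive_linear_def)
      from bspec[OF bspec[OF add that(1)] Sum_space_cmult[OF that(2), of "- 1"]] show ?thesis .
    qed
    ultimately show ?thesis by eventually_elim simp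
  qed
  have lip: "lipschitz_wrt Y nY (Sum_space M) S C"
    if b: "bounded_on Y nY S" "\<And>f. f \<in> Y \<Longrightarrow> 0 \<le> nY f" "op_norm Y nY S \<le> C"
      and cong: "\<And>f g. f \<in> Y \<Longrightarrow> g \<in> borel_measurable M \<Longrightarrow> AE x in M. f x = g x \<Longrightarrow> g \<in> Y \<and> nY f = nY g"
    for Y nY
    unfolding lipschitz_wrt_def
  proof (intro ballI impI)
    fix f g assume fg: "f \<in> Sum_space M" "g \<in> Sum_space M" "(\<lambda>x. f x - g x) \<in> Y"
    have "S (\<lambda>x. f x - g x) \<in> Y" using b(1) fg(3) by (auto simp: bounded_on_def)
    from cong[OF this _ diff[OF fg(1,2)]] 
    have w: "(\<lambda>x. S f x - S g x) \<in> Y" "nY (S (\<lambda>x. f x - g x)) = nY (\<lambda>x. S f x - S g x)"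
      using Sm[OF fg(1)] Sm[OF fg(2)] by auto
    have "nY (S (\<lambda>x. f x - g x)) \<le> op_norm Y nY S * nY (\<lambda>x. f x - g x)"
      by (rule op_norm_bound[OF b(1,2) fg(3)])
    also have "\<dots> \<le> C * nY (\<lambda>x. f x - g x)" using b(2)[OF fg(3)] b(3) by (rule mult_right_mono[rotated])
    finally show "(\<lambda>x. S f x - S g x) \<in> Y \<and> nY (\<lambda>x. S f x - S g x) \<le> C * nY (\<lambda>x. f x - g x)"
      using w by simp
  qed
  have LB: "Lip_bound M (Sum_space M) S C"
    unfolding Lip_bound_def
  proof (intro conjI lip b0 b1 C)
    fix f g assume h: "f \<in> L1 M" "g \<in> borel_measurable M" "AE x in M. f x = g x"
    show "g \<in> L1 M" by (rule L1_AE_cong[OF h])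
    show "L1_norm M f = L1_norm M g" by (rule L1_norm_AE_cong[OF L1_measurable[OF h(1)] h(2,3)])
  next
    fix f g assume h: "f \<in> Linf M" "g \<in> borel_measurable M" "AE x in M. f x = g x"
    show "g \<in> Linf M" by (rule Linf_AE_cong[OF h])
    show "Linf_norm M f = Linf_norm M g" by (rule Linf_norm_AE_cong[OF Linf_measurable[OF h(1)] h(2,3)])
  qed (auto intro: Linf_norm_nonneg)
  have "order_preserving M (Sum_space M) S"
    unfolding order_preserving_def
  proof (intro ballI impI)
    fix f g assume fg: "f \<in> Sum_space M" "g \<in> Sum_space M" "AE x in M. g x \<le> f x"
    have "AE x in M. 0 \<le> S (\<lambda>x. f x - g x) x"
      using S Sum_space_diff[OF fg(1,2)] fg(3) unfolding positive_linear_def by auto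
    then show "AE x in M. S g x \<le> S f x" using diff[OF fg(1,2)] by eventually_elim auto
  qed
  then have lipX: "lipschitz_wrt X nX (Sum_space M) S (Lip_norm M (Sum_space M) S)"
    using Lip op LB solid_lattice_Sum_space
    unfolding exact_interpolation_Lipschitz_def admissible_Lipschitz_def by blast
  have LN: "Lip_norm M (Sum_space M) S \<le> C"
    unfolding Lip_norm_def using LB
    by (intro cInf_lower) (auto simp: Lip_bound_def intro!: bdd_belowI[of _ 0])
  have S0: "AE x in M. S (\<lambda>x. 0) x = 0"
    using diff[OF Sum_space_zero Sum_space_zero] by auto
  have X_est: "S f \<in> X \<and> nX (S f) \<le> C * nX f" if f: "f \<in> X" for f
  proof -
    have fS: "f \<in> Sum_space M" using f XD(1) by auto
    let ?w = "\<lambda>x. S f x - S (\<lambda>x. 0) x"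
    have w: "?w \<in> X" "nX ?w \<le> Lip_norm M (Sum_space M) S * nX f"
      using lipX fS Sum_space_zero[of M] f unfolding lipschitz_wrt_def by force+
    have ae: "AE x in M. ?w x = S f x" using S0 by eventually_elim simp
    have "S f \<in> X" by (rule ae_saturatedD[OF XD(2) w(1) Sm[OF fS] ae])
    moreover have "nX (S f) = nX ?w" using XD(4)[OF w(1) calculation ae] by simp
    moreover have "Lip_norm M (Sum_space M) S * nX f \<le> C * nX f"
      using LN XD(7)[OF f] by (rule mult_right_mono)
    ultimately show ?thesis using w by simp
  qed
  show "bounded_on X nX S \<and> op_norm X nX S \<le> couple_op_norm M S"
    unfolding C_def[symmetric]
  proof
    show "bounded_on X nX S" using X_est by (auto simp: bounded_on_def)
    show "op_norm X nX S \<le> C"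
      using XD(3,7) C(1) X_est by (intro op_norm_le) auto
  qed
qed

section \<open>Extracting mass with a prescribed mean\<close>

definition top_weight :: "('a \<Rightarrow> real) \<Rightarrow> real \<Rightarrow> real \<Rightarrow> 'a \<Rightarrow> real" where
  "top_weight F c \<theta> x = (if c < F x then 1 else if F x = c then \<theta> else 0)"

lemma top_weight_measurable [measurable]:
  fixes F :: "'a \<Rightarrow> real"
  assumes [measurable]: "F \<in> borel_measurable M"
  shows "top_weight F c \<theta> \<in> borel_measurable M"
  unfolding top_weight_def[abs_def] by measurable

lemma top_weight_range: "0 \<le> \<theta> \<Longrightarrow> \<theta> \<le> 1 \<Longrightarrow> 0 \<le> top_weight F c \<theta> x \<and> top_weight F c \<theta> x \<le> 1"
  by (simp add: top_weight_def)

lemma nn_integral_top_weight: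
  fixes F :: "'a \<Rightarrow> real"
  assumes [measurable]: "F \<in> borel_measurable M" and "0 \<le> \<theta>"
  shows "mass M (top_weight F c \<theta>) =
    superlevel M F c + ennreal \<theta> * emeasure M {x\<in>space M. F x = c}"
proof -
  have "mass M (top_weight F c \<theta>) =
    (\<integral>\<^sup>+x. indicator {x\<in>space M. c < F x} x + ennreal \<theta> * indicator {x\<in>space M. F x = c} x \<partial>M)"
    by (intro nn_integral_cong) (auto simp: top_weight_def indicator_def)
  also have "\<dots> = superlevel M F c + ennreal \<theta> * emeasure M {x\<in>space M. F x = c}"
    by (subst nn_integral_add) (auto simp: nn_integral_cmult_indicator)
  finally show ?thesis .
qed

text \<open>Continuity from above, which needs the finiteness of the distribution function below
  \<open>c\<close>.\<close>

lemma superlevel_ge_limit: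
  fixes F :: "'a \<Rightarrow> real"
  assumes F [measurable]: "F \<in> borel_measurable M" and c: "0 < c"
    and fin: "\<And>l. 0 < l \<Longrightarrow> superlevel M F l < \<infinity>"
    and ge: "\<And>l. 0 \<le> l \<Longrightarrow> l < c \<Longrightarrow> s \<le> superlevel M F l"
  shows "s \<le> emeasure M {x\<in>space M. c \<le> F x}"
proof -
  let ?A = "\<lambda>n. {x\<in>space M. c - c / (real n + 2) < F x}"
  have pos: "0 < c - c / (real n + 2)" "c - c / (real n + 2) < c" for n
    using c by (auto simp: field_simps add_pos_nonneg)
  have "(\<Inter>n. ?A n) = {x\<in>space M. c \<le> F x}"
  proof safe
    fix x assume x: "x \<in> (\<Inter>n. ?A n)"
    show "c \<le> F x"
    proof (rule ccontr)
      assume "\<not> ?thesis"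
      then have pos: "0 < c - F x" by simp
      obtain n :: nat where "c / (c - F x) < real n" using reals_Archimedean2 by blast
      then have "c < (real n + 2) * (c - F x)" using pos by (simp add: field_simps)
      then have "c / (real n + 2) < c - F x" by (simp add: field_simps)
      moreover have "c - c / (real n + 2) < F x" using x by blast
      ultimately show False by simp
    qed
  next
    fix x n assume "c \<le> F x"
    then show "c - c / (real n + 2) < F x" using pos(2)[of n] by (rule less_le_trans[rotated])
  qed auto
  moreover have "(INF n. emeasure M (?A n)) = emeasure M (\<Inter>n. ?A n)"
  proof (rule INF_emeasure_decseq)
    show "decseq ?A"
    proof (intro decseq_SucI subsetI)
      fix n x assume "x \<in> ?A (Suc n)"
      moreover have "c / (real (Suc n) + 2) \<le> c / (real n + 2)" using c by (intro divide_left_mono) auto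
      ultimately show "x \<in> ?A n" by auto
    qed
  qed (use fin pos in \<open>auto simp: less_top\<close>)
  moreover have "s \<le> (INF n. emeasure M (?A n))" 
    by (rule INF_greatest, rule ge, rule less_imp_le, rule pos(1), rule pos(2))
  ultimately show ?thesis by simp
qed

text \<open>Splitting \<open>F\<close> at the height \<open>c\<close>: what exceeds \<open>c\<close> contributes at most the excess, the rest at
  most \<open>c\<close> times the mass of the weight.\<close>

lemma weighted_integral_le_excess:
  fixes F :: "'a \<Rightarrow> real"
  assumes [measurable]: "F \<in> borel_measurable M" "u \<in> borel_measurable M"
    and u: "\<And>x. 0 \<le> u x" "\<And>x. u x \<le> 1" "mass M u \<le> ennreal s" and c: "0 \<le> c" "0 \<le> s"
  shows "mass M (\<lambda>x. u x * F x) \<le> excess M F c + ennreal (s * c)"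
proof -
  have "mass M (\<lambda>x. u x * F x) \<le> (\<integral>\<^sup>+x. ennreal (F x - c) + ennreal c * ennreal (u x) \<partial>M)"
  proof (intro nn_integral_mono)
    fix x
    have "u x * (F x - c) \<le> max (F x - c) 0"
      using u(1,2)[of x] by (cases "0 \<le> F x - c") (auto simp: mult_left_le_one_le mult_nonneg_nonpos)
    then have "u x * F x \<le> max (F x - c) 0 + c * u x" by (simp add: algebra_simps)
    then have "ennreal (u x * F x) \<le> ennreal (max (F x - c) 0 + c * u x)" by (rule ennreal_leI)
    also have "\<dots> = ennreal (F x - c) + ennreal c * ennreal (u x)"
      using u(1)[of x] c by (auto simp: ennreal_plus ennreal_mult max_def ennreal_neg)
    finally show "ennreal (u x * F x) \<le> ennreal (F x - c) + ennreal c * ennreal (u x)" .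
  qed
  also have "\<dots> = excess M F c + ennreal c * mass M u"
    unfolding excess_def by (simp add: nn_integral_add nn_integral_cmult)
  also have "\<dots> \<le> excess M F c + ennreal c * ennreal s"
    using u(3) by (intro add_left_mono mult_left_mono) auto
  finally show ?thesis using c by (simp add: ennreal_mult mult.commute)
qed

text \<open>The part of mass \<open>s\<close> on which \<open>F\<close> is largest.  When the level is 0 the whole set
  where \<open>F\<close> is positive has been used up, and the set where \<open>F\<close> vanishes is left out.\<close>

definition is_top_weight :: "'a measure \<Rightarrow> ('a \<Rightarrow> real) \<Rightarrow> real \<Rightarrow> real \<Rightarrow> real \<Rightarrow> bool" where
  "is_top_weight M F s c \<theta> \<longleftrightarrow> 0 \<le> c \<and> 0 \<le> \<theta> \<and> \<theta> \<le> 1 \<and>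
    superlevel M F c \<le> ennreal s \<and>
    (\<forall>c'\<ge>0. superlevel M F c' \<le> ennreal s \<longrightarrow> c \<le> c') \<and>
    mass M (top_weight F c \<theta>) \<le> ennreal s \<and>
    (0 < c \<longrightarrow> mass M (top_weight F c \<theta>) = ennreal s) \<and>
    (c = 0 \<longrightarrow> \<theta> = 0) \<and>
    mass M (\<lambda>x. top_weight F c \<theta> x * F x) = excess M F c + ennreal (s * c) \<and>
    mass M (\<lambda>x. top_weight F c \<theta> x * F x) < \<infinity>"

text \<open>The level is the least \<open>c\<close> with \<open>superlevel M F c \<le> s\<close>.  The set \<open>{F = c}\<close> may have positive
  mass, even be an atom; the fraction \<open>\<theta>\<close> of it completes the mass to \<open>s\<close>.\<close>

lemma top_weight_exists:
  fixes F :: "'a \<Rightarrow> real"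
  assumes F [measurable]: "F \<in> borel_measurable M" and nn: "\<And>x. 0 \<le> F x"
    and fin: "\<And>c. 0 < c \<Longrightarrow> excess M F c < \<infinity>" and s: "0 < s"
  shows "\<exists>c \<theta>. is_top_weight M F s c \<theta>"
proof -
  let ?m = "\<lambda>c. superlevel M F c"
  define A where "A = {c. 0 \<le> c \<and> ?m c \<le> ennreal s}"
  have "excess M F 1 < \<infinity>" by (rule fin) simp
  from superlevel_small[OF F this s] obtain l where "0 \<le> l" "?m l \<le> ennreal s" by blast
  then have "l \<in> A" by (simp add: A_def)
  then have A: "A \<noteq> {}" "bdd_below A" by (auto simp: A_def intro!: bdd_belowI[of _ 0])
  define c where "c = Inf A"
  have c0: "0 \<le> c" unfolding c_def using A(1) by (intro cInf_greatest) (auto simp: A_def)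
  have c_le: "c \<le> c'" if "0 \<le> c'" "?m c' \<le> ennreal s" for c'
    unfolding c_def using A(2) that by (intro cInf_lower) (auto simp: A_def)
  have mc: "?m c \<le> ennreal s"
  proof (rule ccontr)
    assume "\<not> ?thesis"
    then obtain e where e: "0 < e" "ennreal s < ?m (c + e)"
      using superlevel_approx[OF F, of "ennreal s" c] by (auto simp: not_le)
    then obtain c' where c': "c' \<in> A" "c' < c + e"
      using cInf_lessD[OF A(1), of "c + e"] by (auto simp: c_def)
    have "?m (c + e) \<le> ?m c'" using c'(2) by (intro emeasure_mono) auto
    then show False using c'(1) e(2) by (auto simp: A_def)
  qed
  have fin': "?m l < \<infinity>" if "0 < l" for l
    using superlevel_finite[OF F _ fin[of "l / 2"]] that by auto
  have "\<exists>\<theta>\<ge>0. \<theta> \<le> 1 \<and> (0 < c \<longrightarrow> ?m c + ennreal \<theta> * emeasure M {x\<in>space M. F x = c} = ennreal s)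
      \<and> (c = 0 \<longrightarrow> \<theta> = 0)"
  proof (cases "c = 0")
    case False
    then have c: "0 < c" using c0 by simp
    have "ennreal s \<le> emeasure M {x\<in>space M. c \<le> F x}"
    proof (rule superlevel_ge_limit[OF F c fin'])
      fix l :: real assume "0 \<le> l" "l < c"
      then show "ennreal s \<le> ?m l" using c_le[of l] by (meson linear not_le)
    qed
    also have "{x\<in>space M. c \<le> F x} = {x\<in>space M. c < F x} \<union> {x\<in>space M. F x = c}" by auto
    also have "emeasure M \<dots> = ?m c + emeasure M {x\<in>space M. F x = c}"
      by (rule plus_emeasure[symmetric]) auto
    finally have s_le: "ennreal s \<le> ?m c + emeasure M {x\<in>space M. F x = c}" .
    have "emeasure M {x\<in>space M. F x = c} \<le> ?m (c / 2)" using c by (intro emeasure_mono) auto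
    then have "emeasure M {x\<in>space M. F x = c} < \<infinity>" using fin'[of "c / 2"] c by (auto intro: le_less_trans)
    then obtain k where k: "0 \<le> k" "emeasure M {x\<in>space M. F x = c} = ennreal k"
      by (cases "emeasure M {x\<in>space M. F x = c}") auto
    obtain m where m: "0 \<le> m" "?m c = ennreal m" using fin'[OF c] by (cases "?m c") auto
    have ms: "m \<le> s" using mc m s by (simp add: ennreal_le_iff)
    have sk: "s \<le> m + k" using s_le m k by (simp add: ennreal_plus[symmetric] ennreal_le_iff del: ennreal_plus)
    define \<theta> where "\<theta> = (if k = 0 then 0 else (s - m) / k)"
    have th: "0 \<le> \<theta>" "\<theta> \<le> 1" "m + \<theta> * k = s"
      using ms sk k m by (auto simp: \<theta>_def field_simps)
    have "?m c + ennreal \<theta> * emeasure M {x\<in>space M. F x = c} = ennreal s"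
      using th k m by (simp add: ennreal_mult[symmetric] flip: ennreal_plus)
    then show ?thesis using th c by auto
  qed (auto intro!: exI[of _ 0])
  then obtain \<theta> where th: "0 \<le> \<theta>" "\<theta> \<le> 1" "c = 0 \<Longrightarrow> \<theta> = 0"
    and eq: "0 < c \<Longrightarrow> mass M (top_weight F c \<theta>) = ennreal s"
    unfolding nn_integral_top_weight[OF F] by (auto simp: nn_integral_top_weight[OF F])
  have le: "mass M (top_weight F c \<theta>) \<le> ennreal s"
  proof (cases "c = 0")
    case True
    then show ?thesis using th(3) mc by (simp add: nn_integral_top_weight[OF F])
  qed (use eq c0 in auto)
  have "mass M (\<lambda>x. top_weight F c \<theta> x * F x) =
      (\<integral>\<^sup>+x. ennreal (F x - c) + ennreal c * ennreal (top_weight F c \<theta> x) \<partial>M)"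
    using c0 th by (intro nn_integral_cong)
      (auto simp: top_weight_def ennreal_neg ennreal_mult[symmetric] ennreal_plus[symmetric] mult.commute simp del: ennreal_plus)
  also have "\<dots> = excess M F c + ennreal c * mass M (top_weight F c \<theta>)"
    unfolding excess_def by (simp add: nn_integral_add nn_integral_cmult)
  also have "\<dots> = excess M F c + ennreal (s * c)"
    using eq c0 s by (cases "c = 0") (auto simp: ennreal_mult mult.commute)
  finally have int: "mass M (\<lambda>x. top_weight F c \<theta> x * F x) = excess M F c + ennreal (s * c)" .
  have "mass M (\<lambda>x. top_weight F c \<theta> x * F x) \<le> excess M F 1 + ennreal (s * 1)"
    using le s by (intro weighted_integral_le_excess) (auto simp: top_weight_range th)
  also have "\<dots> < \<infinity>" using fin[of 1] by simp
  finally have "mass M (\<lambda>x. top_weight F c \<theta> x * F x) < \<infinity>" .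
  then have "is_top_weight M F s c \<theta>"
    unfolding is_top_weight_def using c0 th mc c_le le eq int by (intro conjI) blast+
  then show ?thesis by blast
qed

lemma excess_vanishes:
  fixes F :: "'a \<Rightarrow> real"
  assumes F [measurable]: "F \<in> borel_measurable M" and fin: "excess M F 1 < \<infinity>" and e: "0 < e"
  obtains c where "1 \<le> c" "excess M F c < ennreal e"
proof -
  have "(\<lambda>n. \<integral>\<^sup>+x. ennreal (F x - real (Suc n)) \<partial>M) \<longlonglongrightarrow> (\<integral>\<^sup>+x. 0 \<partial>M)"
  proof (rule nn_integral_dominated_convergence[where w = "\<lambda>x. ennreal (F x - 1)"])
    show "AE x in M. (\<lambda>n. ennreal (F x - real (Suc n))) \<longlonglongrightarrow> 0"
    proof (intro AE_I2 tendsto_eventually)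
      fix x
      obtain n :: nat where "F x \<le> real n" using real_arch_simple by blast
      then show "\<forall>\<^sub>F n in sequentially. ennreal (F x - real (Suc n)) = 0"
        by (intro eventually_sequentiallyI[of n]) (auto simp: ennreal_neg)
    qed
  qed (use fin in \<open>auto simp: excess_def intro!: ennreal_leI\<close>)
  then have "\<forall>\<^sub>F n in sequentially. mass M (\<lambda>x. F x - real (Suc n)) < ennreal e"
    by (rule order_tendstoD) (use e in auto)
  then obtain n where "mass M (\<lambda>x. F x - real (Suc n)) < ennreal e"
    by (auto simp: eventually_sequentially)
  then show ?thesis by (intro that[of "real (Suc n)"]) (auto simp: excess_def)
qed

text \<open>The weight takes mass \<open>\<beta>\<close> with \<open>F\<close>-integral \<open>\<beta> * b\<close> out of the set \<open>{p \<le> F \<le> q}\<close> and uses up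
  \<open>{p < F < q}\<close>; the first alternative of the last condition stands for \<open>q = \<infinity>\<close>.  At \<open>p = 0\<close> the
  set where \<open>F\<close> is positive may be too small to yield mass \<open>\<beta>\<close>.\<close>

definition interval_weight ::
  "'a measure \<Rightarrow> ('a \<Rightarrow> real) \<Rightarrow> real \<Rightarrow> real \<Rightarrow> real \<Rightarrow> ('a \<Rightarrow> real) \<Rightarrow> bool" where
  "interval_weight M F \<beta> b p v \<longleftrightarrow> v \<in> borel_measurable M \<and> (\<forall>x. 0 \<le> v x \<and> v x \<le> 1) \<and> 0 \<le> p \<and>
    mass M v \<le> ennreal \<beta> \<and> (0 < p \<longrightarrow> mass M v = ennreal \<beta>) \<and>
    mass M (\<lambda>x. v x * F x) = ennreal (\<beta> * b) \<and> (\<forall>x. F x < p \<longrightarrow> v x = 0) \<and>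
    ((\<forall>x. p < F x \<longrightarrow> v x = 1) \<or>
      (\<exists>q\<ge>p. (\<forall>x. p < F x \<and> F x < q \<longrightarrow> v x = 1) \<and> (\<forall>x. q < F x \<longrightarrow> v x = 0)))"

text \<open>Let \<open>U s\<close> be the largest integral of \<open>F\<close> over mass \<open>s\<close>.  The increment
  \<open>U (s + \<beta>) - U s\<close> is continuous in \<open>s\<close>, at least \<open>\<beta> * b\<close> at \<open>s = 0\<close> and at most
  \<open>\<beta> * b\<close> once the set where \<open>F > b\<close> is used up.  So it equals \<open>\<beta> * b\<close> somewhere, and
  the difference of the two top weights there is the weight sought.  At \<open>s = 0\<close> the upper
  level is infinite.\<close>

lemma interval_weight_exists:
  fixes F :: "'a \<Rightarrow> real"
  assumes F [measurable]: "F \<in> borel_measurable M" and nn: "\<And>x. 0 \<le> F x"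
    and fin: "\<And>c. 0 < c \<Longrightarrow> excess M F c < \<infinity>" and \<beta>: "0 < \<beta>" and b: "0 < b"
    and dom: "\<And>c. 0 \<le> c \<Longrightarrow> ennreal \<beta> * ennreal (b - c) \<le> excess M F c"
  shows "\<exists>p v. interval_weight M F \<beta> b p v"
proof -
  obtain c \<theta> where P: "\<And>s. 0 < s \<Longrightarrow> is_top_weight M F s (c s) (\<theta> s)"
    using top_weight_exists[OF F nn fin] by metis
  define u where "u s = top_weight F (c s) (\<theta> s)" for s
  define U where "U s = enn2real (mass M (\<lambda>x. u s x * F x))" for s
  have u: "u s \<in> borel_measurable M" for s unfolding u_def by measurable
  have c0: "0 \<le> c s" and th: "0 \<le> \<theta> s" "\<theta> s \<le> 1" "c s = 0 \<Longrightarrow> \<theta> s = 0"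
    and lev: "superlevel M F (c s) \<le> ennreal s"
    and c_le: "\<And>c'. 0 \<le> c' \<Longrightarrow> superlevel M F c' \<le> ennreal s \<Longrightarrow> c s \<le> c'"
    and mass: "mass M (u s) \<le> ennreal s"
      "0 < c s \<Longrightarrow> mass M (u s) = ennreal s"
    and Ueq: "mass M (\<lambda>x. u s x * F x) = ennreal (U s)"
    and Uex: "ennreal (U s) = excess M F (c s) + ennreal (s * c s)"
    if "0 < s" for s
    using P[OF that] unfolding is_top_weight_def u_def[symmetric] U_def by auto
  have u01: "0 \<le> u s x" "u s x \<le> 1" if "0 < s" for s x
    using th(1,2)[OF that] by (simp_all add: u_def top_weight_range)
  have U0: "0 \<le> U s" for s by (simp add: U_def)
  \<comment> \<open>\<open>U\<close> is the infimum over \<open>c\<close> of the affine functions \<open>excess M F c + s * c\<close>, attained at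
    \<open>c s\<close>; so \<open>c s\<close> is a supergradient, and \<open>U\<close> is concave.\<close>
  have grad: "U s' \<le> U s + (s' - s) * c s" if s: "0 < s" "0 < s'" for s s'
  proof -
    have "excess M F (c s) < \<infinity>"
      using Uex[OF s(1)] by (metis ennreal_add_eq_top ennreal_neq_top infinity_ennreal_def less_top)
    then obtain E where E: "0 \<le> E" "excess M F (c s) = ennreal E" by (cases "excess M F (c s)") auto
    have e: "U s = E + s * c s"
      using Uex[OF s(1)] E c0[OF s(1)] s U0 by (simp flip: ennreal_plus)
    have "ennreal (U s') \<le> excess M F (c s) + ennreal (s' * c s)"
      unfolding Ueq[OF s(2), symmetric]
      using s c0[OF s(1)] mass[OF s(2)] u01[OF s(2)] by (intro weighted_integral_le_excess u F) auto
    also have "\<dots> = ennreal (E + s' * c s)" using E s c0[OF s(1)] by (simp add: ennreal_plus)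
    finally have "U s' \<le> E + s' * c s" using E s c0[OF s(1)] by (subst (asm) ennreal_le_iff) auto
    then show ?thesis using e by (simp add: algebra_simps)
  qed
  have mono: "U s \<le> U s'" if "0 < s" "s \<le> s'" for s s'
  proof -
    have "(s - s') * c s' \<le> 0" using that c0[of s'] by (intro mult_nonpos_nonneg) auto
    then show ?thesis using grad[of s' s] that by auto
  qed
  have "convex_on {0<..} (\<lambda>s. - U s)"
  proof (intro convex_onI)
    fix t x y :: real assume t: "0 < t" "t < 1" and xy: "x \<in> {0<..}" "y \<in> {0<..}"
    define z where "z = (1 - t) * x + t * y"
    have z: "0 < z" using t xy by (auto simp: z_def intro!: add_pos_pos)
    have "(1 - t) * U x \<le> (1 - t) * (U z + (x - z) * c z)" using grad[of z x] z xy t by (intro mult_left_mono) auto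
    moreover have "t * U y \<le> t * (U z + (y - z) * c z)" using grad[of z y] z xy t by (intro mult_left_mono) auto
    moreover have "(1 - t) * (U z + (x - z) * c z) + t * (U z + (y - z) * c z) = U z + (z - z) * c z"
      by (simp add: z_def algebra_simps)
    ultimately show "- U ((1 - t) *\<^sub>R x + t *\<^sub>R y) \<le> (1 - t) * - U x + t * - U y"
      by (simp add: z_def)
  qed auto
  then have "continuous_on {0<..} (\<lambda>s. - (- U s))"
    by (intro continuous_on_minus convex_on_continuous) auto
  then have cont: "continuous_on {0<..} U" by simp
  have U\<beta>: "\<beta> * b \<le> U \<beta>"
  proof -
    have "ennreal (\<beta> * b) \<le> ennreal \<beta> * ennreal (b - c \<beta>) + ennreal (\<beta> * c \<beta>)"
    proof -
      have "\<beta> * b \<le> \<beta> * max (b - c \<beta>) 0 + \<beta> * c \<beta>"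
        using \<beta> by (simp add: distrib_left[symmetric])
      then have "ennreal (\<beta> * b) \<le> ennreal (\<beta> * max (b - c \<beta>) 0 + \<beta> * c \<beta>)" by (rule ennreal_leI)
      also have "\<dots> = ennreal \<beta> * ennreal (max (b - c \<beta>) 0) + ennreal (\<beta> * c \<beta>)"
        using \<beta> c0[OF \<beta>] by (simp add: ennreal_plus ennreal_mult)
      also have "ennreal (max (b - c \<beta>) 0) = ennreal (b - c \<beta>)" by (auto simp: max_def ennreal_neg)
      finally show ?thesis .
    qed
    also have "\<dots> \<le> ennreal (U \<beta>)" unfolding Uex[OF \<beta>] using dom[OF c0[OF \<beta>]] by (rule add_right_mono)
    finally show ?thesis using U0 by (simp add: ennreal_le_iff)
  qed
  show ?thesis
  proof (cases "U \<beta> = \<beta> * b")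
    case True
    have "interval_weight M F \<beta> b (c \<beta>) (u \<beta>)"
      unfolding interval_weight_def
      using True u01[OF \<beta>] c0[OF \<beta>] mass[OF \<beta>] Ueq[OF \<beta>] u by (auto simp: u_def top_weight_def)
    then show ?thesis by blast
  next
    case False
    define d where "d = U \<beta> - \<beta> * b"
    have d: "0 < d" using False U\<beta> by (simp add: d_def)
    obtain c' where c': "1 \<le> c'" "excess M F c' < ennreal (d / 2)"
      using excess_vanishes[OF F fin[of 1], of "d / 2"] d by auto
    \<comment> \<open>Near 0 the function \<open>U\<close> is small, so the increment is still above \<open>\<beta> * b\<close> at \<open>s1\<close>.\<close>
    define s1 where "s1 = d / (2 * c')"
    have s1: "0 < s1" "s1 * c' = d / 2" using d c' by (auto simp: s1_def field_simps)
    have "ennreal (U s1) \<le> excess M F c' + ennreal (s1 * c')"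
      unfolding Ueq[OF s1(1), symmetric]
      using s1 c' mass[OF s1(1)] u01[OF s1(1)] by (intro weighted_integral_le_excess u F) auto
    also have "\<dots> \<le> ennreal (d / 2) + ennreal (d / 2)"
      using c' s1 by (intro add_mono) auto
    also have "\<dots> = ennreal d" using d by (simp flip: ennreal_plus)
    finally have Us1: "U s1 \<le> d" using d by (simp add: ennreal_le_iff)
    define W where "W s = U (s + \<beta>) - U s" for s
    have W1: "\<beta> * b \<le> W s1" using mono[of \<beta> "s1 + \<beta>"] Us1 s1 \<beta> by (auto simp: W_def d_def)
    have "superlevel M F b < \<infinity>" using superlevel_finite[OF F _ fin[of "b / 2"]] b by auto
    then obtain n where n: "0 \<le> n" "superlevel M F b = ennreal n"
      by (cases "superlevel M F b") auto
    \<comment> \<open>From \<open>s2\<close> on the supergradient is at most \<open>b\<close>.\<close>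
    define s2 where "s2 = max s1 n"
    have s2: "s1 \<le> s2" "0 < s2" using s1 by (auto simp: s2_def)
    have "c s2 \<le> b" using b n by (intro c_le[OF s2(2)]) (auto simp: s2_def intro: ennreal_leI)
    moreover have "W s2 \<le> \<beta> * c s2" using grad[of s2 "s2 + \<beta>"] s2 \<beta> by (simp add: W_def)
    ultimately have W2: "W s2 \<le> \<beta> * b" using \<beta> by (meson less_imp_le mult_left_mono order_trans)
    have "continuous_on {s1..s2} W"
      unfolding W_def
      by (intro continuous_intros continuous_on_compose2[OF cont] continuous_on_subset[OF cont])
        (use s1 \<beta> in auto)
    then obtain s where s: "s1 \<le> s" "s \<le> s2" "W s = \<beta> * b"
      using IVT2'[of W s2 "\<beta> * b" s1] W1 W2 s2 by auto
    have s0: "0 < s" and s\<beta>: "0 < s + \<beta>" using s s1 \<beta> by auto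
    have "ennreal s \<le> ennreal (s + \<beta>)" using \<beta> by (intro ennreal_leI) simp
    then have cc: "c (s + \<beta>) \<le> c s"
      by (rule c_le[OF s\<beta> c0[OF s0] order_trans[OF lev[OF s0]]])
    have uu: "u s x \<le> u (s + \<beta>) x" for x
    proof (cases "c (s + \<beta>) = c s")
      case True
      have "\<theta> s \<le> \<theta> (s + \<beta>)"
      proof (rule ccontr)
        assume neg: "\<not> ?thesis"
        then have pos: "0 < c s" using th(3)[OF s0] th(1)[OF s\<beta>] c0[OF s0] by force
        have "mass M (\<lambda>x. u (s + \<beta>) x) \<le> mass M (u s)"
          using neg True by (intro nn_integral_mono ennreal_leI) (auto simp: u_def top_weight_def)
        then show False using mass(2)[OF s0] mass(2)[OF s\<beta>] pos True s0 \<beta> by (simp add: ennreal_le_iff)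
      qed
      then show ?thesis using True by (auto simp: u_def top_weight_def)
    next
      case False
      then show ?thesis using cc th(1,2)[OF s0] th(1,2)[OF s\<beta>] by (auto simp: u_def top_weight_def)
    qed
    define v where "v x = u (s + \<beta>) x - u s x" for x
    have [measurable]: "v \<in> borel_measurable M" "u s \<in> borel_measurable M"
      unfolding v_def[abs_def] using u by auto
    have v01: "0 \<le> v x" "v x \<le> 1" for x
      using uu[of x] u01(1)[OF s0, of x] u01(2)[OF s\<beta>, of x] by (auto simp: v_def)
    have split: "mass M (\<lambda>x. u (s + \<beta>) x) = mass M (u s) + mass M v"
    proof -
      have "mass M (\<lambda>x. u (s + \<beta>) x) = (\<integral>\<^sup>+x. ennreal (u s x) + ennreal (v x) \<partial>M)"
        using v01 u01[OF s0] by (intro nn_integral_cong) (simp add: v_def flip: ennreal_plus)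
      then show ?thesis by (simp add: nn_integral_add)
    qed
    have "mass M (\<lambda>x. u (s + \<beta>) x * F x) = (\<integral>\<^sup>+x. ennreal (u s x * F x) + ennreal (v x * F x) \<partial>M)"
      using v01 u01[OF s0] nn
      by (intro nn_integral_cong) (simp add: v_def ennreal_plus[symmetric] left_diff_distrib mult_right_mono uu del: ennreal_plus)
    then have "ennreal (U (s + \<beta>)) = ennreal (U s) + mass M (\<lambda>x. v x * F x)"
      unfolding Ueq[OF s0, symmetric] Ueq[OF s\<beta>, symmetric] by (simp add: nn_integral_add)
    moreover have "ennreal (U (s + \<beta>)) = ennreal (U s) + ennreal (\<beta> * b)"
      using s(3) \<beta> b U0 by (simp add: W_def flip: ennreal_plus)
    ultimately have vF: "mass M (\<lambda>x. v x * F x) = ennreal (\<beta> * b)" by simp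
    have sb: "ennreal (s + \<beta>) = ennreal s + ennreal \<beta>" using s0 \<beta> by (simp add: ennreal_plus)
    have mv: "mass M v = ennreal \<beta>" if "0 < c (s + \<beta>)"
    proof -
      have "0 < c s" using that cc by simp
      then have "ennreal s + ennreal \<beta> = ennreal s + mass M v"
        using split mass(2)[OF s0] mass(2)[OF s\<beta> that] by (simp add: sb)
      then show ?thesis by simp
    qed
    have mv_le: "mass M v \<le> ennreal \<beta>"
    proof (cases "0 < c s")
      case True
      have "ennreal s + mass M v \<le> ennreal s + ennreal \<beta>"
        using split mass(2)[OF s0 True] mass(1)[OF s\<beta>] by (simp add: sb)
      then show ?thesis by simp
    next
      case False
      then have "c s = 0" "c (s + \<beta>) = 0" using c0[OF s0] c0[OF s\<beta>] cc by auto
      then have "v x = 0" for x using th(3)[OF s0] th(3)[OF s\<beta>] by (simp add: v_def u_def)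
      then show ?thesis by simp
    qed
    have "(\<forall>x. c (s + \<beta>) < F x \<and> F x < c s \<longrightarrow> v x = 1) \<and> (\<forall>x. c s < F x \<longrightarrow> v x = 0)"
      "\<forall>x. F x < c (s + \<beta>) \<longrightarrow> v x = 0"
      using cc by (auto simp: v_def u_def top_weight_def)
    then have "interval_weight M F \<beta> b (c (s + \<beta>)) v"
      unfolding interval_weight_def using v01 vF mv mv_le c0[OF s\<beta>] cc by auto
    then show ?thesis by blast
  qed
qed

subsection \<open>The excess left after an extraction\<close>

text \<open>Convexity on \<open>[0, \<infinity>)\<close> for values in \<open>ennreal\<close>, multiplied out because the values
  may be infinite.\<close>

definition ennreal_convex :: "(real \<Rightarrow> ennreal) \<Rightarrow> bool" where
  "ennreal_convex \<Psi> \<longleftrightarrow> (\<forall>p c q. 0 \<le> p \<longrightarrow> p \<le> c \<longrightarrow> c \<le> q \<longrightarrow>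
     ennreal (q - p) * \<Psi> c \<le> ennreal (q - c) * \<Psi> p + ennreal (c - p) * \<Psi> q)"

lemma ennreal_convex_sum:
  "ennreal_convex (\<lambda>c. \<Sum>i. ennreal (\<beta> i) * ennreal (b i - c))"
  unfolding ennreal_convex_def
proof (intro allI impI)
  fix p c q :: real assume h: "0 \<le> p" "p \<le> c" "c \<le> q"
  have single: "ennreal (q - p) * ennreal (a - c) \<le> ennreal (q - c) * ennreal (a - p) + ennreal (c - p) * ennreal (a - q)"
    for a
  proof (cases "a \<le> c")
    case False
    have "(q - p) * (a - c) \<le> (q - c) * (a - p) + (c - p) * max (a - q) 0"
    proof -
      have "(q - p) * (a - c) = (q - c) * (a - p) + (c - p) * (a - q)" by (simp add: algebra_simps)
      also have "(c - p) * (a - q) \<le> (c - p) * max (a - q) 0" using h by (intro mult_left_mono) auto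
      finally show ?thesis by simp
    qed
    then have "ennreal ((q - p) * (a - c)) \<le> ennreal ((q - c) * (a - p) + (c - p) * max (a - q) 0)"
      by (rule ennreal_leI)
    also have "\<dots> = ennreal (q - c) * ennreal (a - p) + ennreal (c - p) * ennreal (max (a - q) 0)"
      using h False by (simp add: ennreal_plus ennreal_mult)
    also have "ennreal (max (a - q) 0) = ennreal (a - q)" by (auto simp: max_def ennreal_neg)
    finally show ?thesis using h False by (simp add: ennreal_mult)
  qed (simp add: ennreal_neg)
  have "ennreal (q - p) * (\<Sum>i. ennreal (\<beta> i) * ennreal (b i - c)) =
      (\<Sum>i. ennreal (\<beta> i) * (ennreal (q - p) * ennreal (b i - c)))"
    by (simp add: ennreal_suminf_cmult[symmetric] mult.left_commute del: ennreal_suminf_cmult)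
  also have "\<dots> \<le> (\<Sum>i. ennreal (\<beta> i) * (ennreal (q - c) * ennreal (b i - p) + ennreal (c - p) * ennreal (b i - q)))"
    by (intro suminf_le mult_left_mono single summableI) auto
  also have "\<dots> = (\<Sum>i. ennreal (q - c) * (ennreal (\<beta> i) * ennreal (b i - p)) + ennreal (c - p) * (ennreal (\<beta> i) * ennreal (b i - q)))"
    by (simp add: distrib_left mult.left_commute)
  also have "\<dots> = ennreal (q - c) * (\<Sum>i. ennreal (\<beta> i) * ennreal (b i - p)) +
      ennreal (c - p) * (\<Sum>i. ennreal (\<beta> i) * ennreal (b i - q))"
    by (simp add: suminf_add[symmetric] summableI)
  finally show "ennreal (q - p) * (\<Sum>i. ennreal (\<beta> i) * ennreal (b i - c)) \<le>
     ennreal (q - c) * (\<Sum>i. ennreal (\<beta> i) * ennreal (b i - p)) +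
      ennreal (c - p) * (\<Sum>i. ennreal (\<beta> i) * ennreal (b i - q))" .
qed

abbreviation weighted_excess :: "'a measure \<Rightarrow> ('a \<Rightarrow> real) \<Rightarrow> ('a \<Rightarrow> real) \<Rightarrow> real \<Rightarrow> ennreal" where
  "weighted_excess M \<rho> F c \<equiv> (\<integral>\<^sup>+x. ennreal (\<rho> x) * ennreal (F x - c) \<partial>M)"

text \<open>Below the interval \<open>[p, q]\<close> of extracted levels the excess drops by exactly
  \<open>\<beta> * (b - c)\<close>, above it nothing changes, and on it the new excess is affine, so that a convex
  function which it dominates at \<open>p\<close> and \<open>q\<close> is dominated in between.  If \<open>q = \<infinity>\<close>, the new excess
  vanishes from \<open>p\<close> on, and so does the antitone function which it dominates at \<open>p\<close>.\<close>

lemma residual_dominates: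
  fixes F :: "'a \<Rightarrow> real"
  assumes F [measurable]: "F \<in> borel_measurable M" and nn: "\<And>x. 0 \<le> F x"
    and \<beta>: "0 < \<beta>" and b: "0 < b" and iw: "interval_weight M F \<beta> b p v"
    and anti: "\<And>c c'. c \<le> c' \<Longrightarrow> \<Psi> c' \<le> \<Psi> c" and conv: "ennreal_convex \<Psi>"
    and dom: "\<And>c. 0 \<le> c \<Longrightarrow> \<Psi> c + ennreal \<beta> * ennreal (b - c) \<le> excess M F c"
    and c: "0 \<le> c"
  shows "\<Psi> c \<le> weighted_excess M (\<lambda>x. 1 - v x) F c"
proof -
  have v [measurable]: "v \<in> borel_measurable M" and v01: "\<And>x. 0 \<le> v x" "\<And>x. v x \<le> 1" and p: "0 \<le> p"
    and mass: "0 < p \<Longrightarrow> mass M v = ennreal \<beta>" and mean: "mass M (\<lambda>x. v x * F x) = ennreal (\<beta> * b)"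
    and low: "\<And>x. F x < p \<Longrightarrow> v x = 0"
    and up: "(\<forall>x. p < F x \<longrightarrow> v x = 1) \<or>
      (\<exists>q\<ge>p. (\<forall>x. p < F x \<and> F x < q \<longrightarrow> v x = 1) \<and> (\<forall>x. q < F x \<longrightarrow> v x = 0))"
    using iw by (auto simp: interval_weight_def)
  define R where "R c = weighted_excess M (\<lambda>x. 1 - v x) F c" for c
  have below: "\<Psi> c \<le> R c" if c: "0 \<le> c" "c \<le> p" for c
  proof -
    define I where "I = weighted_excess M v F c"
    have "excess M F c = (\<integral>\<^sup>+x. ennreal (v x) * ennreal (F x - c) + ennreal (1 - v x) * ennreal (F x - c) \<partial>M)"
      unfolding excess_def
      using v01 by (intro nn_integral_cong) (simp add: distrib_right[symmetric] flip: ennreal_plus)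
    also have "\<dots> = I + R c" unfolding I_def R_def by (rule nn_integral_add) auto
    finally have split: "excess M F c = I + R c" .
    have "ennreal (\<beta> * b) = (\<integral>\<^sup>+x. ennreal (v x) * ennreal (F x - c) + ennreal c * ennreal (v x) \<partial>M)"
      unfolding mean[symmetric]
    proof (intro nn_integral_cong)
      fix x
      show "ennreal (v x * F x) = ennreal (v x) * ennreal (F x - c) + ennreal c * ennreal (v x)"
      proof (cases "F x < p")
        case True then show ?thesis using low by simp
      next
        case False
        then have "c \<le> F x" using c by simp
        have "v x * F x = v x * (F x - c) + c * v x" by (simp add: algebra_simps)
        then show ?thesis using v01(1)[of x] c \<open>c \<le> F x\<close> by (simp only: ennreal_plus ennreal_mult mult_nonneg_nonneg diff_ge_0_iff_ge)
      qed
    qed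
    also have "\<dots> = I + ennreal c * mass M v"
      unfolding I_def by (simp add: nn_integral_add nn_integral_cmult)
    also have "\<dots> = I + ennreal (c * \<beta>)"
      using c mass \<beta> by (cases "c = 0") (auto simp: ennreal_mult)
    finally have Ic: "ennreal (\<beta> * b) = I + ennreal (c * \<beta>)" .
    then obtain i where i: "0 \<le> i" "I = ennreal i" by (cases I) auto
    then have "\<beta> * b = i + c * \<beta>" using Ic c \<beta> b by (simp flip: ennreal_plus)
    then have ib: "i = \<beta> * (b - c)" by (simp add: algebra_simps)
    then have "0 \<le> b - c" using i(1) \<beta> by (simp add: zero_le_mult_iff)
    then have "ennreal \<beta> * ennreal (b - c) = I" using i ib \<beta> by (simp add: ennreal_mult)
    then have "\<Psi> c + I \<le> R c + I" using dom[OF c(1)] split by (simp add: add.commute)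
    then show ?thesis using i by (simp add: ennreal_add_left_cancel_le add.commute)
  qed
  show ?thesis
  proof (cases "c \<le> p")
    case True
    then show ?thesis using below[OF c] by (simp add: R_def)
  next
    case cp: False
    from up show ?thesis
    proof (elim disjE exE conjE)
      assume one: "\<forall>x. p < F x \<longrightarrow> v x = 1"
      have "R p = (\<integral>\<^sup>+x. 0 \<partial>M)" unfolding R_def
      proof (intro nn_integral_cong)
        fix x show "ennreal (1 - v x) * ennreal (F x - p) = 0"
          using one by (cases "p < F x") (auto simp: ennreal_neg)
      qed
      then have "\<Psi> p = 0" using below[OF p order_refl] by simp
      then have "\<Psi> c = 0" using anti[of p c] cp by simp
      then show ?thesis by simp
    next
      fix q assume q: "p \<le> q" "\<forall>x. p < F x \<and> F x < q \<longrightarrow> v x = 1" "\<forall>x. q < F x \<longrightarrow> v x = 0"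
      have above: "\<Psi> c \<le> R c" if c: "q \<le> c" for c
      proof -
        have "0 \<le> c" using c q p by simp
        have "\<Psi> c \<le> \<Psi> c + ennreal \<beta> * ennreal (b - c)" by simp
        also have "\<dots> \<le> excess M F c" by (rule dom) fact
        also have "excess M F c = R c"
          unfolding R_def excess_def
        proof (intro nn_integral_cong)
          fix x show "ennreal (F x - c) = ennreal (1 - v x) * ennreal (F x - c)"
            using q(3) c by (cases "q < F x") (auto simp: ennreal_neg)
        qed
        finally show ?thesis .
      qed
      show ?thesis
      proof (cases "q \<le> c")
        case True then show ?thesis using above by (simp add: R_def)
      next
        case False
        then have pcq: "p \<le> c" "c \<le> q" "p < q" using cp by auto
        have "ennreal (q - p) * \<Psi> c \<le> ennreal (q - c) * \<Psi> p + ennreal (c - p) * \<Psi> q"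
          using conv p pcq unfolding ennreal_convex_def by blast
        also have "\<dots> \<le> ennreal (q - c) * R p + ennreal (c - p) * R q"
          using below[OF p order_refl] above[OF order_refl] by (intro add_mono mult_left_mono) auto
        also have "\<dots> = (\<integral>\<^sup>+x. ennreal (q - c) * (ennreal (1 - v x) * ennreal (F x - p)) +
            ennreal (c - p) * (ennreal (1 - v x) * ennreal (F x - q)) \<partial>M)"
          unfolding R_def by (subst nn_integral_add) (auto simp: nn_integral_cmult)
        also have "\<dots> = (\<integral>\<^sup>+x. ennreal (q - p) * (ennreal (1 - v x) * ennreal (F x - c)) \<partial>M)"
        proof (intro nn_integral_cong)
          fix x
          have *: "ennreal (q - c) * ennreal (F x - p) + ennreal (c - p) * ennreal (F x - q) =
              ennreal (q - p) * ennreal (F x - c)" if "F x \<le> p \<or> q \<le> F x"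
            using that
          proof
            assume "F x \<le> p"
            then show ?thesis using pcq by (simp add: ennreal_neg)
          next
            assume qF: "q \<le> F x"
            have "(q - c) * (F x - p) + (c - p) * (F x - q) = (q - p) * (F x - c)" by (simp add: algebra_simps)
            then show ?thesis using qF pcq
              by (simp add: ennreal_mult[symmetric] flip: ennreal_plus)
          qed
          show "ennreal (q - c) * (ennreal (1 - v x) * ennreal (F x - p)) +
            ennreal (c - p) * (ennreal (1 - v x) * ennreal (F x - q)) =
            ennreal (q - p) * (ennreal (1 - v x) * ennreal (F x - c))"
          proof (cases "F x \<le> p \<or> q \<le> F x")
            case True
            show ?thesis
              using arg_cong[OF *[OF True], of "\<lambda>y. ennreal (1 - v x) * y"]
              by (simp add: distrib_left mult.left_commute)
          qed (use q(2) in auto)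
        qed
        also have "\<dots> = ennreal (q - p) * R c" unfolding R_def by (rule nn_integral_cmult) auto
        finally show ?thesis using pcq unfolding R_def[symmetric]
          by (subst (asm) ennreal_mult_le_mult_iff) auto
      qed
    qed
  qed
qed

text \<open>Here \<open>\<rho>\<close> is the density of the mass still available and \<open>\<rho>'\<close> that of the mass left after the
  extraction; the interval weight is taken with respect to the measure with density \<open>\<rho>\<close>.\<close>

lemma extraction_step:
  fixes F :: "'a \<Rightarrow> real"
  assumes F [measurable]: "F \<in> borel_measurable M" and nn: "\<And>x. 0 \<le> F x"
    and \<rho> [measurable]: "\<rho> \<in> borel_measurable M" and \<rho>01: "\<And>x. 0 \<le> \<rho> x" "\<And>x. \<rho> x \<le> 1"
    and fin: "\<And>c. 0 < c \<Longrightarrow> excess M F c < \<infinity>" and \<beta>: "0 \<le> \<beta>" and b: "0 \<le> b"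
    and anti: "\<And>c c'. c \<le> c' \<Longrightarrow> \<Psi> c' \<le> \<Psi> c" and conv: "ennreal_convex \<Psi>"
    and dom: "\<And>c. 0 \<le> c \<Longrightarrow> \<Psi> c + ennreal \<beta> * ennreal (b - c) \<le> weighted_excess M \<rho> F c"
  shows "\<exists>\<rho>'. \<rho>' \<in> borel_measurable M \<and> (\<forall>x. 0 \<le> \<rho>' x \<and> \<rho>' x \<le> \<rho> x) \<and>
    (\<forall>c\<ge>0. \<Psi> c \<le> weighted_excess M \<rho>' F c) \<and>
    mass M (\<lambda>x. \<rho> x - \<rho>' x) \<le> ennreal \<beta> \<and>
    ennreal (\<beta> * b) \<le> mass M (\<lambda>x. (\<rho> x - \<rho>' x) * F x)"
proof (cases "\<beta> = 0 \<or> b = 0")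
  case True
  have "\<Psi> c \<le> weighted_excess M \<rho> F c" if "0 \<le> c" for c
    using dom[OF that] by (rule order_trans[OF add_increasing2[OF zero_le order_refl]])
  then show ?thesis using True \<rho> \<rho>01 by (intro exI[of _ \<rho>]) auto
next
  case False
  then have \<beta>: "0 < \<beta>" and b: "0 < b" using \<beta> b by auto
  define N where "N = density M (\<lambda>x. ennreal (\<rho> x))"
  have intN: "(\<integral>\<^sup>+x. h x \<partial>N) = (\<integral>\<^sup>+x. ennreal (\<rho> x) * h x \<partial>M)" if "h \<in> borel_measurable M" for h
    unfolding N_def using that by (intro nn_integral_density) auto
  have exN: "excess N F c = weighted_excess M \<rho> F c" for c
    unfolding excess_def by (rule intN) measurable
  have FN [measurable]: "F \<in> borel_measurable N" by (simp add: N_def)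
  have finN: "excess N F c < \<infinity>" if "0 < c" for c
  proof -
    have "excess N F c \<le> excess M F c"
      unfolding exN unfolding excess_def
    proof (intro nn_integral_mono)
      fix x show "ennreal (\<rho> x) * ennreal (F x - c) \<le> ennreal (F x - c)"
        using mult_right_mono[of "ennreal (\<rho> x)" 1 "ennreal (F x - c)"] \<rho>01(2)[of x] by simp
    qed
    then show ?thesis using fin[OF that] by (rule le_less_trans)
  qed
  have domN: "\<Psi> c + ennreal \<beta> * ennreal (b - c) \<le> excess N F c" if "0 \<le> c" for c
    unfolding exN using dom[OF that] .
  have domN': "ennreal \<beta> * ennreal (b - c) \<le> excess N F c" if "0 \<le> c" for c
    using domN[OF that] by (rule order_trans[OF add_increasing[OF zero_le order_refl]])
  obtain p v where iw: "interval_weight N F \<beta> b p v"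
    using interval_weight_exists[OF FN nn finN \<beta> b domN'] by blast
  then have v: "v \<in> borel_measurable N" "\<And>x. 0 \<le> v x" "\<And>x. v x \<le> 1" "mass N v \<le> ennreal \<beta>"
    "mass N (\<lambda>x. v x * F x) = ennreal (\<beta> * b)" by (auto simp: interval_weight_def)
  have vm [measurable]: "v \<in> borel_measurable M" using v(1) by (simp add: N_def)
  define \<rho>' where "\<rho>' x = \<rho> x * (1 - v x)" for x
  have [measurable]: "\<rho>' \<in> borel_measurable M" unfolding \<rho>'_def[abs_def] by measurable
  have diff: "\<rho> x - \<rho>' x = \<rho> x * v x" for x by (simp add: \<rho>'_def algebra_simps)
  have "\<Psi> c \<le> weighted_excess M \<rho>' F c" if c: "0 \<le> c" for c
  proof -
    have "\<Psi> c \<le> weighted_excess N (\<lambda>x. 1 - v x) F c"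
      by (rule residual_dominates[OF FN nn \<beta> b iw anti conv domN c])
    also have "\<dots> = (\<integral>\<^sup>+x. ennreal (\<rho> x) * (ennreal (1 - v x) * ennreal (F x - c)) \<partial>M)"
      by (rule intN) measurable
    also have "\<dots> = weighted_excess M \<rho>' F c"
      using \<rho>01 v(3) by (intro nn_integral_cong) (simp add: \<rho>'_def ennreal_mult mult.assoc)
    finally show ?thesis .
  qed
  moreover have "mass M (\<lambda>x. \<rho> x - \<rho>' x) \<le> ennreal \<beta>"
    using v(4) unfolding diff by (subst (asm) intN) (auto simp: ennreal_mult \<rho>01 v(2))
  moreover have "ennreal (\<beta> * b) \<le> mass M (\<lambda>x. (\<rho> x - \<rho>' x) * F x)"
    unfolding diff v(5)[symmetric]
    by (subst intN) (auto simp: ennreal_mult' ennreal_mult'' \<rho>01 v(2) nn mult.assoc)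
  moreover have "0 \<le> \<rho>' x \<and> \<rho>' x \<le> \<rho> x" for x
    using \<rho>01(1)[of x] v(2,3)[of x] by (auto simp: \<rho>'_def mult_left_le)
  ultimately show ?thesis by (intro exI[of _ \<rho>']) auto
qed

text \<open>The pairs \<open>(\<beta> i, b i)\<close> are served one after the other, in any order: the invariant is that the
  excess of the mass left dominates the joint excess of the pairs not yet served, and each extraction
  preserves it.  As \<open>v i\<close> is the difference of successive densities, the sums telescope.\<close>

lemma greedy_extraction:
  fixes F :: "'a \<Rightarrow> real" and \<beta> b :: "nat \<Rightarrow> real"
  assumes F [measurable]: "F \<in> borel_measurable M" and nn: "\<And>x. 0 \<le> F x"
    and fin: "\<And>c. 0 < c \<Longrightarrow> excess M F c < \<infinity>"
    and \<beta>: "\<And>i. 0 \<le> \<beta> i" and b: "\<And>i. 0 \<le> b i"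
    and dom: "\<And>c. 0 \<le> c \<Longrightarrow> (\<Sum>i. ennreal (\<beta> i) * ennreal (b i - c)) \<le> excess M F c"
  obtains v where "\<And>i. v i \<in> borel_measurable M" "\<And>i x. 0 \<le> v i x" "\<And>n x. (\<Sum>i<n. v i x) \<le> 1"
    "\<And>i. mass M (v i) \<le> ennreal (\<beta> i)"
    "\<And>i. ennreal (\<beta> i * b i) \<le> mass M (\<lambda>x. v i x * F x)"
proof -
  define \<Psi> where "\<Psi> n c = (\<Sum>i. ennreal (\<beta> (i + n)) * ennreal (b (i + n) - c))" for n c
  define P where "P n \<rho> \<longleftrightarrow> \<rho> \<in> borel_measurable M \<and> (\<forall>x. 0 \<le> \<rho> x \<and> \<rho> x \<le> 1) \<and>
    (\<forall>c\<ge>0. \<Psi> n c \<le> weighted_excess M \<rho> F c)" for n \<rho>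
  define Q where "Q n \<rho> \<rho>' \<longleftrightarrow> (\<forall>x. \<rho>' x \<le> \<rho> x) \<and>
    mass M (\<lambda>x. \<rho> x - \<rho>' x) \<le> ennreal (\<beta> n) \<and>
    ennreal (\<beta> n * b n) \<le> mass M (\<lambda>x. (\<rho> x - \<rho>' x) * F x)" for n and \<rho> \<rho>' :: "'a \<Rightarrow> real"
  have \<Psi>_Suc: "\<Psi> n c = \<Psi> (Suc n) c + ennreal (\<beta> n) * ennreal (b n - c)" for n c
    unfolding \<Psi>_def
    using suminf_offset[of "\<lambda>i. ennreal (\<beta> (i + n)) * ennreal (b (i + n) - c)" 1]
    by (simp add: add.commute)
  have "P 0 (\<lambda>_. 1)" unfolding P_def \<Psi>_def using dom by (simp add: excess_def)
  moreover have "\<exists>\<rho>'. P (Suc n) \<rho>' \<and> Q n \<rho> \<rho>'" if \<rho>: "P n \<rho>" for n \<rho>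
  proof -
    have "\<exists>\<rho>'. \<rho>' \<in> borel_measurable M \<and> (\<forall>x. 0 \<le> \<rho>' x \<and> \<rho>' x \<le> \<rho> x) \<and>
      (\<forall>c\<ge>0. \<Psi> (Suc n) c \<le> weighted_excess M \<rho>' F c) \<and>
      mass M (\<lambda>x. \<rho> x - \<rho>' x) \<le> ennreal (\<beta> n) \<and>
      ennreal (\<beta> n * b n) \<le> mass M (\<lambda>x. (\<rho> x - \<rho>' x) * F x)"
    proof (rule extraction_step[OF F nn _ _ _ fin \<beta> b])
      show "\<Psi> (Suc n) c' \<le> \<Psi> (Suc n) c" if "c \<le> c'" for c c'
        unfolding \<Psi>_def using that by (intro suminf_le summableI mult_left_mono ennreal_leI) auto
      show "ennreal_convex (\<Psi> (Suc n))"
        unfolding \<Psi>_def using ennreal_convex_sum[of "\<lambda>i. \<beta> (i + Suc n)" "\<lambda>i. b (i + Suc n)"] by simp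
      show "\<Psi> (Suc n) c + ennreal (\<beta> n) * ennreal (b n - c) \<le> weighted_excess M \<rho> F c"
        if "0 \<le> c" for c
        using \<rho> that unfolding P_def \<Psi>_Suc[symmetric] by blast
    qed (use \<rho> in \<open>auto simp: P_def\<close>)
    then obtain \<rho>' where \<rho>': "\<rho>' \<in> borel_measurable M" "\<And>x. 0 \<le> \<rho>' x \<and> \<rho>' x \<le> \<rho> x"
      "\<forall>c\<ge>0. \<Psi> (Suc n) c \<le> weighted_excess M \<rho>' F c"
      "mass M (\<lambda>x. \<rho> x - \<rho>' x) \<le> ennreal (\<beta> n)"
      "ennreal (\<beta> n * b n) \<le> mass M (\<lambda>x. (\<rho> x - \<rho>' x) * F x)" by blast
    have "\<rho>' x \<le> 1" for x using \<rho>'(2)[of x] \<rho> by (auto simp: P_def intro: order_trans)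
    then have "P (Suc n) \<rho>'" "Q n \<rho> \<rho>'" using \<rho>' by (auto simp: P_def Q_def)
    then show ?thesis by blast
  qed
  ultimately obtain \<rho> where \<rho>: "\<And>n. P n (\<rho> n)" "\<And>n. Q n (\<rho> n) (\<rho> (Suc n))"
    using dependent_nat_choice[of P Q] by metis
  have [measurable]: "\<rho> n \<in> borel_measurable M" for n using \<rho>(1) by (simp add: P_def)
  show ?thesis
  proof (rule that[of "\<lambda>i x. \<rho> i x - \<rho> (Suc i) x"])
    fix n x
    have "(\<Sum>i<n. \<rho> i x - \<rho> (Suc i) x) = \<rho> 0 x - \<rho> n x"
      using sum_lessThan_telescope'[of "\<lambda>i. \<rho> i x" n] by simp
    also have "\<rho> 0 x \<le> 1" "0 \<le> \<rho> n x" using \<rho>(1) by (auto simp: P_def)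
    then have "\<rho> 0 x - \<rho> n x \<le> 1" by linarith
    finally show "(\<Sum>i<n. \<rho> i x - \<rho> (Suc i) x) \<le> 1" .
    show "(\<lambda>x. \<rho> i x - \<rho> (Suc i) x) \<in> borel_measurable M" for i by measurable
  qed (use \<rho> in \<open>auto simp: P_def Q_def\<close>)
qed

section \<open>Matching a function with a majorant\<close>

lemma nn_integral_exhaustion:
  fixes A :: "nat \<Rightarrow> 'a set"
  assumes A [measurable]: "\<And>i. A i \<in> sets M" "incseq A" "(\<Union>i. A i) = space M"
    and [measurable]: "h \<in> borel_measurable M"
  shows "(\<integral>\<^sup>+x. h x \<partial>M) = (SUP i. \<integral>\<^sup>+x. h x * indicator (A i) x \<partial>M)"
proof -
  have "(\<integral>\<^sup>+x. h x \<partial>M) = (\<integral>\<^sup>+x. (SUP i. h x * indicator (A i) x) \<partial>M)"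
  proof (intro nn_integral_cong)
    fix x assume "x \<in> space M"
    then obtain i where "x \<in> A i" using A(3) by blast
    then have "h x = h x * indicator (A i) x" by simp
    also have "\<dots> \<le> (SUP i. h x * indicator (A i) x)" by (rule SUP_upper) simp
    finally show "h x = (SUP i. h x * indicator (A i) x)"
      by (intro antisym SUP_least) (auto simp: indicator_def)
  qed
  also have "\<dots> = (SUP i. \<integral>\<^sup>+x. h x * indicator (A i) x \<partial>M)"
  proof (rule nn_integral_monotone_convergence_SUP)
    show "incseq (\<lambda>i x. h x * indicator (A i) x)"
    proof (intro incseq_SucI le_funI)
      fix i x show "h x * indicator (A i) x \<le> h x * indicator (A (Suc i)) x"
        using incseq_SucD[OF A(2), of i] by (auto simp: indicator_def)
    qed
  qed measurable
  finally show ?thesis .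
qed

context sigma_finite_measure
begin

text \<open>With \<open>B \<subseteq> {g > c}\<close> of finite mass \<open>t\<close>, the integral of \<open>g\<close> over \<open>B\<close> is at most
  \<open>K(g, t) \<le> K(f, t) \<le> excess M f c + t * c\<close>; subtracting \<open>t * c\<close> and letting \<open>B\<close> grow
  compares the excesses.\<close>

lemma excess_le_of_K_le:
  assumes g: "g \<in> Sum_space M" "\<And>x. 0 \<le> g x" and f: "f \<in> Sum_space M" "\<And>x. 0 \<le> f x"
    and K: "\<And>t. 0 < t \<Longrightarrow> K_functional M g t \<le> K_functional M f t" and c: "0 \<le> c"
  shows "excess M g c \<le> excess M f c"
proof (cases "excess M f c = \<infinity>")
  case False
  note [measurable] = Sum_space_measurable[OF g(1)] Sum_space_measurable[OF f(1)]
  obtain E where E: "0 \<le> E" "excess M f c = ennreal E" using False by (cases "excess M f c") auto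
  have part: "(\<integral>\<^sup>+x. ennreal (g x - c) * indicator B x \<partial>M) \<le> ennreal E"
    if B [measurable]: "B \<in> sets M" and Bf: "emeasure M B \<noteq> \<infinity>" and Bg: "\<And>x. x \<in> B \<Longrightarrow> c < g x" for B
  proof -
    obtain t where t: "0 \<le> t" "emeasure M B = ennreal t" using Bf by (cases "emeasure M B") auto
    show ?thesis
    proof (cases "t = 0")
      case True
      then have "B \<in> null_sets M" using t by (intro null_setsI) auto
      then have "AE x in M. x \<notin> B" by (rule AE_not_in)
      then have "(\<integral>\<^sup>+x. ennreal (g x - c) * indicator B x \<partial>M) = (\<integral>\<^sup>+x. 0 \<partial>M)"
        by (intro nn_integral_cong_AE) (auto elim!: eventually_mono)
      then show ?thesis by simp
    next
      case False
      then have tpos: "0 < t" using t by simp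
      have upper: "mass M (\<lambda>x. indicator B x * g x) \<le> excess M g c' + ennreal (t * c')" if "0 \<le> c'" for c'
        using that t by (intro weighted_integral_le_excess) (auto simp: ennreal_indicator)
      obtain c0 where c0: "0 \<le> c0" "excess M g c0 < \<infinity>" by (rule excess_finite_nonneg[OF g])
      have "mass M (\<lambda>x. indicator B x * g x) < \<infinity>"
        by (rule le_less_trans[OF upper[OF c0(1)]]) (use c0(2) in simp)
      then obtain y where y: "0 \<le> y" "mass M (\<lambda>x. indicator B x * g x) = ennreal y"
        by (cases "\<integral>\<^sup>+x. ennreal (indicator B x * g x) \<partial>M") auto
      have "y \<le> K_functional M g t"
      proof (rule K_functional_ge[OF g(1)])
        fix c' A :: real assume h: "0 \<le> c'" "0 \<le> A" "excess M g c' \<le> ennreal A"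
        have "ennreal y \<le> ennreal A + ennreal (t * c')"
          using upper[OF h(1)] h(3) y(2) by (simp add: add_right_mono order_trans)
        then show "y \<le> A + t * c'" using h t by (simp add: ennreal_plus[symmetric] ennreal_le_iff del: ennreal_plus)
      qed
      also have "\<dots> \<le> K_functional M f t" by (rule K[OF tpos])
      also have "\<dots> \<le> E + t * c" using E c t f(2) by (intro K_functional_le) auto
      finally have yE: "y \<le> E + t * c" .
      have "ennreal y = (\<integral>\<^sup>+x. ennreal (g x - c) * indicator B x + ennreal c * indicator B x \<partial>M)"
        unfolding y(2)[symmetric]
      proof (intro nn_integral_cong)
        fix x show "ennreal (indicator B x * g x) = ennreal (g x - c) * indicator B x + ennreal c * indicator B x"
          using Bg[of x] c by (auto simp: indicator_def simp flip: ennreal_plus)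
      qed
      also have "\<dots> = (\<integral>\<^sup>+x. ennreal (g x - c) * indicator B x \<partial>M) + ennreal (t * c)"
        using c t by (subst nn_integral_add) (auto simp: nn_integral_cmult_indicator ennreal_mult mult.commute)
      finally have "(\<integral>\<^sup>+x. ennreal (g x - c) * indicator B x \<partial>M) + ennreal (t * c) \<le> ennreal E + ennreal (t * c)"
        using ennreal_leI[OF yE] E c t by (simp add: ennreal_plus)
      then show ?thesis by (simp add: ennreal_add_left_cancel_le add.commute[of _ "ennreal (t * c)"])
    qed
  qed
  obtain A :: "nat \<Rightarrow> 'a set" where A: "range A \<subseteq> sets M" "(\<Union>i. A i) = space M"
    "\<And>i. emeasure M (A i) \<noteq> \<infinity>" "incseq A" by (rule sigma_finite_incseq) blast
  have [measurable]: "A i \<in> sets M" for i using A(1) by auto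
  define B where "B i = A i \<inter> {x\<in>space M. c < g x}" for i
  have [measurable]: "B i \<in> sets M" for i unfolding B_def by measurable
  have "excess M g c = (SUP i. \<integral>\<^sup>+x. ennreal (g x - c) * indicator (A i) x \<partial>M)"
    unfolding excess_def using A(2,4) by (intro nn_integral_exhaustion) auto
  also have "\<dots> = (SUP i. \<integral>\<^sup>+x. ennreal (g x - c) * indicator (B i) x \<partial>M)"
    by (intro SUP_cong refl nn_integral_cong) (auto simp: B_def indicator_def ennreal_neg)
  also have "\<dots> \<le> ennreal E"
  proof (intro SUP_least part)
    fix i
    have "emeasure M (B i) \<le> emeasure M (A i)" by (intro emeasure_mono) (auto simp: B_def)
    then show "emeasure M (B i) \<noteq> \<infinity>" using A(3)[of i] by (auto simp: top_unique)
  qed (auto simp: B_def)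
  finally show ?thesis using E by simp
qed simp

text \<open>Where \<open>g > 0\<close>, the cells are the sets on which \<open>g\<close> lies between two successive powers of \<open>r\<close>,
  cut along a countable partition into sets of finite measure; \<open>b\<close> is the lower power.\<close>

lemma geometric_levels:
  assumes g [measurable]: "g \<in> borel_measurable M" and r: "1 < r"
  obtains J :: "'a \<Rightarrow> nat" and b :: "nat \<Rightarrow> real" where "J \<in> measurable M (count_space UNIV)"
    "\<And>j. 0 \<le> b j" "\<And>x. 0 < g x \<Longrightarrow> b (J x) \<le> g x \<and> g x \<le> r * b (J x)"
    "\<And>j. emeasure M {x\<in>space M. J x = j} < \<infinity>"
proof -
  obtain A :: "nat \<Rightarrow> 'a set" where A: "range A \<subseteq> sets M" "(\<Union>i. A i) = space M"
    "\<And>i. emeasure M (A i) \<noteq> \<infinity>" by (rule sigma_finite_disjoint) blast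
  have [measurable]: "A i \<in> sets M" for i using A(1) by auto
  define n where "n x = (LEAST i. x \<in> A i)" for x
  have [measurable]: "n \<in> measurable M (count_space UNIV)" unfolding n_def[abs_def] by measurable
  define k where "k x = \<lfloor>log r (g x)\<rfloor>" for x
  have [measurable]: "k \<in> measurable M (count_space UNIV)" unfolding k_def[abs_def] by measurable
  define J where "J x = to_nat (k x, n x)" for x
  define b where "b j = r powr real_of_int (fst (from_nat j :: int \<times> nat))" for j
  have "(\<lambda>x. to_nat (i, n x)) \<in> measurable M (count_space UNIV)" for i :: int by measurable
  then have J: "J \<in> measurable M (count_space UNIV)"
    unfolding J_def[abs_def]
    by (rule measurable_compose_countable[where f = "\<lambda>i x. to_nat (i, n x)" and g = k]) measurable
  have bJ: "b (J x) = r powr real_of_int \<lfloor>log r (g x)\<rfloor>" for x by (simp add: b_def J_def k_def)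
  have "b (J x) \<le> g x \<and> g x \<le> r * b (J x)" if x: "0 < g x" for x
  proof
    have gx: "g x = r powr log r (g x)" using r x by simp
    show "b (J x) \<le> g x" unfolding bJ using r by (subst gx) (intro powr_mono, auto)
    have "r powr log r (g x) \<le> r powr (1 + real_of_int \<lfloor>log r (g x)\<rfloor>)"
      using r by (intro powr_mono) linarith+
    then show "g x \<le> r * b (J x)" unfolding bJ using r gx by (simp add: powr_add)
  qed
  moreover have "emeasure M {x\<in>space M. J x = j} < \<infinity>" for j
  proof -
    have "{x\<in>space M. J x = j} \<subseteq> A (snd (from_nat j :: int \<times> nat))"
    proof safe
      fix x assume "x \<in> space M"
      then have "\<exists>i. x \<in> A i" using A(2) by blast
      then have "x \<in> A (n x)" unfolding n_def by (rule LeastI_ex)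
      then show "x \<in> A (snd (from_nat (J x) :: int \<times> nat))" by (simp add: J_def)
    qed
    then have "emeasure M {x\<in>space M. J x = j} \<le> emeasure M (A (snd (from_nat j :: int \<times> nat)))"
      by (intro emeasure_mono) auto
    then show ?thesis using A(3) by (auto simp: less_top[symmetric] top_unique)
  qed
  ultimately show ?thesis using that[of J b] J r by (auto simp: b_def)
qed

lemma level_excess_le:
  fixes J :: "'a \<Rightarrow> nat"
  assumes [measurable]: "g \<in> borel_measurable M" "J \<in> measurable M (count_space UNIV)"
    and le: "\<And>x. 0 < g x \<Longrightarrow> b (J x) \<le> g x"
  shows "(\<Sum>j. emeasure M {x\<in>space M. J x = j \<and> 0 < g x} * ennreal (b j - c)) \<le> excess M g c"
proof -
  let ?B = "\<lambda>j. {x\<in>space M. J x = j \<and> 0 < g x}"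
  have "(\<Sum>j. emeasure M (?B j) * ennreal (b j - c)) =
    (\<Sum>j. \<integral>\<^sup>+x. ennreal (b j - c) * indicator (?B j) x \<partial>M)"
    by (simp add: nn_integral_cmult_indicator mult.commute)
  also have "\<dots> = (\<integral>\<^sup>+x. (\<Sum>j. ennreal (b j - c) * indicator (?B j) x) \<partial>M)"
    by (rule nn_integral_suminf[symmetric]) measurable
  also have "\<dots> \<le> excess M g c"
    unfolding excess_def
  proof (intro nn_integral_mono)
    fix x assume x: "x \<in> space M"
    show "(\<Sum>j. ennreal (b j - c) * indicator (?B j) x) \<le> ennreal (g x - c)"
    proof (cases "0 < g x")
      case True
      have "(\<Sum>j. ennreal (b j - c) * indicator (?B j) x) = ennreal (b (J x) - c)"
        using x True by (intro suminf_cmult_indicator) (auto simp: disjoint_family_on_def)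
      also have "\<dots> \<le> ennreal (g x - c)" using le[OF True] by (intro ennreal_leI) simp
      finally show ?thesis .
    qed simp
  qed
  finally show ?thesis .
qed

text \<open>A set of infinite mass has room for countably many prescribed finite masses, since removing
  finitely many of them leaves infinite mass.\<close>

lemma fill_infinite_mass:
  fixes m :: "nat \<Rightarrow> real"
  assumes Q [measurable]: "Q \<in> sets M" and inf: "emeasure M Q = \<infinity>" and m: "\<And>i. 0 \<le> m i"
  obtains w where "\<And>i. w i \<in> borel_measurable M" "\<And>i x. 0 \<le> w i x"
    "\<And>n x. (\<Sum>i<n. w i x) \<le> indicator Q x" "\<And>i. mass M (w i) = ennreal (m i)"
proof -
  obtain A :: "nat \<Rightarrow> 'a set" where A: "range A \<subseteq> sets M" "(\<Union>i. A i) = space M"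
    "\<And>i. emeasure M (A i) \<noteq> \<infinity>" "incseq A" by (rule sigma_finite_incseq) blast
  have [measurable]: "A i \<in> sets M" for i using A(1) by auto
  define P where "P n \<rho> \<longleftrightarrow> \<rho> \<in> borel_measurable M \<and> (\<forall>x. 0 \<le> \<rho> x \<and> \<rho> x \<le> indicator Q x) \<and>
    mass M \<rho> = \<infinity>" for n :: nat and \<rho> :: "'a \<Rightarrow> real"
  define R where "R n \<rho> \<rho>' \<longleftrightarrow> (\<forall>x. \<rho>' x \<le> \<rho> x) \<and> mass M (\<lambda>x. \<rho> x - \<rho>' x) = ennreal (m n)"
    for n and \<rho> \<rho>' :: "'a \<Rightarrow> real"
  have "P 0 (indicator Q)"
    using inf by (auto simp: P_def ennreal_indicator)
  moreover have "\<exists>\<rho>'. P (Suc n) \<rho>' \<and> R n \<rho> \<rho>'" if \<rho>: "P n \<rho>" for n \<rho>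
  proof -
    have [measurable]: "\<rho> \<in> borel_measurable M" and \<rho>01: "\<And>x. 0 \<le> \<rho> x" "\<And>x. \<rho> x \<le> indicator Q x"
      and \<rho>inf: "mass M \<rho> = \<infinity>" using \<rho> by (auto simp: P_def)
    have "mass M \<rho> = (SUP i. \<integral>\<^sup>+x. ennreal (\<rho> x) * indicator (A i) x \<partial>M)"
      using A(2,4) by (intro nn_integral_exhaustion) auto
    then have "ennreal (m n) < (SUP i. \<integral>\<^sup>+x. ennreal (\<rho> x) * indicator (A i) x \<partial>M)"
      using \<rho>inf by simp
    then obtain i where i: "ennreal (m n) < (\<integral>\<^sup>+x. ennreal (\<rho> x) * indicator (A i) x \<partial>M)"
      unfolding less_SUP_iff by blast
    have "\<rho> x \<le> 1" for x using \<rho>01(2)[of x] by (cases "x \<in> Q") auto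
    then have "(\<integral>\<^sup>+x. ennreal (\<rho> x) * indicator (A i) x \<partial>M) \<le> (\<integral>\<^sup>+x. indicator (A i) x \<partial>M)"
      by (intro nn_integral_mono) (auto simp: indicator_def)
    then have "(\<integral>\<^sup>+x. ennreal (\<rho> x) * indicator (A i) x \<partial>M) \<noteq> \<infinity>" using A(3)[of i] by (auto simp: top_unique)
    then obtain y where y: "0 \<le> y" "(\<integral>\<^sup>+x. ennreal (\<rho> x) * indicator (A i) x \<partial>M) = ennreal y"
      by (cases "\<integral>\<^sup>+x. ennreal (\<rho> x) * indicator (A i) x \<partial>M") auto
    have my: "m n < y" using i y m[of n] by (simp add: ennreal_less_iff)
    then have y0: "0 < y" using m[of n] by linarith
    define w where "w x = m n / y * (\<rho> x * indicator (A i) x)" for x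
    have w0: "0 \<le> w x" "w x \<le> \<rho> x" for x
    proof -
      have "0 \<le> m n / y" "m n / y \<le> 1" using my y0 m[of n] by auto
      then show "0 \<le> w x" "w x \<le> \<rho> x"
        using \<rho>01(1)[of x] mult_left_le_one_le[of "\<rho> x" "m n / y"] mult_nonneg_nonneg[of "m n / y" "\<rho> x"]
        by (auto simp: w_def indicator_def)
    qed
    have [measurable]: "w \<in> borel_measurable M" unfolding w_def[abs_def] by measurable
    have "mass M w = (\<integral>\<^sup>+x. ennreal (m n / y) * (ennreal (\<rho> x) * indicator (A i) x) \<partial>M)"
      using m[of n] y0 \<rho>01(1) by (intro nn_integral_cong) (auto simp: w_def indicator_def simp flip: ennreal_mult)
    also have "\<dots> = ennreal (m n / y) * ennreal y" unfolding y(2)[symmetric] by (rule nn_integral_cmult) measurable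
    also have "\<dots> = ennreal (m n)" using y0 m[of n] by (simp add: ennreal_mult[symmetric])
    finally have wm: "mass M w = ennreal (m n)" .
    have "\<infinity> = (\<integral>\<^sup>+x. ennreal (\<rho> x - w x) + ennreal (w x) \<partial>M)"
      unfolding \<rho>inf[symmetric] using w0 by (intro nn_integral_cong) (simp flip: ennreal_plus)
    also have "\<dots> = mass M (\<lambda>x. \<rho> x - w x) + ennreal (m n)" unfolding wm[symmetric] by (rule nn_integral_add) auto
    finally have "mass M (\<lambda>x. \<rho> x - w x) + ennreal (m n) = \<infinity>" by (rule sym)
    then have "mass M (\<lambda>x. \<rho> x - w x) = \<infinity>" by (simp add: ennreal_add_eq_top)
    moreover have "\<rho> x - w x \<le> indicator Q x" for x using w0(1)[of x] \<rho>01(2)[of x] by linarith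
    ultimately have "P (Suc n) (\<lambda>x. \<rho> x - w x)" "R n \<rho> (\<lambda>x. \<rho> x - w x)"
      using w0 wm by (auto simp: P_def R_def)
    then show ?thesis by blast
  qed
  ultimately obtain \<rho> where \<rho>: "\<And>n. P n (\<rho> n)" "\<And>n. R n (\<rho> n) (\<rho> (Suc n))"
    using dependent_nat_choice[of P R] by metis
  have [measurable]: "\<rho> n \<in> borel_measurable M" for n using \<rho>(1) by (simp add: P_def)
  show ?thesis
  proof (rule that[of "\<lambda>i x. \<rho> i x - \<rho> (Suc i) x"])
    fix n x
    have "(\<Sum>i<n. \<rho> i x - \<rho> (Suc i) x) = \<rho> 0 x - \<rho> n x"
      using sum_lessThan_telescope'[of "\<lambda>i. \<rho> i x" n] by simp
    also have "\<rho> 0 x \<le> indicator Q x" "0 \<le> \<rho> n x" using \<rho>(1) by (auto simp: P_def)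
    then have "\<rho> 0 x - \<rho> n x \<le> indicator Q x" by linarith
    finally show "(\<Sum>i<n. \<rho> i x - \<rho> (Suc i) x) \<le> indicator Q x" .
    show "(\<lambda>x. \<rho> i x - \<rho> (Suc i) x) \<in> borel_measurable M" for i by measurable
  qed (use \<rho> in \<open>auto simp: P_def R_def\<close>)
qed

text \<open>If the excess of \<open>f\<close> is infinite below and finite above some \<open>d > 0\<close>, the set
  \<open>{d / r < f \<le> r\<^sup>2 * d}\<close> has infinite mass.  The part of \<open>f\<close> above \<open>r\<^sup>2 * d\<close> is handled
  by extraction; mass from that set then makes up for what is missing, at the cost of the factor
  \<open>r\<^sup>3\<close>.\<close>

lemma match_levels:
  fixes \<beta> b :: "nat \<Rightarrow> real"
  assumes f [measurable]: "f \<in> borel_measurable M" and nn: "\<And>x. 0 \<le> f x"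
    and fin: "0 \<le> a" "excess M f a < \<infinity>" and r: "1 < r"
    and \<beta>: "\<And>i. 0 \<le> \<beta> i" and b: "\<And>i. 0 \<le> b i"
    and dom: "\<And>c. 0 \<le> c \<Longrightarrow> (\<Sum>i. ennreal (\<beta> i) * ennreal (b i - c)) \<le> excess M f c"
  obtains v where "\<And>i. v i \<in> borel_measurable M" "\<And>i x. 0 \<le> v i x" "\<And>n x. (\<Sum>i<n. v i x) \<le> 1"
    "\<And>i. mass M (v i) \<le> ennreal (\<beta> i)"
    "\<And>i. ennreal (\<beta> i * b i) \<le> ennreal (r ^ 3) * mass M (\<lambda>x. v i x * f x)"
proof (cases "\<forall>c>0. excess M f c < \<infinity>")
  case True
  obtain v where v: "\<And>i. v i \<in> borel_measurable M" "\<And>i x. 0 \<le> v i x" "\<And>n x. (\<Sum>i<n. v i x) \<le> 1"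
    "\<And>i. mass M (v i) \<le> ennreal (\<beta> i)"
    "\<And>i. ennreal (\<beta> i * b i) \<le> mass M (\<lambda>x. v i x * f x)"
    by (rule greedy_extraction[OF f nn _ \<beta> b dom]) (use True in blast)+
  have "1 \<le> r ^ 3" using r by (simp add: one_le_power)
  then have "1 \<le> ennreal (r ^ 3)" using ennreal_leI by fastforce
  then have "y \<le> ennreal (r ^ 3) * y" for y :: ennreal using mult_right_mono[of 1 "ennreal (r ^ 3)" y] by simp
  then have "ennreal (\<beta> i * b i) \<le> ennreal (r ^ 3) * mass M (\<lambda>x. v i x * f x)" for i
    by (rule order_trans[OF v(5)])
  then show ?thesis using v by (intro that[of v])
next
  case False
  then obtain c' where c': "0 < c'" "excess M f c' = \<infinity>" by (auto simp: less_top[symmetric])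
  define D where "D = {c. 0 \<le> c \<and> excess M f c < \<infinity>}"
  define d where "d = Inf D"
  have D: "D \<noteq> {}" "bdd_below D" using fin by (auto simp: D_def intro!: bdd_belowI[of _ 0])
  have "c' \<le> d"
    unfolding d_def
  proof (rule cInf_greatest[OF D(1)])
    fix c assume "c \<in> D"
    then show "c' \<le> c" using excess_antimono[of c c' M f] c'(2) by (cases "c \<le> c'") (auto simp: D_def top_unique)
  qed
  then have d: "0 < d" using c' by simp
  define c0 c1 c2 where "c0 = d / r" and "c1 = r * d" and "c2 = r * (r * d)"
  have c01: "0 < c0" "c0 < d" "d < c1" "c1 < c2" using d r by (auto simp: c0_def c1_def c2_def field_simps)
  have c20: "c2 = r ^ 3 * c0" using r by (simp add: c0_def c2_def power3_eq_cube)
  have ex0: "excess M f c0 = \<infinity>"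
  proof (rule ccontr)
    assume "\<not> ?thesis"
    then have "c0 \<in> D" using c01 by (auto simp: D_def less_top)
    then have "d \<le> c0" unfolding d_def using D(2) by (intro cInf_lower)
    then show False using c01 by simp
  qed
  obtain e where "e \<in> D" "e < c1" using cInf_lessD[OF D(1), of c1] c01 by (auto simp: d_def)
  then have ex1: "excess M f c1 < \<infinity>" using excess_antimono[of e c1 M f] by (auto simp: D_def intro: le_less_trans)
  define Q where "Q = {x\<in>space M. c0 < f x \<and> f x \<le> c2}"
  have [measurable]: "Q \<in> sets M" unfolding Q_def by measurable
  have Qinf: "emeasure M Q = \<infinity>"
  proof (rule ccontr)
    assume Q: "emeasure M Q \<noteq> \<infinity>"
    define k where "k = (c2 - c0) / (c2 - c1)"
    have k: "0 \<le> k" "1 \<le> k" using c01 by (auto simp: k_def)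
    \<comment> \<open>With this \<open>k\<close> the two sides of the estimate agree at \<open>f x = c2\<close>.\<close>
    have "excess M f c0 \<le> (\<integral>\<^sup>+x. ennreal (c2 - c0) * indicator Q x + ennreal k * ennreal (f x - c1) \<partial>M)"
      unfolding excess_def
    proof (intro nn_integral_mono)
      fix x assume x: "x \<in> space M"
      consider "f x \<le> c0" | "x \<in> Q" | "c2 < f x" using x by (force simp: Q_def)
      then show "ennreal (f x - c0) \<le> ennreal (c2 - c0) * indicator Q x + ennreal k * ennreal (f x - c1)"
      proof cases
        case 2
        then have "ennreal (f x - c0) \<le> ennreal (c2 - c0)" by (intro ennreal_leI) (auto simp: Q_def)
        then show ?thesis using 2 by (simp add: add_increasing2)
      next
        case 3
        have "(f x - c0) * (c2 - c1) - (c2 - c0) * (f x - c1) = (c0 - c1) * (f x - c2)"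
          by (simp add: algebra_simps)
        also have "\<dots> \<le> 0" using c01 3 by (intro mult_nonpos_nonneg) auto
        finally have "f x - c0 \<le> k * (f x - c1)" using c01 by (simp add: k_def field_simps)
        then have "ennreal (f x - c0) \<le> ennreal (k * (f x - c1))" by (rule ennreal_leI)
        also have "\<dots> = ennreal k * ennreal (f x - c1)" using k(1) by (rule ennreal_mult')
        finally show ?thesis by (simp add: add_increasing)
      qed (simp add: ennreal_neg)
    qed
    also have "\<dots> = ennreal (c2 - c0) * emeasure M Q + ennreal k * excess M f c1"
      unfolding excess_def by (simp add: nn_integral_add nn_integral_cmult nn_integral_cmult_indicator)
    also have "\<dots> < \<infinity>" using Q ex1 by (simp add: ennreal_mult_less_top less_top)
    finally show False using ex0 by simp
  qed
  define F where "F x = max (f x - c2) 0" for x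
  have [measurable]: "F \<in> borel_measurable M" unfolding F_def[abs_def] by measurable
  have exF: "excess M F c = excess M f (c2 + c)" if "0 \<le> c" for c
    unfolding excess_def using that by (intro nn_integral_cong) (auto simp: F_def max_def ennreal_neg diff_diff_eq)
  have finF: "excess M F c < \<infinity>" if "0 < c" for c
    using exF[of c] excess_antimono[of c1 "c2 + c" M f] c01 that ex1 by (auto intro: le_less_trans)
  define b' where "b' i = max (b i - c2) 0" for i
  have domF: "(\<Sum>i. ennreal (\<beta> i) * ennreal (b' i - c)) \<le> excess M F c" if c: "0 \<le> c" for c
  proof -
    have "ennreal (b' i - c) = ennreal (b i - (c2 + c))" for i using c by (auto simp: b'_def max_def ennreal_neg diff_diff_eq)
    then show ?thesis using dom[of "c2 + c"] c c01 by (simp add: exF)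
  qed
  obtain v where v: "\<And>i. v i \<in> borel_measurable M" "\<And>i x. 0 \<le> v i x" "\<And>n x. (\<Sum>i<n. v i x) \<le> 1"
    "\<And>i. mass M (v i) \<le> ennreal (\<beta> i)"
    "\<And>i. ennreal (\<beta> i * b' i) \<le> mass M (\<lambda>x. v i x * F x)"
  proof (rule greedy_extraction[of F M \<beta> b'])
    show "F \<in> borel_measurable M" by measurable
  qed (use finF domF \<beta> in \<open>auto simp: F_def b'_def\<close>)
  define v' where "v' i x = v i x * indicator {x. c2 < f x} x" for i x
  note [measurable] = v(1)
  have v'm [measurable]: "v' i \<in> borel_measurable M" for i unfolding v'_def[abs_def] by measurable
  have v'0: "0 \<le> v' i x" "v' i x \<le> v i x" for i x using v(2) by (auto simp: v'_def indicator_def)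
  have v'\<beta>: "mass M (v' i) \<le> ennreal (\<beta> i)" for i
    using v'0(2) by (intro order_trans[OF nn_integral_mono v(4)] ennreal_leI)
  define m where "m i = enn2real (mass M (v' i))" for i
  have m: "mass M (v' i) = ennreal (m i)" "0 \<le> m i" for i
    using v'\<beta>[of i] by (auto simp: m_def ennreal_enn2real_if top_unique)
  have m\<beta>: "m i \<le> \<beta> i" for i using v'\<beta>[of i] \<beta> by (simp add: m ennreal_le_iff)
  obtain w where w: "\<And>i. w i \<in> borel_measurable M" "\<And>i x. 0 \<le> w i x"
    "\<And>n x. (\<Sum>i<n. w i x) \<le> indicator Q x" "\<And>i. mass M (w i) = ennreal (\<beta> i - m i)"
    by (rule fill_infinite_mass[OF \<open>Q \<in> sets M\<close> Qinf, of "\<lambda>i. \<beta> i - m i"]) (use m\<beta> in auto)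
  note [measurable] = w(1)
  have w_out: "w i x = 0" if "x \<notin> Q" for i x
  proof -
    have "w i x \<le> (\<Sum>j<Suc i. w j x)" using w(2) by (intro member_le_sum) auto
    then show ?thesis using w(2)[of i x] w(3)[of x "Suc i"] that by simp
  qed
  show ?thesis
  proof (rule that[of "\<lambda>i x. v' i x + w i x"])
    fix n x
    show "(\<Sum>i<n. v' i x + w i x) \<le> 1"
    proof (cases "c2 < f x")
      case True
      then have "x \<notin> Q" by (simp add: Q_def)
      then have "(\<Sum>i<n. v' i x + w i x) \<le> (\<Sum>i<n. v i x)" using v'0 w_out by (intro sum_mono) auto
      then show ?thesis using v(3)[where n = n and x = x] by linarith
    next
      case False
      then have "(\<Sum>i<n. v' i x + w i x) = (\<Sum>i<n. w i x)" by (simp add: v'_def)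
      also have "\<dots> \<le> indicator Q x" by (rule w(3))
      also have "\<dots> \<le> 1" by (simp add: indicator_def)
      finally show ?thesis .
    qed
  next
    fix i
    show "mass M (\<lambda>x. v' i x + w i x) \<le> ennreal (\<beta> i)"
      using m\<beta>[of i] m(2)[of i]
      by (simp add: ennreal_plus v'0 w nn_integral_add m(1))
        (simp flip: ennreal_plus)
    have "\<beta> i * b i \<le> \<beta> i * (b' i + c2)" using \<beta>[of i] by (intro mult_left_mono) (auto simp: b'_def)
    also have "\<dots> \<le> r ^ 3 * (\<beta> i * b' i + c0 * \<beta> i)"
    proof -
      have "1 * (\<beta> i * b' i) \<le> r ^ 3 * (\<beta> i * b' i)"
        using r \<beta>[of i] by (intro mult_right_mono one_le_power) (auto simp: b'_def)
      then show ?thesis by (simp add: c20 algebra_simps)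
    qed
    also have "\<dots> \<le> r ^ 3 * (\<beta> i * b' i + (c2 * m i + c0 * (\<beta> i - m i)))"
    proof -
      have "c0 * m i \<le> c2 * m i" using c01 m(2)[of i] by (intro mult_right_mono) auto
      then show ?thesis using r by (intro mult_left_mono add_left_mono) (auto simp: algebra_simps)
    qed
    finally have "ennreal (\<beta> i * b i) \<le> ennreal (r ^ 3 * (\<beta> i * b' i + (c2 * m i + c0 * (\<beta> i - m i))))"
      by (rule ennreal_leI)
    also have "\<dots> = ennreal (r ^ 3) * (ennreal (\<beta> i * b' i) + (ennreal c2 * ennreal (m i) + ennreal c0 * ennreal (\<beta> i - m i)))"
    proof -
      have "0 \<le> \<beta> i * b' i" "0 \<le> c2 * m i" "0 \<le> c0 * (\<beta> i - m i)" "0 \<le> c2"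
        using \<beta>[of i] m\<beta>[of i] m(2)[of i] c01 by (auto simp: b'_def intro!: mult_nonneg_nonneg)
      then show ?thesis using r by (simp add: ennreal_mult' ennreal_mult'' ennreal_plus c01(1) less_imp_le)
    qed
    also have "\<dots> \<le> ennreal (r ^ 3) * (mass M (\<lambda>x. v i x * F x) +
        (ennreal c2 * mass M (v' i) + ennreal c0 * mass M (w i)))"
      using v(5)[of i] by (intro mult_left_mono add_right_mono) (auto simp: m w)
    also have "\<dots> = ennreal (r ^ 3) * (\<integral>\<^sup>+x. ennreal (v i x * F x) +
        (ennreal c2 * ennreal (v' i x) + ennreal c0 * ennreal (w i x)) \<partial>M)"
      by (simp add: nn_integral_add nn_integral_cmult)
    also have "\<dots> \<le> ennreal (r ^ 3) * mass M (\<lambda>x. (v' i x + w i x) * f x)"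
    proof (intro mult_left_mono nn_integral_mono)
      fix x assume x: "x \<in> space M"
      show "ennreal (v i x * F x) + (ennreal c2 * ennreal (v' i x) + ennreal c0 * ennreal (w i x))
          \<le> ennreal ((v' i x + w i x) * f x)"
      proof (cases "c2 < f x")
        case True
        then have "w i x = 0" by (intro w_out) (simp add: Q_def)
        moreover have "v' i x * f x = v i x * F x + c2 * v' i x"
          using True by (simp add: F_def v'_def algebra_simps)
        ultimately show ?thesis using v(2) v'0 c01 by (simp add: ennreal_plus F_def ennreal_mult)
      next
        case False
        have "c0 * w i x \<le> w i x * f x"
        proof (cases "x \<in> Q")
          case True
          then show ?thesis using mult_left_mono[of c0 "f x" "w i x"] w(2) by (simp add: Q_def mult.commute)
        qed (simp add: w_out)
        then have "ennreal (c0 * w i x) \<le> ennreal (w i x * f x)" by (rule ennreal_leI)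
        then show ?thesis using False c01 w(2) by (simp add: F_def v'_def ennreal_mult)
      qed
    qed simp
    finally show "ennreal (\<beta> i * b i) \<le> ennreal (r ^ 3) * mass M (\<lambda>x. (v' i x + w i x) * f x)" .
  qed (use v'0 w in auto)
qed

text \<open>The weight \<open>v i\<close> belongs to the cell with number \<open>i\<close>: the integral of \<open>f\<close> with this weight,
  divided by the mass of the cell, is at least \<open>g / r\<^sup>4\<close> on the cell.  One factor \<open>r\<close> comes from the
  rounding of \<open>g\<close> and three from the matching of the levels.\<close>

lemma match_majorant:
  assumes g: "g \<in> Sum_space M" "\<And>x. 0 \<le> g x" and f: "f \<in> Sum_space M" "\<And>x. 0 \<le> f x"
    and K: "\<And>t. 0 < t \<Longrightarrow> K_functional M g t \<le> K_functional M f t" and r: "1 < r"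
  obtains J :: "'a \<Rightarrow> nat" and v :: "nat \<Rightarrow> 'a \<Rightarrow> real" where
    "J \<in> measurable M (count_space UNIV)" "\<And>i. emeasure M {x\<in>space M. J x = i} < \<infinity>"
    "\<And>i. v i \<in> borel_measurable M" "\<And>i x. 0 \<le> v i x" "\<And>n x. (\<Sum>i<n. v i x) \<le> 1"
    "\<And>i. mass M (v i) \<le> emeasure M {x\<in>space M. J x = i \<and> 0 < g x}"
    "\<And>x. 0 < g x \<Longrightarrow> ennreal (g x) * emeasure M {y\<in>space M. J y = J x \<and> 0 < g y} \<le>
      ennreal (r ^ 4) * mass M (\<lambda>y. v (J x) y * f y)"
proof -
  note gm [measurable] = Sum_space_measurable[OF g(1)]
  note fm [measurable] = Sum_space_measurable[OF f(1)]
  obtain J :: "'a \<Rightarrow> nat" and b :: "nat \<Rightarrow> real" where J [measurable]: "J \<in> measurable M (count_space UNIV)"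
    and b: "\<And>j. 0 \<le> b j" "\<And>x. 0 < g x \<Longrightarrow> b (J x) \<le> g x \<and> g x \<le> r * b (J x)"
    and Jfin: "\<And>j. emeasure M {x\<in>space M. J x = j} < \<infinity>"
    by (rule geometric_levels[OF gm r]) blast
  let ?B = "\<lambda>j. {x\<in>space M. J x = j \<and> 0 < g x}"
  define \<beta> where "\<beta> j = measure M (?B j)" for j
  have \<beta>: "emeasure M (?B j) = ennreal (\<beta> j)" for j
  proof -
    have "emeasure M (?B j) \<le> emeasure M {x\<in>space M. J x = j}" by (intro emeasure_mono) auto
    then have "emeasure M (?B j) \<noteq> \<infinity>" using Jfin[of j] by (auto simp: top_unique)
    then show ?thesis unfolding \<beta>_def by (simp add: emeasure_eq_ennreal_measure)
  qed
  have dom: "(\<Sum>i. ennreal (\<beta> i) * ennreal (b i - c)) \<le> excess M f c" if c: "0 \<le> c" for c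
  proof -
    have "(\<Sum>i. emeasure M (?B i) * ennreal (b i - c)) \<le> excess M g c"
      by (rule level_excess_le[OF gm J]) (use b in blast)
    also have "\<dots> \<le> excess M f c" by (rule excess_le_of_K_le[OF g f K c])
    finally show ?thesis unfolding \<beta> .
  qed
  obtain a where a: "0 \<le> a" "excess M f a < \<infinity>" by (rule excess_finite_nonneg[OF f])
  obtain v where v: "\<And>i. v i \<in> borel_measurable M" "\<And>i x. 0 \<le> v i x" "\<And>n x. (\<Sum>i<n. v i x) \<le> 1"
    "\<And>i. mass M (v i) \<le> ennreal (\<beta> i)"
    "\<And>i. ennreal (\<beta> i * b i) \<le> ennreal (r ^ 3) * mass M (\<lambda>x. v i x * f x)"
    by (rule match_levels[OF fm f(2) a r, of \<beta> b]) (use b dom in \<open>auto simp: \<beta>_def\<close>)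
  show ?thesis
  proof (rule that[OF J Jfin v(1-3)])
    fix x assume x: "0 < g x"
    have "ennreal (g x) * emeasure M (?B (J x)) \<le> ennreal (r * b (J x)) * ennreal (\<beta> (J x))"
      unfolding \<beta> using b(2)[OF x] by (intro mult_right_mono ennreal_leI) auto
    also have "\<dots> = ennreal r * ennreal (\<beta> (J x) * b (J x))"
      using r b(1) by (simp add: ennreal_mult ennreal_mult' \<beta>_def ac_simps)
    also have "\<dots> \<le> ennreal r * (ennreal (r ^ 3) * mass M (\<lambda>y. v (J x) y * f y))"
      by (intro mult_left_mono v(5)) simp
    also have "\<dots> = ennreal (r ^ 4) * mass M (\<lambda>y. v (J x) y * f y)"
      using r by (simp add: mult.assoc[symmetric] ennreal_mult[symmetric] power3_eq_cube power4_eq_xxxx)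
    finally show "ennreal (g x) * emeasure M (?B (J x)) \<le> ennreal (r ^ 4) * mass M (\<lambda>y. v (J x) y * f y)" .
  qed (use v(4) \<beta> in auto)
qed

end

section \<open>Positive linear operators with a countable kernel\<close>

text \<open>The operator sends \<open>h\<close> to the function with value \<open>k x * (\<integral>y. v (J x) y * h y)\<close> at \<open>x\<close>,
  where \<open>J\<close> numbers the cells of a countable partition.  The row bound controls its norm on bounded
  functions.  The column bound, together with \<open>(\<Sum>i. v i) \<le> 1\<close>, controls its norm on integrable
  functions.\<close>

locale countable_kernel =
  fixes M :: "'a measure" and J :: "'a \<Rightarrow> nat" and v :: "nat \<Rightarrow> 'a \<Rightarrow> real" and k :: "'a \<Rightarrow> real" and C :: real
  assumes J [measurable]: "J \<in> measurable M (count_space UNIV)"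
    and v [measurable]: "\<And>i. v i \<in> borel_measurable M" and v0: "\<And>i x. 0 \<le> v i x"
    and v1: "\<And>n x. (\<Sum>i<n. v i x) \<le> 1" and v_fin: "\<And>i. mass M (v i) < \<infinity>"
    and k [measurable]: "k \<in> borel_measurable M" and k0: "\<And>x. x \<in> space M \<Longrightarrow> 0 \<le> k x" and C: "0 \<le> C"
    and row: "\<And>x. x \<in> space M \<Longrightarrow> ennreal (k x) * mass M (v (J x)) \<le> ennreal C"
    and column: "\<And>i. (\<integral>\<^sup>+x. ennreal (k x) * indicator {x\<in>space M. J x = i} x \<partial>M) \<le> ennreal C"
begin

definition T :: "('a \<Rightarrow> real) \<Rightarrow> 'a \<Rightarrow> real" where
  "T h x = k x * (\<integral>y. v (J x) y * h y \<partial>M)"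

lemma v_le_1: "v i x \<le> 1"
proof -
  have "v i x \<le> (\<Sum>j<Suc i. v j x)" using v0 by (intro member_le_sum) auto
  then show ?thesis using v1[where n = "Suc i" and x = x] by linarith
qed

text \<open>The weights are bounded and integrable, hence can be paired with both summands of an element
  of the sum space.\<close>

lemma integrable_weight_mult:
  assumes h: "h \<in> Sum_space M"
  shows "integrable M (\<lambda>y. v i y * h y)"
proof -
  obtain h0 h1 where d: "h0 \<in> L1 M" "h1 \<in> Linf M" "AE x in M. h x = h0 x + h1 x"
    using h by (auto simp: Sum_space_def)
  note [measurable] = Sum_space_measurable[OF h] L1_measurable[OF d(1)] Linf_measurable[OF d(2)]
  have iv: "integrable M (v i)" unfolding integrable_iff_bounded using v_fin v0 by simp
  have 0: "integrable M (\<lambda>y. v i y * h0 y)"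
  proof (rule Bochner_Integration.integrable_bound[of M h0])
    show "integrable M h0" using d(1) by (simp add: L1_def)
    show "AE y in M. norm (v i y * h0 y) \<le> norm (h0 y)"
      using v0 v_le_1 by (auto simp: abs_mult intro!: mult_left_le_one_le)
  qed measurable
  have 1: "integrable M (\<lambda>y. v i y * h1 y)"
  proof (rule Bochner_Integration.integrable_bound[of M "\<lambda>y. Linf_norm M h1 * v i y"])
    show "integrable M (\<lambda>y. Linf_norm M h1 * v i y)" using iv by simp
    show "AE y in M. norm (v i y * h1 y) \<le> norm (Linf_norm M h1 * v i y)"
      using Linf_norm_AE[OF d(2)]
    proof eventually_elim
      case (elim y)
      then show ?case using v0[of i y] Linf_norm_nonneg[OF d(2)]
        by (simp add: abs_mult mult.commute[of "v i y"] mult_right_mono)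
    qed
  qed measurable
  show ?thesis
  proof (rule integrable_cong_AE_imp[OF Bochner_Integration.integrable_add[OF 0 1]])
    show "AE y in M. v i y * h0 y + v i y * h1 y = v i y * h y"
      using d(3) by eventually_elim (simp add: distrib_left)
  qed measurable
qed

lemma T_measurable:
  assumes [measurable]: "h \<in> borel_measurable M"
  shows "T h \<in> borel_measurable M"
proof -
  have "(\<lambda>x. (\<lambda>i. \<integral>y. v i y * h y \<partial>M) (J x)) \<in> borel_measurable M"
    by (rule measurable_compose[OF J]) simp
  then show ?thesis unfolding T_def[abs_def] by measurable
qed

lemma T_cong_AE:
  assumes [measurable]: "h \<in> borel_measurable M" "h' \<in> borel_measurable M" and eq: "AE x in M. h x = h' x"
  shows "T h = T h'"
proof
  fix x
  have "(\<integral>y. v (J x) y * h y \<partial>M) = (\<integral>y. v (J x) y * h' y \<partial>M)"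
    by (intro integral_cong_AE, measurable, use eq in eventually_elim) simp
  then show "T h x = T h' x" by (simp add: T_def)
qed

lemma T_add: "h \<in> Sum_space M \<Longrightarrow> h' \<in> Sum_space M \<Longrightarrow> T (\<lambda>y. h y + h' y) x = T h x + T h' x"
  by (simp add: T_def distrib_left integrable_weight_mult)

lemma T_cmult: "T (\<lambda>y. c * h y) x = c * T h x"
  by (simp add: T_def mult.left_commute)

lemma T_nonneg:
  assumes "x \<in> space M" "AE y in M. 0 \<le> h y"
  shows "0 \<le> T h x"
proof -
  have "AE y in M. 0 \<le> v (J x) y * h y" using assms(2) by eventually_elim (simp add: v0)
  then show ?thesis unfolding T_def by (intro mult_nonneg_nonneg k0 assms(1) integral_nonneg_AE)
qed

text \<open>Summing over the cells \<open>{J = i}\<close> first, then exchanging the sum with the inner integral.\<close>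

lemma T_L1:
  assumes h: "h \<in> L1 M"
  shows "T h \<in> L1 M" "L1_norm M (T h) \<le> C * L1_norm M h"
proof -
  note [measurable] = L1_measurable[OF h] T_measurable[OF L1_measurable[OF h]]
  define a where "a i = mass M (\<lambda>y. v i y * \<bar>h y\<bar>)" for i
  have "(\<integral>\<^sup>+x. ennreal \<bar>T h x\<bar> \<partial>M) \<le> (\<integral>\<^sup>+x. (\<Sum>i. (a i * ennreal (k x)) * indicator {x\<in>space M. J x = i} x) \<partial>M)"
  proof (intro nn_integral_mono)
    fix x assume x: "x \<in> space M"
    have "ennreal \<bar>\<integral>y. v (J x) y * h y \<partial>M\<bar> \<le> (\<integral>\<^sup>+y. ennreal (norm (v (J x) y * h y)) \<partial>M)"
      using integral_norm_bound_ennreal[OF integrable_weight_mult[OF L1_subset_Sum[OF h]], of "J x"] by simp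
    also have "\<dots> = a (J x)" unfolding a_def by (simp add: abs_mult v0)
    finally have "ennreal \<bar>T h x\<bar> \<le> a (J x) * ennreal (k x)"
      using k0[OF x] by (simp add: T_def abs_mult ennreal_mult mult.commute mult_left_mono)
    also have "\<dots> = (\<Sum>i. (a i * ennreal (k x)) * indicator {x\<in>space M. J x = i} x)"
      using x by (intro suminf_cmult_indicator[symmetric]) (auto simp: disjoint_family_on_def)
    finally show "ennreal \<bar>T h x\<bar> \<le> \<dots>" .
  qed
  also have "\<dots> = (\<Sum>i. \<integral>\<^sup>+x. a i * (ennreal (k x) * indicator {x\<in>space M. J x = i} x) \<partial>M)"
    by (subst nn_integral_suminf) (auto simp: mult.assoc)
  also have "\<dots> = (\<Sum>i. a i * (\<integral>\<^sup>+x. ennreal (k x) * indicator {x\<in>space M. J x = i} x \<partial>M))"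
    by (subst nn_integral_cmult) auto
  also have "\<dots> \<le> (\<Sum>i. a i * ennreal C)"
    by (intro suminf_le mult_left_mono column summableI) auto
  also have "\<dots> = ennreal C * (\<Sum>i. a i)" by (simp add: mult.commute[of _ "ennreal C"])
  also have "(\<Sum>i. a i) = (\<integral>\<^sup>+y. (\<Sum>i. ennreal (v i y * \<bar>h y\<bar>)) \<partial>M)"
    unfolding a_def by (rule nn_integral_suminf[symmetric]) measurable
  also have "\<dots> \<le> (\<integral>\<^sup>+y. ennreal \<bar>h y\<bar> \<partial>M)"
  proof (intro nn_integral_mono)
    fix y
    have "(\<Sum>i<n. ennreal (v i y * \<bar>h y\<bar>)) \<le> ennreal \<bar>h y\<bar>" for n
    proof -
      have "(\<Sum>i<n. ennreal (v i y * \<bar>h y\<bar>)) = ennreal ((\<Sum>i<n. v i y) * \<bar>h y\<bar>)"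
        using v0 by (simp add: sum_distrib_right sum_nonneg)
      also have "\<dots> \<le> ennreal \<bar>h y\<bar>"
        using v1[where n = n and x = y] v0 by (intro ennreal_leI mult_left_le_one_le sum_nonneg) auto
      finally show ?thesis .
    qed
    then show "(\<Sum>i. ennreal (v i y * \<bar>h y\<bar>)) \<le> ennreal \<bar>h y\<bar>"
      by (intro suminf_le_const summableI) auto
  qed
  also have "\<dots> = ennreal (L1_norm M h)" by (rule ennreal_L1_norm[OF h, symmetric])
  finally have le: "(\<integral>\<^sup>+x. ennreal \<bar>T h x\<bar> \<partial>M) \<le> ennreal (C * L1_norm M h)"
    using C by (simp add: ennreal_mult mult_left_mono)
  then show L: "T h \<in> L1 M" by (simp add: L1_iff_nn_integral le_less_trans)
  show "L1_norm M (T h) \<le> C * L1_norm M h" using le L1_norm_le_iff[OF L] C by simp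
qed

lemma T_Linf:
  assumes h: "h \<in> Linf M"
  shows "T h \<in> Linf M" "Linf_norm M (T h) \<le> C * Linf_norm M h"
proof -
  note [measurable] = Linf_measurable[OF h]
  let ?n = "Linf_norm M h"
  have n0: "0 \<le> ?n" by (rule Linf_norm_nonneg[OF h])
  have bound: "\<bar>T h x\<bar> \<le> C * ?n" if x: "x \<in> space M" for x
  proof -
    have "ennreal \<bar>\<integral>y. v (J x) y * h y \<partial>M\<bar> \<le> (\<integral>\<^sup>+y. ennreal (norm (v (J x) y * h y)) \<partial>M)"
      using integral_norm_bound_ennreal[OF integrable_weight_mult[OF Linf_subset_Sum[OF h]], of "J x"] by simp
    also have "\<dots> \<le> (\<integral>\<^sup>+y. ennreal ?n * ennreal (v (J x) y) \<partial>M)"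
    proof (intro nn_integral_mono_AE)
      show "AE y in M. ennreal (norm (v (J x) y * h y)) \<le> ennreal ?n * ennreal (v (J x) y)"
        using Linf_norm_AE[OF h]
      proof eventually_elim
        case (elim y)
        then have "norm (v (J x) y * h y) \<le> ?n * v (J x) y"
          using v0[of "J x" y] by (simp add: abs_mult mult.commute[of "v (J x) y"] mult_right_mono)
        then show ?case using n0 v0 by (simp add: ennreal_mult[symmetric] ennreal_leI)
      qed
    qed
    also have "\<dots> = ennreal ?n * mass M (v (J x))" by (rule nn_integral_cmult) measurable
    finally have "ennreal (k x) * ennreal \<bar>\<integral>y. v (J x) y * h y \<partial>M\<bar> \<le>
        ennreal ?n * (ennreal (k x) * mass M (v (J x)))"
      by (subst mult.left_commute) (rule mult_left_mono, auto)
    also have "\<dots> \<le> ennreal ?n * ennreal C" by (intro mult_left_mono row x) simp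
    finally have "ennreal \<bar>T h x\<bar> \<le> ennreal (C * ?n)"
      using k0[OF x] n0 C by (simp add: T_def abs_mult ennreal_mult mult.commute)
    then show ?thesis using n0 C by (subst (asm) ennreal_le_iff) auto
  qed
  show "T h \<in> Linf M" unfolding Linf_def using bound T_measurable by auto
  show "Linf_norm M (T h) \<le> C * ?n" using bound n0 C by (intro Linf_norm_le T_measurable) auto
qed

lemma T_Sum:
  assumes h: "h \<in> Sum_space M"
  shows "T h \<in> Sum_space M"
proof -
  obtain h0 h1 where d: "h0 \<in> L1 M" "h1 \<in> Linf M" "AE x in M. h x = h0 x + h1 x"
    using h by (auto simp: Sum_space_def)
  have "T h = T (\<lambda>x. h0 x + h1 x)"
    using d L1_measurable[OF d(1)] Linf_measurable[OF d(2)] Sum_space_measurable[OF h]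
    by (intro T_cong_AE) auto
  also have "\<dots> = (\<lambda>x. T h0 x + T h1 x)"
    using d by (intro ext T_add L1_subset_Sum Linf_subset_Sum)
  finally show ?thesis
    using d T_L1(1) T_Linf(1) by (simp add: Sum_space_add L1_subset_Sum Linf_subset_Sum)
qed

lemma T_admissible: "admissible_positive_linear M T"
proof -
  have "operator_on M (Sum_space M) T"
    unfolding operator_on_def
  proof (intro conjI ballI impI)
    fix h h' assume "h \<in> Sum_space M" "h' \<in> Sum_space M" "AE x in M. h x = h' x"
    then have "T h = T h'" by (intro T_cong_AE Sum_space_measurable)
    then show "AE x in M. T h x = T h' x" by simp
  qed (use Sum_space_zero[of M] ae_saturated_Sum_space[of M] T_Sum in auto)
  moreover have "AE x in M. 0 \<le> T h x" if "AE x in M. 0 \<le> h x" for h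
    using T_nonneg[OF _ that] by (rule AE_I2)
  ultimately have "positive_linear M T"
    unfolding positive_linear_def by (auto simp: T_add T_cmult)
  moreover have "bounded_on (L1 M) (L1_norm M) T" "bounded_on (Linf M) (Linf_norm M) T"
    unfolding bounded_on_def using T_L1 T_Linf by blast+
  ultimately show ?thesis by (simp add: admissible_positive_linear_def)
qed

lemma couple_op_norm_T: "couple_op_norm M T \<le> C"
  unfolding couple_op_norm_def
  using L1_zero[of M] Linf_zero[of M] T_L1 T_Linf C
  by (auto intro!: op_norm_le Linf_norm_nonneg)

end

section \<open>From positive linear operators to K-monotonicity\<close>

context sigma_finite_measure
begin

text \<open>The families for the positive and for the negative parts are interleaved, the even indices
  serving the set where \<open>g > 0\<close> from the set where \<open>f > 0\<close>, the odd ones the negative parts.\<close>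

lemma match_signed:
  assumes g: "g \<in> Sum_space M" and f: "f \<in> Sum_space M" and K: "partially_K_below M g f" and r: "1 < r"
  obtains J :: "'a \<Rightarrow> nat" and v :: "nat \<Rightarrow> 'a \<Rightarrow> real" where
    "J \<in> measurable M (count_space UNIV)" "\<And>i. emeasure M {x\<in>space M. J x = i \<and> g x \<noteq> 0} < \<infinity>"
    "\<And>i. v i \<in> borel_measurable M" "\<And>i x. 0 \<le> v i x" "\<And>n x. (\<Sum>i<n. v i x) \<le> 1"
    "\<And>i. mass M (v i) \<le> emeasure M {x\<in>space M. J x = i \<and> g x \<noteq> 0}"
    "\<And>i. integrable M (\<lambda>y. v i y * f y)"
    "\<And>x. 0 < g x \<Longrightarrow> 0 \<le> (\<integral>y. v (J x) y * f y \<partial>M)"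
    "\<And>x. g x < 0 \<Longrightarrow> (\<integral>y. v (J x) y * f y \<partial>M) \<le> 0"
    "\<And>x. \<bar>g x\<bar> * measure M {y\<in>space M. J y = J x \<and> g y \<noteq> 0} \<le> r ^ 4 * \<bar>\<integral>y. v (J x) y * f y \<partial>M\<bar>"
proof -
  let ?B = "\<lambda>J i. {x\<in>space M. J x = i \<and> g x \<noteq> 0}"
  let ?P = "\<lambda>J i. {x\<in>space M. J x = i \<and> 0 < pos_part g x}"
  let ?N = "\<lambda>J i. {x\<in>space M. J x = i \<and> 0 < neg_part g x}"
  have fS: "pos_part f \<in> Sum_space M" "neg_part f \<in> Sum_space M"
    and gS: "pos_part g \<in> Sum_space M" "neg_part g \<in> Sum_space M"
    by (intro pos_part_Sum neg_part_Sum f g)+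
  note [measurable] = Sum_space_measurable[OF f] Sum_space_measurable[OF g]
  have Kp: "K_functional M (pos_part g) t \<le> K_functional M (pos_part f) t"
    and Kn: "K_functional M (neg_part g) t \<le> K_functional M (neg_part f) t" if "0 < t" for t
    using K that by (auto simp: partially_K_below_def)
  obtain J1 :: "'a \<Rightarrow> nat" and v1 :: "nat \<Rightarrow> 'a \<Rightarrow> real" where
    J1 [measurable]: "J1 \<in> measurable M (count_space UNIV)" and J1f: "\<And>i. emeasure M {x\<in>space M. J1 x = i} < \<infinity>"
    and v1 [measurable]: "\<And>i. v1 i \<in> borel_measurable M" and v1n: "\<And>i x. 0 \<le> v1 i x" "\<And>n x. (\<Sum>i<n. v1 i x) \<le> 1"
    and m1: "\<And>i. mass M (v1 i) \<le> emeasure M (?P J1 i)"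
    and e1: "\<And>x. 0 < pos_part g x \<Longrightarrow> ennreal (pos_part g x) * emeasure M (?P J1 (J1 x)) \<le>
      ennreal (r ^ 4) * mass M (\<lambda>y. v1 (J1 x) y * pos_part f y)"
    by (rule match_majorant[OF gS(1) pos_part_nonneg fS(1) pos_part_nonneg Kp r]) (assumption | blast)+
  obtain J2 :: "'a \<Rightarrow> nat" and v2 :: "nat \<Rightarrow> 'a \<Rightarrow> real" where
    J2 [measurable]: "J2 \<in> measurable M (count_space UNIV)" and J2f: "\<And>i. emeasure M {x\<in>space M. J2 x = i} < \<infinity>"
    and v2 [measurable]: "\<And>i. v2 i \<in> borel_measurable M" and v2n: "\<And>i x. 0 \<le> v2 i x" "\<And>n x. (\<Sum>i<n. v2 i x) \<le> 1"
    and m2: "\<And>i. mass M (v2 i) \<le> emeasure M (?N J2 i)"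
    and e2: "\<And>x. 0 < neg_part g x \<Longrightarrow> ennreal (neg_part g x) * emeasure M (?N J2 (J2 x)) \<le>
      ennreal (r ^ 4) * mass M (\<lambda>y. v2 (J2 x) y * neg_part f y)"
    by (rule match_majorant[OF gS(2) neg_part_nonneg fS(2) neg_part_nonneg Kn r]) (assumption | blast)+
  define J where "J x = (if 0 < g x then 2 * J1 x else 2 * J2 x + 1)" for x
  define v where "v i x = (if even i then (if 0 < f x then v1 (i div 2) x else 0)
      else (if f x < 0 then v2 (i div 2) x else 0))" for i x
  have [measurable]: "J \<in> measurable M (count_space UNIV)" unfolding J_def[abs_def] by measurable
  have vm: "v i \<in> borel_measurable M" for i unfolding v_def[abs_def] by (cases "even i") auto
  note [measurable] = vm
  have v0: "0 \<le> v i x" for i x using v1n v2n by (simp add: v_def)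
  have sum2: "(\<Sum>i<2 * n. v i x) = (\<Sum>i<n. v (2 * i) x) + (\<Sum>i<n. v (2 * i + 1) x)" for n x
    by (induction n) (auto simp: algebra_simps)
  have vsum: "(\<Sum>i<n. v i x) \<le> 1" for n x
  proof -
    have "(\<Sum>i<n. v i x) \<le> (\<Sum>i<2 * n. v i x)" using v0 by (intro sum_mono2) auto
    also have "\<dots> \<le> 1" unfolding sum2 using v1n(2)[of x n] v2n(2)[of x n]
      by (cases "0 < f x"; cases "f x < 0") (auto simp: v_def)
    finally show ?thesis .
  qed
  have even_set: "?B J (2 * j) = ?P J1 j"
    and odd_set: "?B J (2 * j + 1) = ?N J2 j" for j
    by (auto simp: J_def pos_part_def neg_part_def split: if_splits) presburger+
  have parity: "\<exists>j. i = 2 * j \<or> i = 2 * j + 1" for i :: nat by presburger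
  have even_v: "v (2 * j) y * f y = v1 j y * pos_part f y"
    and odd_v: "v (2 * j + 1) y * f y = - (v2 j y * neg_part f y)" for j y
    by (auto simp: v_def pos_part_def neg_part_def max_def)
  have set_fin: "emeasure M (?B J i) < \<infinity>" for i
  proof -
    obtain j where "i = 2 * j \<or> i = 2 * j + 1" using parity by blast
    then show ?thesis
    proof
      assume i: "i = 2 * j"
      have "emeasure M (?P J1 j) \<le> emeasure M {x\<in>space M. J1 x = j}"
        by (intro emeasure_mono) auto
      then show ?thesis unfolding i even_set using J1f by (rule le_less_trans)
    next
      assume i: "i = 2 * j + 1"
      have "emeasure M (?N J2 j) \<le> emeasure M {x\<in>space M. J2 x = j}"
        by (intro emeasure_mono) auto
      then show ?thesis unfolding i odd_set using J2f by (rule le_less_trans)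
    qed
  qed
  have mass: "mass M (v i) \<le> emeasure M (?B J i)" for i
  proof -
    obtain j where "i = 2 * j \<or> i = 2 * j + 1" using parity by blast
    then show ?thesis
    proof
      assume i: "i = 2 * j"
      have "mass M (v i) \<le> mass M (v1 j)"
        using v1n by (intro nn_integral_mono ennreal_leI) (auto simp: v_def i)
      also note m1[of j]
      finally show ?thesis unfolding i even_set .
    next
      assume i: "i = 2 * j + 1"
      have "mass M (v i) \<le> mass M (v2 j)"
        using v2n by (intro nn_integral_mono ennreal_leI) (auto simp: v_def i)
      also note m2[of j]
      finally show ?thesis unfolding i odd_set .
    qed
  qed
  \<comment> \<open>The zero kernel serves only to reuse the integrability of \<open>v i * f\<close>.\<close>
  interpret Z: countable_kernel M J v "\<lambda>_. 0" 0
  proof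
    show "mass M (v i) < \<infinity>" for i using mass set_fin by (rule le_less_trans)
  qed (use v0 vsum in \<open>auto\<close>)
  have int: "integrable M (\<lambda>y. v i y * f y)" for i by (rule Z.integrable_weight_mult[OF f])
  have pos: "ennreal (\<integral>y. v (2 * j) y * f y \<partial>M) = mass M (\<lambda>y. v1 j y * pos_part f y)"
      "0 \<le> (\<integral>y. v (2 * j) y * f y \<partial>M)" for j
    using int[of "2 * j"] unfolding even_v
    by (auto intro!: nn_integral_eq_integral[symmetric] integral_nonneg_AE simp: v1n)
  have neg: "ennreal (- (\<integral>y. v (2 * j + 1) y * f y \<partial>M)) = mass M (\<lambda>y. v2 j y * neg_part f y)"
      "(\<integral>y. v (2 * j + 1) y * f y \<partial>M) \<le> 0" for j
  proof -
    have "integrable M (\<lambda>y. v2 j y * neg_part f y)" using int[of "2 * j + 1"] unfolding odd_v by simp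
    then show "ennreal (- (\<integral>y. v (2 * j + 1) y * f y \<partial>M)) = mass M (\<lambda>y. v2 j y * neg_part f y)"
      unfolding odd_v by (auto intro!: nn_integral_eq_integral[symmetric] simp: v2n)
    show "(\<integral>y. v (2 * j + 1) y * f y \<partial>M) \<le> 0"
      unfolding odd_v by (auto intro!: integral_nonneg_AE simp: v2n)
  qed
  have em: "emeasure M (?B J i) = ennreal (measure M (?B J i))" for i
    using set_fin[of i] by (intro emeasure_eq_ennreal_measure) simp
  have em1: "emeasure M (?P J1 j) =
      ennreal (measure M (?P J1 j))"
    and em2: "emeasure M (?N J2 j) =
      ennreal (measure M (?N J2 j))" for j
    using em[of "2 * j"] em[of "2 * j + 1"] unfolding even_set odd_set .
  show ?thesis
  proof (rule that[OF \<open>J \<in> measurable M (count_space UNIV)\<close> set_fin vm v0 vsum mass int])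
    fix x
    show "0 \<le> (\<integral>y. v (J x) y * f y \<partial>M)" if "0 < g x" using pos(2) that by (simp add: J_def)
    show "(\<integral>y. v (J x) y * f y \<partial>M) \<le> 0" if "g x < 0" using neg(2)[of "J2 x"] that by (simp add: J_def)
    have r4: "0 \<le> r ^ 4" using r by simp
    have transfer: "p * m \<le> r ^ 4 * y"
      if "ennreal p * ennreal m \<le> ennreal (r ^ 4) * ennreal y" "0 \<le> p" "0 \<le> m" "0 \<le> y" for p m y
      using that r4 by (simp add: ennreal_mult[symmetric] ennreal_le_iff)
    consider "0 < g x" | "g x < 0" | "g x = 0" by linarith
    then show "\<bar>g x\<bar> * measure M (?B J (J x)) \<le> r ^ 4 * \<bar>\<integral>y. v (J x) y * f y \<partial>M\<bar>"
    proof cases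
      case 1
      then have Jx: "J x = 2 * J1 x" and px: "pos_part g x = \<bar>g x\<bar>" by (auto simp: J_def pos_part_def)
      have "\<bar>g x\<bar> * measure M (?P J1 (J1 x)) \<le>
          r ^ 4 * (\<integral>y. v (J x) y * f y \<partial>M)"
        using e1[of x] 1 pos[of "J1 x"] unfolding em1 pos(1)[symmetric] px Jx by (intro transfer) auto
      then show ?thesis using pos(2)[of "J1 x"] unfolding Jx even_set by simp
    next
      case 2
      then have Jx: "J x = 2 * J2 x + 1" and px: "neg_part g x = \<bar>g x\<bar>" by (auto simp: J_def neg_part_def)
      have "\<bar>g x\<bar> * measure M (?N J2 (J2 x)) \<le>
          r ^ 4 * - (\<integral>y. v (J x) y * f y \<partial>M)"
        using e2[of x] 2 neg(2)[of "J2 x"] unfolding em2 neg(1)[symmetric] px Jx by (intro transfer) auto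
      then show ?thesis using neg(2)[of "J2 x"] unfolding Jx odd_set by (simp add: abs_of_nonpos)
    qed (use r4 in simp)
  qed
qed

text \<open>Dividing \<open>g\<close> by the integrals \<open>a (J x)\<close> gives a kernel whose operator maps \<open>f\<close> to \<open>g\<close>
  exactly, except on the cells of measure zero.  The matching estimate says that \<open>k\<close> is at most
  \<open>r\<^sup>4\<close> over the mass of the cell, which is the row and the column bound at once.\<close>

lemma K_below_imp_kernel_operator:
  assumes g: "g \<in> Sum_space M" and f: "f \<in> Sum_space M" and K: "partially_K_below M g f" and r: "1 < r"
  obtains S where "admissible_positive_linear M S" "couple_op_norm M S \<le> r ^ 4" "AE x in M. S f x = g x"
proof -
  obtain J :: "'a \<Rightarrow> nat" and v :: "nat \<Rightarrow> 'a \<Rightarrow> real" where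
    J [measurable]: "J \<in> measurable M (count_space UNIV)"
    and fin: "\<And>i. emeasure M {x\<in>space M. J x = i \<and> g x \<noteq> 0} < \<infinity>"
    and v [measurable]: "\<And>i. v i \<in> borel_measurable M" and v0: "\<And>i x. 0 \<le> v i x" "\<And>n x. (\<Sum>i<n. v i x) \<le> 1"
    and mass: "\<And>i. mass M (v i) \<le> emeasure M {x\<in>space M. J x = i \<and> g x \<noteq> 0}"
    and int: "\<And>i. integrable M (\<lambda>y. v i y * f y)"
    and sgn: "\<And>x. 0 < g x \<Longrightarrow> 0 \<le> (\<integral>y. v (J x) y * f y \<partial>M)"
      "\<And>x. g x < 0 \<Longrightarrow> (\<integral>y. v (J x) y * f y \<partial>M) \<le> 0"
    and est: "\<And>x. \<bar>g x\<bar> * measure M {y\<in>space M. J y = J x \<and> g y \<noteq> 0} \<le> r ^ 4 * \<bar>\<integral>y. v (J x) y * f y \<partial>M\<bar>"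
    by (rule match_signed[OF g f K r]) blast
  note [measurable] = Sum_space_measurable[OF g] Sum_space_measurable[OF f]
  let ?B = "\<lambda>i. {x\<in>space M. J x = i \<and> g x \<noteq> 0}"
  define a where "a i = (\<integral>y. v i y * f y \<partial>M)" for i
  define \<beta> where "\<beta> i = measure M (?B i)" for i
  define k where "k x = g x / a (J x)" for x
  have \<beta>: "emeasure M (?B i) = ennreal (\<beta> i)" "0 \<le> \<beta> i" for i
    using fin[of i] unfolding \<beta>_def by (auto intro: emeasure_eq_ennreal_measure)
  have k0: "0 \<le> k x" for x
    using sgn[of x] by (cases "0 < g x"; cases "g x < 0") (auto simp: k_def a_def divide_nonpos_nonpos)
  have C: "0 \<le> r ^ 4" using r by simp
  have k\<beta>: "k x * \<beta> (J x) \<le> r ^ 4" for x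
  proof (cases "a (J x) = 0")
    case False
    have "k x = \<bar>k x\<bar>" using k0 by simp
    also have "\<dots> = \<bar>g x\<bar> / \<bar>a (J x)\<bar>" by (simp add: k_def)
    finally have "k x * \<beta> (J x) = \<bar>g x\<bar> * \<beta> (J x) / \<bar>a (J x)\<bar>" by simp
    also have "\<dots> \<le> r ^ 4" using est[of x] False by (simp add: a_def[symmetric] \<beta>_def[symmetric] divide_le_eq)
    finally show ?thesis .
  qed (simp add: k_def C)
  have aJ: "(\<lambda>x. a (J x)) \<in> borel_measurable M" by (rule measurable_compose[OF J]) simp
  interpret S: countable_kernel M J v k "r ^ 4"
  proof
    show "k \<in> borel_measurable M" unfolding k_def[abs_def] using aJ by measurable
    show "mass M (v i) < \<infinity>" for i using mass fin by (rule le_less_trans)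
    show "ennreal (k x) * mass M (v (J x)) \<le> ennreal (r ^ 4)" for x
    proof -
      have "ennreal (k x) * mass M (v (J x)) \<le> ennreal (k x) * ennreal (\<beta> (J x))"
        using mass[of "J x"] unfolding \<beta> by (intro mult_left_mono) auto
      also have "\<dots> \<le> ennreal (r ^ 4)" using k\<beta>[of x] k0[of x] \<beta>(2) by (simp add: ennreal_mult[symmetric] ennreal_leI)
      finally show ?thesis .
    qed
    show "(\<integral>\<^sup>+x. ennreal (k x) * indicator {x\<in>space M. J x = i} x \<partial>M) \<le> ennreal (r ^ 4)" for i
    proof (cases "\<beta> i = 0")
      case True
      then have "?B i \<in> null_sets M" using \<beta>(1)[of i] by (intro null_setsI) auto
      then have "AE x in M. x \<notin> ?B i" by (rule AE_not_in)
      then have "AE x in M. ennreal (k x) * indicator {x\<in>space M. J x = i} x = 0"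
        by eventually_elim (auto simp: indicator_def k_def)
      then have "(\<integral>\<^sup>+x. ennreal (k x) * indicator {x\<in>space M. J x = i} x \<partial>M) = (\<integral>\<^sup>+x. 0 \<partial>M)"
        by (rule nn_integral_cong_AE)
      then show ?thesis by simp
    next
      case False
      then have pos: "0 < \<beta> i" using \<beta>(2)[of i] by simp
      have "(\<integral>\<^sup>+x. ennreal (k x) * indicator {x\<in>space M. J x = i} x \<partial>M) \<le>
          (\<integral>\<^sup>+x. ennreal (r ^ 4 / \<beta> i) * indicator (?B i) x \<partial>M)"
      proof (intro nn_integral_mono)
        fix x
        have "k x \<le> r ^ 4 / \<beta> i" if "J x = i" using k\<beta>[of x] pos that by (simp add: field_simps)
        moreover have "k x = 0" if "g x = 0" using that by (simp add: k_def)
        ultimately show "ennreal (k x) * indicator {x\<in>space M. J x = i} x \<le> ennreal (r ^ 4 / \<beta> i) * indicator (?B i) x"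
          by (auto simp: indicator_def intro!: ennreal_leI)
      qed
      also have "\<dots> = ennreal (r ^ 4 / \<beta> i) * ennreal (\<beta> i)"
        by (subst nn_integral_cmult_indicator) (auto simp: \<beta>)
      also have "\<dots> = ennreal (r ^ 4)" using pos C by (simp add: ennreal_mult[symmetric])
      finally show ?thesis by simp
    qed
  qed (use k0 C v0 in auto)
  have "AE x in M. \<forall>i. \<beta> i = 0 \<longrightarrow> x \<notin> ?B i"
    unfolding AE_all_countable
  proof
    fix i show "AE x in M. \<beta> i = 0 \<longrightarrow> x \<notin> ?B i"
    proof (cases "\<beta> i = 0")
      case True
      then have "?B i \<in> null_sets M" using \<beta>(1)[of i] by (intro null_setsI) auto
      then have "AE x in M. x \<notin> ?B i" by (rule AE_not_in)
      then show ?thesis by eventually_elim simp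
    qed simp
  qed
  then have "AE x in M. S.T f x = g x"
    using AE_space
  proof eventually_elim
    case (elim x)
    show ?case
    proof (cases "g x = 0")
      case False
      then have "\<beta> (J x) \<noteq> 0" using elim by blast
      then have "0 < \<bar>g x\<bar> * \<beta> (J x)" using False \<beta>(2)[of "J x"] by (intro mult_pos_pos) auto
      then have "a (J x) \<noteq> 0" using est[of x] by (auto simp: a_def[symmetric] \<beta>_def[symmetric])
      then show ?thesis by (simp add: S.T_def k_def a_def[symmetric])
    qed (simp add: S.T_def k_def)
  qed
  then show ?thesis using that[OF S.T_admissible S.couple_op_norm_T] by blast
qed

text \<open>The representations \<open>g = S f\<close> with norm bounds \<open>r\<^sup>4\<close> give the exact estimate in the limit
  \<open>r \<rightarrow> 1\<close>.\<close>

lemma positive_linear_imp_K_monotone: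
  assumes X: "intermediate_space M X nX" and lin: "exact_interpolation_positive_linear M X nX"
  shows "exact_partially_K_monotone M X nX"
  unfolding exact_partially_K_monotone_def
proof (intro ballI impI)
  fix f g assume f: "f \<in> X" and g: "g \<in> Sum_space M" and K: "partially_K_below M g f"
  note XD = intermediate_spaceD[OF X]
  have fS: "f \<in> Sum_space M" using f XD(1) by auto
  have main: "g \<in> X \<and> nX g \<le> r ^ 4 * nX f" if r: "1 < r" for r
  proof -
    obtain S where S: "admissible_positive_linear M S" "couple_op_norm M S \<le> r ^ 4" "AE x in M. S f x = g x"
      by (rule K_below_imp_kernel_operator[OF g fS K r])
    have b: "bounded_on X nX S" and n: "op_norm X nX S \<le> r ^ 4"
      using lin S(1,2) unfolding exact_interpolation_positive_linear_def by (blast intro: order_trans)+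
    have SfX: "S f \<in> X" using b f by (auto simp: bounded_on_def)
    have gX: "g \<in> X" by (rule ae_saturatedD[OF XD(2) SfX Sum_space_measurable[OF g] S(3)])
    have "nX g = nX (S f)" using XD(4)[OF SfX gX S(3)] by simp
    also have "\<dots> \<le> op_norm X nX S * nX f" by (rule op_norm_bound[OF b XD(7) f])
    also have "\<dots> \<le> r ^ 4 * nX f" using n XD(7)[OF f] by (rule mult_right_mono)
    finally show ?thesis using gX by blast
  qed
  have "(\<lambda>n. (1 + inverse (real (Suc n))) ^ 4 * nX f) \<longlonglongrightarrow> (1 + 0) ^ 4 * nX f"
    by (intro tendsto_intros LIMSEQ_inverse_real_of_nat)
  then have "nX g \<le> (1 + 0) ^ 4 * nX f"
    by (rule LIMSEQ_le_const) (use main in auto)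
  moreover have "g \<in> X" using main[of 2] by simp
  ultimately show "g \<in> X \<and> nX g \<le> nX f" by simp
qed

end

theorem theorem1p1:
  fixes M :: "'a measure"
    and X :: "('a \<Rightarrow> real) set"
    and nX :: "('a \<Rightarrow> real) \<Rightarrow> real"
  assumes "sigma_finite_measure M"
    and "intermediate_space M X nX"
  shows "(exact_partially_monotone M X nX \<longleftrightarrow> exact_partially_K_monotone M X nX) \<and>
         (exact_partially_K_monotone M X nX \<longleftrightarrow> exact_interpolation_GP M X nX) \<and>
         (exact_interpolation_GP M X nX \<longleftrightarrow> exact_interpolation_Lipschitz M X nX) \<and>
         (exact_interpolation_Lipschitz M X nX \<longleftrightarrow> exact_interpolation_positive_linear M X nX)"
proof -
  interpret sigma_finite_measure M by fact
  note X = assms(2)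
  have "exact_partially_monotone M X nX \<longleftrightarrow> exact_partially_K_monotone M X nX"
    by (rule exact_partially_monotone_iff[OF intermediate_spaceD(1)[OF X]])
  then show ?thesis
    using K_monotone_imp_GP[OF X] GP_imp_Lipschitz[OF X] Lipschitz_imp_positive_linear[OF X]
      positive_linear_imp_K_monotone[OF X]
    by blast
qed

end
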